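(* Let $W$ be a finite complex reflection group acting on a finite-dimensional complex vector space $V$, with reflection arrangement $\mathcal{A}(W)$. Then $\mathcal{A}(W)$ is supersolvable if and only if every irreducible factor of $W$ satisfies one of the following: it has rank at most $2$; it is isomorphic to a Coxeter group of type $A_\ell$ or $B_\ell$ for some $\ell \ge 3$; or it is isomorphic to a monomial group $G(r,p,\ell)$ for some $r,\ell \ge 3$ and $p \ne r$.
   Context: A finite complex reflection group is a finite subgroup $W\subseteq \mathrm{GL}(V)$, $V$ a finite-dimensional complex vector space, generated by reflections (elements of finite order whose fixed space is a hyperplane); it may be assumed unitary. Its reflection arrangement $\mathcal{A}(W)$ is the set of the fixed hyperplanes of all reflections in $W$. There is a decomposition $V = V^W\oplus V_1\oplus\cdots\oplus V_k$ and $W = W_1\times\cdots\times W_k$, where $W_i$ acts on $V_i$ as an irreducible reflection group and trivially on the other summands; the $W_i$ (acting on $V_i$) are the irreducible factors of $W$, and the rank of $W_i$ is $\dim V_i$. "Isomorphic" means isomorphic as reflection groups. A finite Coxeter group is regarded as a complex reflection group via its complexified reflection representation. For $r,p,\ell\ge 1$ with $p\mid r$, the monomial group $G(r,p,\ell)$ is the group of all $\ell\times\ell$ monomial matrices (exactly one non-zero entry in each row and column) whose non-zero entries are $r$-th roots of unity and such that the product of the non-zero entries is an $(r/p)$-th root of unity. For a finite set $\mathcal{A}$ of linear hyperplanes in $V$, $L(\mathcal{A})$ is the set of all intersections of subsets of $\mathcal{A}$ (with $V$ the empty intersection), ordered by reverse inclusion: $X\le Y$ iff $Y\subseteq X$.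 The rank of $X\in L(\mathcal{A})$ is $\operatorname{codim}_V X$, and $r(\mathcal{A})$ is the rank of the maximal element $T=\bigcap_{H\in\mathcal{A}}H$. An element $X\in L(\mathcal{A})$ is modular if $X+Y\in L(\mathcal{A})$ for all $Y\in L(\mathcal{A})$. $\mathcal{A}$ is supersolvable if there is a maximal chain $V=X_0<X_1<\cdots<X_{r(\mathcal{A})}=T$ in $L(\mathcal{A})$ consisting of modular elements. *)

theory Defs
  imports Complex_Main "HOL-Algebra.Bij" "HOL-Algebra.Generated_Groups"
    "HOL-Algebra.Product_Groups" "Jordan_Normal_Form.Matrix"
begin

text \<open>
  A complex vector space is a type \<open>'v\<close> with a scalar multiplication \<open>scale\<close> forming a
  \<^locale>\<open>vector_space\<close>. Groups act on a subspace \<open>U\<close>, the whole space being \<open>U = UNIV\<close>; as in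
  \<^const>\<open>BijGroup\<close>, a transformation of \<open>U\<close> is a function that is extensional on \<open>U\<close>, which is
  no restriction when \<open>U = UNIV\<close>.
\<close>

definition GL :: "(complex \<Rightarrow> 'v::ab_group_add \<Rightarrow> 'v) \<Rightarrow> 'v set \<Rightarrow> ('v \<Rightarrow> 'v) monoid" where
  "GL scale U = (BijGroup U)\<lparr>carrier :=
     {g \<in> Bij U. (\<forall>x\<in>U. \<forall>y\<in>U. g (x + y) = g x + g y) \<and> (\<forall>c. \<forall>x\<in>U. g (scale c x) = scale c (g x))}\<rparr>"

definition fixed_by :: "'v set \<Rightarrow> ('v \<Rightarrow> 'v) \<Rightarrow> 'v set" where
  "fixed_by U g = {u \<in> U. g u = u}"

definition is_hyperplane :: "(complex \<Rightarrow> 'v::ab_group_add \<Rightarrow> 'v) \<Rightarrow> 'v set \<Rightarrow> 'v set \<Rightarrow> bool" where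
  "is_hyperplane scale U H \<longleftrightarrow> module.subspace scale H \<and> H \<subseteq> U \<and>
     vector_space.dim scale H + 1 = vector_space.dim scale U"

definition is_reflection :: "(complex \<Rightarrow> 'v::ab_group_add \<Rightarrow> 'v) \<Rightarrow> 'v set \<Rightarrow> ('v \<Rightarrow> 'v) \<Rightarrow> bool" where
  "is_reflection scale U g \<longleftrightarrow> g \<in> carrier (GL scale U) \<and>
     (\<exists>n::nat. n > 0 \<and> g [^]\<^bsub>GL scale U\<^esub> n = \<one>\<^bsub>GL scale U\<^esub>) \<and>
     is_hyperplane scale U (fixed_by U g)"

definition finite_reflection_group ::
  "(complex \<Rightarrow> 'v::ab_group_add \<Rightarrow> 'v) \<Rightarrow> 'v set \<Rightarrow> ('v \<Rightarrow> 'v) set \<Rightarrow> bool" where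
  "finite_reflection_group scale U W \<longleftrightarrow> subgroup W (GL scale U) \<and> finite W \<and>
     W = generate (GL scale U) {g \<in> W. is_reflection scale U g}"

definition irreducible_action ::
  "(complex \<Rightarrow> 'v::ab_group_add \<Rightarrow> 'v) \<Rightarrow> 'v set \<Rightarrow> ('v \<Rightarrow> 'v) set \<Rightarrow> bool" where
  "irreducible_action scale U W \<longleftrightarrow> U \<noteq> {0} \<and>
     (\<forall>S. module.subspace scale S \<and> S \<subseteq> U \<and> (\<forall>g\<in>W. g ` S \<subseteq> S) \<longrightarrow> S = {0} \<or> S = U)"

definition fixed_space :: "('v \<Rightarrow> 'v) set \<Rightarrow> 'v set" where
  "fixed_space W = {v. \<forall>g\<in>W. g v = v}"

definition direct_sum_decomposition ::
  "(complex \<Rightarrow> 'v::ab_group_add \<Rightarrow> 'v) \<Rightarrow> 'v set \<Rightarrow> nat \<Rightarrow> (nat \<Rightarrow> 'v set) \<Rightarrow> bool" where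
  "direct_sum_decomposition scale F k U \<longleftrightarrow>
     module.subspace scale F \<and> (\<forall>i<k. module.subspace scale (U i)) \<and>
     (\<forall>v. \<exists>f\<in>F. \<exists>u. (\<forall>i<k. u i \<in> U i) \<and> v = f + (\<Sum>i<k. u i)) \<and>
     (\<forall>f\<in>F. \<forall>u. (\<forall>i<k. u i \<in> U i) \<and> f + (\<Sum>i<k. u i) = 0 \<longrightarrow> f = 0 \<and> (\<forall>i<k. u i = 0))"

text \<open>
  \<open>V = V\<^sup>W \<oplus> V\<^sub>1 \<oplus> \<dots> \<oplus> V\<^sub>k\<close> with \<open>W = W\<^sub>1 \<times> \<dots> \<times> W\<^sub>k\<close> (internal direct product). The \<open>W\<^sub>i\<close> are
  subgroups of \<open>W\<close>, hence act on all of \<open>V\<close>; on \<open>V\<^sup>W\<close> they act trivially because \<open>W\<^sub>i \<subseteq> W\<close>.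
\<close>

definition irreducible_decomposition ::
  "(complex \<Rightarrow> 'v::ab_group_add \<Rightarrow> 'v) \<Rightarrow> ('v \<Rightarrow> 'v) set \<Rightarrow> nat \<Rightarrow> (nat \<Rightarrow> 'v set) \<Rightarrow>
     (nat \<Rightarrow> ('v \<Rightarrow> 'v) set) \<Rightarrow> bool" where
  "irreducible_decomposition scale W k V' W' \<longleftrightarrow>
     direct_sum_decomposition scale (fixed_space W) k V' \<and>
     (\<forall>i<k. subgroup (W' i) (GL scale UNIV) \<and> W' i \<subseteq> W) \<and>
     (\<lambda>g. foldr (\<lambda>i h. g i \<otimes>\<^bsub>GL scale UNIV\<^esub> h) [0..<k] \<one>\<^bsub>GL scale UNIV\<^esub>)
       \<in> iso (product_group {..<k} (\<lambda>i. (GL scale UNIV)\<lparr>carrier := W' i\<rparr>))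
             ((GL scale UNIV)\<lparr>carrier := W\<rparr>) \<and>
     (\<forall>i<k. finite_reflection_group scale (V' i) ((\<lambda>g. restrict g (V' i)) ` W' i) \<and>
            irreducible_action scale (V' i) ((\<lambda>g. restrict g (V' i)) ` W' i)) \<and>
     (\<forall>i<k. \<forall>j<k. j \<noteq> i \<longrightarrow> (\<forall>g\<in>W' i. \<forall>v\<in>V' j. g v = v))"

text \<open>\<open>K\<close>, a group of transformations of the subspace \<open>U\<close>, is an irreducible factor of \<open>W\<close>.\<close>

definition irreducible_factor ::
  "(complex \<Rightarrow> 'v::ab_group_add \<Rightarrow> 'v) \<Rightarrow> ('v \<Rightarrow> 'v) set \<Rightarrow> 'v set \<Rightarrow> ('v \<Rightarrow> 'v) set \<Rightarrow> bool" where
  "irreducible_factor scale W U K \<longleftrightarrow>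
     (\<exists>k V' W'. irreducible_decomposition scale W k V' W' \<and>
        (\<exists>i<k. U = V' i \<and> K = (\<lambda>g. restrict g (V' i)) ` W' i))"

definition reflection_arrangement ::
  "(complex \<Rightarrow> 'v::ab_group_add \<Rightarrow> 'v) \<Rightarrow> ('v \<Rightarrow> 'v) set \<Rightarrow> 'v set set" where
  "reflection_arrangement scale W = {fixed_by UNIV g | g. g \<in> W \<and> is_reflection scale UNIV g}"

definition intersection_lattice :: "'v set set \<Rightarrow> 'v set set" where
  "intersection_lattice A = {\<Inter>B | B. B \<subseteq> A}"

definition codim :: "(complex \<Rightarrow> 'v::ab_group_add \<Rightarrow> 'v) \<Rightarrow> 'v set \<Rightarrow> nat" where
  "codim scale X = vector_space.dim scale (UNIV :: 'v set) - vector_space.dim scale X"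

definition modular_element :: "'v::ab_group_add set set \<Rightarrow> 'v set \<Rightarrow> bool" where
  "modular_element A X \<longleftrightarrow> X \<in> intersection_lattice A \<and>
     (\<forall>Y\<in>intersection_lattice A. {x + y | x y. x \<in> X \<and> y \<in> Y} \<in> intersection_lattice A)"

text \<open>The order of the lattice is reverse inclusion, so the chain descends as a chain of sets.\<close>

definition supersolvable ::
  "(complex \<Rightarrow> 'v::ab_group_add \<Rightarrow> 'v) \<Rightarrow> 'v set set \<Rightarrow> bool" where
  "supersolvable scale A \<longleftrightarrow>
     (\<exists>X :: nat \<Rightarrow> 'v set.
        X 0 = UNIV \<and> X (codim scale (\<Inter>A)) = \<Inter>A \<and>
        (\<forall>i \<le> codim scale (\<Inter>A). modular_element A (X i)) \<and>
        (\<forall>i < codim scale (\<Inter>A). X (Suc i) \<subset> X i \<and>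
           \<not> (\<exists>Y\<in>intersection_lattice A. X (Suc i) \<subset> Y \<and> Y \<subset> X i)))"

text \<open>
  Isomorphism as reflection groups of \<open>K\<close>, acting on \<open>U\<close>, and a group \<open>G\<close> of \<open>l \<times> l\<close>
  matrices: some linear isomorphism \<open>\<phi>\<close> from \<open>U\<close> to the space of column vectors of length \<open>l\<close>
  satisfies \<open>\<phi> K \<phi>\<^sup>-\<^sup>1 = G\<close>.
\<close>

definition isomorphic_reflection_group ::
  "(complex \<Rightarrow> 'v::ab_group_add \<Rightarrow> 'v) \<Rightarrow> 'v set \<Rightarrow> ('v \<Rightarrow> 'v) set \<Rightarrow> nat \<Rightarrow> complex mat set \<Rightarrow> bool" where
  "isomorphic_reflection_group scale U K l G \<longleftrightarrow>
     (\<exists>\<phi> :: 'v \<Rightarrow> complex vec. bij_betw \<phi> U (carrier_vec l) \<and>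
        (\<forall>x\<in>U. \<forall>y\<in>U. \<phi> (x + y) = \<phi> x + \<phi> y) \<and>
        (\<forall>c. \<forall>x\<in>U. \<phi> (scale c x) = c \<cdot>\<^sub>v \<phi> x) \<and>
        (\<lambda>g. \<lambda>v\<in>carrier_vec l. \<phi> (g (inv_into U \<phi> v))) ` K =
        (\<lambda>M. \<lambda>v\<in>carrier_vec l. M *\<^sub>v v) ` G)"

definition monomial_group :: "nat \<Rightarrow> nat \<Rightarrow> nat \<Rightarrow> complex mat set" where
  "monomial_group r p l = {M \<in> carrier_mat l l.
     (\<forall>i<l. \<exists>!j. j < l \<and> M $$ (i, j) \<noteq> 0) \<and>
     (\<forall>j<l. \<exists>!i. i < l \<and> M $$ (i, j) \<noteq> 0) \<and>
     (\<forall>i<l. \<forall>j<l. M $$ (i, j) \<noteq> 0 \<longrightarrow> M $$ (i, j) ^ r = 1) \<and>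
     (\<Prod>ij \<in> {(i, j). i < l \<and> j < l \<and> M $$ (i, j) \<noteq> 0}. M $$ ij) ^ (r div p) = 1}"

text \<open>
  The reflection (geometric) representation of the Coxeter group with Coxeter matrix \<open>m\<close>: with
  \<open>B(e\<^sub>i, e\<^sub>j) = - cos (\<pi> / m i j)\<close>, the generator \<open>s\<^sub>i\<close> acts by \<open>e\<^sub>j \<mapsto> e\<^sub>j - 2 B(e\<^sub>i, e\<^sub>j) e\<^sub>i\<close>. The
  representation is faithful, so the Coxeter group is identified with its image, and it is
  complexified by reading the real matrices as complex ones.
\<close>

definition coxeter_generator :: "(nat \<Rightarrow> nat \<Rightarrow> nat) \<Rightarrow> nat \<Rightarrow> nat \<Rightarrow> complex mat" where
  "coxeter_generator m l i = mat l l (\<lambda>(a, j).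
     (if a = j then 1 else 0) -
     (if a = i then 2 * complex_of_real (- cos (pi / real (m i j))) else 0))"

definition coxeter_group :: "(nat \<Rightarrow> nat \<Rightarrow> nat) \<Rightarrow> nat \<Rightarrow> complex mat set" where
  "coxeter_group m l =
     generate (units_of (ring_mat TYPE(complex) l ())) (coxeter_generator m l ` {..<l})"

definition coxeter_matrix_A :: "nat \<Rightarrow> nat \<Rightarrow> nat" where
  "coxeter_matrix_A i j = (if i = j then 1 else if j = Suc i \<or> i = Suc j then 3 else 2)"

definition coxeter_matrix_B :: "nat \<Rightarrow> nat \<Rightarrow> nat \<Rightarrow> nat" where
  "coxeter_matrix_B l i j =
     (if i = j then 1
      else if j = Suc i \<or> i = Suc j then (if Suc i = l \<or> Suc j = l then 4 else 3)
      else 2)"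

end

theory Submission
  imports Defs "HOL-Combinatorics.Permutations" "Jordan_Normal_Form.Determinant"
begin

text \<open>
  The proof does not use the classification of reflection groups. If the arrangement is
  supersolvable, then each irreducible factor of rank at least 3 has a modular line; its orbit spans
  the space, so there is a basis of modular lines, with dual coordinates \<open>x\<^sub>i\<close>. Sums of modular lines
  are flats, hence all \<open>x\<^sub>i = 0\<close> are reflecting hyperplanes, and modularity of the \<open>i\<close>-th line says that
  two hyperplanes with forms \<open>x\<^sub>i + \<alpha>\<close> and \<open>x\<^sub>i + \<beta>\<close> force one with form \<open>\<alpha> - \<beta>\<close>. After rescaling, the
  numbers \<open>c\<close> such that \<open>x\<^sub>i = c x\<^sub>j\<close> is a reflecting hyperplane therefore form a finite group, the
  \<open>r\<close>-th roots of unity, independent of \<open>i \<noteq> j\<close>, and no form involves three coordinates: the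
  arrangement is that of \<open>G(r,1,l)\<close>. A reflection preserves the arrangement, which determines it up to
  its eigenvalue on the hyperplanes \<open>x\<^sub>i = 0\<close>; this gives type \<open>A\<close> for \<open>r = 1\<close>, type \<open>B\<close> for \<open>r = 2\<close>
  and \<open>G(r,p,l)\<close> with \<open>p \<noteq> r\<close> otherwise. Conversely, these arrangements are built up by adding one
  coordinate at a time.
\<close>

section \<open>Forms and hyperplanes\<close>

text \<open>A chain of modular elements of the whole arrangement yields a modular line in a factor
  at the step where the chain first drops into the complement of that factor's space: the element
  just above is spanned by a part of this complement and one further vector. Two forms sharing x_i
  can be subtracted because adding the i-th line to a flat eliminates x_i from its equations. Three
  coordinates are excluded by absolute value: a form supported on {i,j,k}, combined with one
  supported on {i,j}, would produce a ratio of absolute value 1/2, while all ratios are roots of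
  unity. Rank at least 3 enters because ratios are multiplied through a third index, and because the
  images of short forms under a reflection are tested against the exclusion of three coordinates.
  The condition p \<noteq> r expresses that x_i = 0 is a reflecting hyperplane for r \<ge> 2: the
  eigenvalues occurring on x_i = 0, together with 1, form the group of order m = r/p, so m \<ge> 2.
  For r = 1 the reflection in x_i = 0 is of another kind and exchanges e_i with an additional
  vector, the negative sum of all e_j.\<close>

locale cspace = finite_dimensional_vector_space scale Basis
  for scale :: "complex \<Rightarrow> 'v::ab_group_add \<Rightarrow> 'v" (infixr \<open>*s\<close> 75) and Basis :: "'v set"
begin

definition lform :: "('v \<Rightarrow> complex) \<Rightarrow> bool" where
  "lform f \<longleftrightarrow> (\<forall>u v. f (u + v) = f u + f v) \<and> (\<forall>c u. f (c *s u) = c * f u)"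

definition lin :: "('v \<Rightarrow> 'v) \<Rightarrow> bool" where
  "lin g \<longleftrightarrow> (\<forall>u v. g (u + v) = g u + g v) \<and> (\<forall>c u. g (c *s u) = c *s g u)"

lemma lform_add: "lform f \<Longrightarrow> f (u + v) = f u + f v"
  and lform_scale: "lform f \<Longrightarrow> f (c *s u) = c * f u"
  by (auto simp: lform_def)

lemma lform_0: "lform f \<Longrightarrow> f 0 = 0"
  using lform_scale[of f 0 0] by simp

lemma lform_diff: "lform f \<Longrightarrow> f (u - v) = f u - f v"
  using lform_add[of f u "- v"] lform_scale[of f "-1" v] by simp

lemma lform_neg: "lform f \<Longrightarrow> f (- v) = - f v"
  using lform_diff[of f 0 v] lform_0[of f] by simp

lemma lform_sum: "lform f \<Longrightarrow> f (\<Sum>i\<in>I. h i) = (\<Sum>i\<in>I. f (h i))"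
  by (induction I rule: infinite_finite_induct) (auto simp: lform_0 lform_add)

lemmas lform_simps = lform_add lform_scale lform_0 lform_diff lform_neg lform_sum

lemma lin_add: "lin f \<Longrightarrow> f (u + v) = f u + f v"
  and lin_scale: "lin f \<Longrightarrow> f (c *s u) = c *s f u"
  by (auto simp: lin_def)

lemma lin_0: "lin f \<Longrightarrow> f 0 = 0"
  using lin_scale[of f 0 0] by simp

lemma lin_diff: "lin f \<Longrightarrow> f (u - v) = f u - f v"
  using lin_add[of f u "- v"] lin_scale[of f "-1" v] by simp

lemma lin_neg: "lin f \<Longrightarrow> f (- v) = - f v"
  using lin_diff[of f 0 v] lin_0[of f] by simp

lemma lin_sum: "lin f \<Longrightarrow> f (\<Sum>i\<in>I. h i) = (\<Sum>i\<in>I. f (h i))"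
  by (induction I rule: infinite_finite_induct) (auto simp: lin_0 lin_add)

lemmas lin_simps = lin_add lin_scale lin_0 lin_diff lin_neg lin_sum

lemma lin_comp: "lin f \<Longrightarrow> lin g \<Longrightarrow> lin (f \<circ> g)"
  by (simp add: lin_def)

lemma lin_id: "lin id"
  by (simp add: lin_def)

lemma lin_inv: assumes "lin g" "bij g" shows "lin (inv_into UNIV g)"
proof -
  have "inv_into UNIV g (u + v) = inv_into UNIV g u + inv_into UNIV g v" for u v
    using assms by (metis bij_inv_eq_iff lin_add)
  moreover have "inv_into UNIV g (c *s u) = c *s inv_into UNIV g u" for c u
    using assms by (metis bij_inv_eq_iff lin_scale)
  ultimately show ?thesis by (simp add: lin_def)
qed

lemma lform_comp: "lform f \<Longrightarrow> lin g \<Longrightarrow> lform (\<lambda>v. f (g v))"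
  by (simp add: lin_def lform_def)

lemma lin_transvection: "lform f \<Longrightarrow> lin (\<lambda>u. u + f u *s v)"
  by (auto simp: lin_def lform_def algebra_simps scale_left_distrib scale_right_distrib)

lemma subspace_ker: "lform f \<Longrightarrow> subspace {v. f v = 0}"
  by (auto simp: subspace_def lform_simps)

lemma subspace_fixed: "lin g \<Longrightarrow> subspace {v. g v = v}"
  by (auto simp: subspace_def lin_simps)

text \<open>A vector \<open>w\<close> with \<open>f w \<noteq> 0\<close> spans a complement of the
  kernel of \<open>f\<close>, so \<open>g\<close> is \<open>f\<close> scaled by
  \<open>g w / f w\<close>; if \<open>f\<close> is zero, the inclusion makes \<open>g\<close> zero
  as well.\<close>

lemma lform_ker_subset:
  assumes f: "lform f" and g: "lform g" and sub: "{v. f v = 0} \<subseteq> {v. g v = 0}"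
  shows "\<exists>c. \<forall>v. g v = c * f v"
proof (cases "\<exists>w. f w \<noteq> 0")
  case True
  then obtain w where w: "f w \<noteq> 0" by blast
  have "g v = (g w / f w) * f v" for v
  proof -
    have "f (v - (f v / f w) *s w) = 0"
      using f w by (simp add: lform_simps)
    then have "g (v - (f v / f w) *s w) = 0"
      using sub by blast
    then show ?thesis
      using g by (simp add: lform_simps)
  qed
  then show ?thesis by blast
next
  case False
  then show ?thesis using sub by auto
qed

text \<open>A basis of \<open>H\<close> together with \<open>w\<close> is independent and extends to
  a basis of the whole space; the form is the coordinate at \<open>w\<close>.\<close>

lemma separating_form:
  assumes "subspace H" "w \<notin> H"
  obtains f where "lform f" "f w = 1" "\<And>h. h \<in> H \<Longrightarrow> f h = 0"
proof -
  obtain B where B: "B \<subseteq> H" "independent B" "H \<subseteq> span B"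
    using basis_exists by metis
  have spB: "span B = H"
    using B assms(1) span_minimal by blast
  have ind: "independent (insert w B)"
    using B(2) assms(2) spB by (simp add: independent_insertI)
  define E where "E = extend_basis (insert w B)"
  have E: "independent E" "span E = UNIV" "insert w B \<subseteq> E"
    using independent_extend_basis[OF ind] span_extend_basis[OF ind] extend_basis_superset[OF ind]
    by (auto simp: E_def)
  define f where "f v = representation E v w" for v
  have lf: "lform f"
    unfolding lform_def f_def using E by (simp add: representation_add representation_scale)
  have fw: "f w = 1"
    unfolding f_def using E by (simp add: representation_basis)
  have wB: "w \<notin> B" using spB assms(2) span_superset by blast
  have fB: "f b = 0" if "b \<in> B" for b
    unfolding f_def using E that wB by (subst representation_basis) auto
  have "f h = 0" if "h \<in> H" for h
  proof -
    have "B \<subseteq> {v. f v = 0}" using fB by auto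
    then show ?thesis
      using span_minimal[OF _ subspace_ker[OF lf]] that spB by blast
  qed
  then show thesis using that lf fw by blast
qed

text \<open>Hyperplanes of the whole space given by a defining form instead of a dimension;
  \<open>is_hyperplane_UNIV\<close> is the link to \<open>is_hyperplane\<close>.\<close>

definition hyp :: "'v set \<Rightarrow> bool" where
  "hyp H \<longleftrightarrow> (\<exists>f. lform f \<and> (\<exists>v. f v \<noteq> 0) \<and> H = {v. f v = 0})"

text \<open>Forms are taken on the whole space even when \<open>U\<close> is a proper subspace. A
  form separating \<open>w\<close> in \<open>U\<close> from \<open>H\<close> vanishes on no further
  vector of \<open>U\<close>, since \<open>w\<close> and \<open>H\<close> span \<open>U\<close> by
  dimension; conversely, subtracting multiples of \<open>w\<close> shows that the codimension is
  one.\<close>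

lemma is_hyperplane_iff:
  assumes U: "subspace U"
  shows "is_hyperplane scale U H \<longleftrightarrow>
    (\<exists>f. lform f \<and> (\<exists>u\<in>U. f u \<noteq> 0) \<and> H = {u \<in> U. f u = 0})" (is "?L \<longleftrightarrow> ?R")
proof
  assume L: ?L
  then have H: "subspace H" "H \<subseteq> U" "dim H + 1 = dim U"
    by (auto simp: is_hyperplane_def)
  then have "H \<noteq> U" by auto
  then obtain w where w: "w \<in> U" "w \<notin> H" using H(2) by blast
  obtain f where f: "lform f" "f w = 1" "\<And>h. h \<in> H \<Longrightarrow> f h = 0"
    using separating_form[OF H(1) w(2)] by blast
  have "dim (span (insert w H)) = dim U"
    using H w by (simp add: dim_insert span_eq_iff[THEN iffD2, OF H(1)])
  moreover have "span (insert w H) \<subseteq> U"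
    using span_minimal[OF _ U] H(2) w(1) by blast
  ultimately have sp: "span (insert w H) = U"
    using subspace_dim_equal[OF subspace_span U] by simp
  have "u \<in> H" if "u \<in> U" "f u = 0" for u
  proof -
    obtain k where "u - k *s w \<in> span H"
      using \<open>u \<in> U\<close> sp span_breakdown_eq[of u w H] by auto
    then have k: "u - k *s w \<in> H" using span_eq_iff H(1) by blast
    then have "f (u - k *s w) = 0" using f(3) by blast
    then have "k = 0" using that(2) f by (simp add: lform_simps)
    then show ?thesis using k by simp
  qed
  then have "H = {u \<in> U. f u = 0}" using H(2) f(3) by blast
  moreover have "f w \<noteq> 0" using f(2) by simp
  ultimately show ?R using f(1) w(1) by blast
next
  assume ?R
  then obtain f w where f: "lform f" "w \<in> U" "f w \<noteq> 0" and HH: "H = {u \<in> U. f u = 0}" by blast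
  have H: "subspace H" unfolding HH using subspace_inter[OF U subspace_ker[OF f(1)]]
    by (simp add: Int_def)
  have spH: "span H = H" using H span_eq_iff by blast
  have w: "w \<notin> span H" unfolding spH using HH f by simp
  have "U \<subseteq> span (insert w H)"
  proof
    fix u assume "u \<in> U"
    then have "u - (f u / f w) *s w \<in> H"
      using f U by (auto simp: HH lform_simps subspace_diff subspace_scale)
    then show "u \<in> span (insert w H)"
      using span_breakdown_eq[of u w H] span_base[of _ H] by auto
  qed
  then have "span (insert w H) = U"
    using span_minimal[OF _ U, of "insert w H"] HH f(2) by blast
  then have "dim U = dim (insert w H)" using dim_span by metis
  then have "dim H + 1 = dim U" using w by (simp add: dim_insert)
  then show ?L using H HH by (auto simp: is_hyperplane_def)
qed

lemma is_hyperplane_UNIV: "is_hyperplane scale UNIV H \<longleftrightarrow> hyp H"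
  using is_hyperplane_iff[OF subspace_UNIV] by (simp add: hyp_def)

lemma hyp_subspace: "hyp H \<Longrightarrow> subspace H"
  unfolding hyp_def using subspace_ker by blast

lemma hyp_subset_eq: assumes "hyp H" "hyp H'" "H \<subseteq> H'" shows "H = H'"
proof -
  obtain f where f: "lform f" "\<exists>v. f v \<noteq> 0" "H = {v. f v = 0}" using assms(1) hyp_def by auto
  obtain f' where f': "lform f'" "\<exists>v. f' v \<noteq> 0" "H' = {v. f' v = 0}" using assms(2) hyp_def by auto
  obtain c where c: "\<And>v. f' v = c * f v" using lform_ker_subset[OF f(1) f'(1)] assms(3) f f' by auto
  then have "c \<noteq> 0" using f'(2) by auto
  then show ?thesis using f f' c by auto
qed

text \<open>A vector off a hyperplane spans a complement of it; the eliminations with flats below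
  are instances of this shift.\<close>

lemma hyp_shift: assumes "hyp H" "w \<notin> H" obtains t where "u - t *s w \<in> H"
proof -
  obtain f where f: "lform f" "\<exists>v. f v \<noteq> 0" "H = {v. f v = 0}" using assms(1) hyp_def by auto
  have "u - (f u / f w) *s w \<in> H" using f assms(2) by (auto simp: lform_simps)
  then show thesis using that by blast
qed

text \<open>Exchange inside a pencil: if \<open>H1 \<inter> H3\<close> had a vector \<open>v\<close>
  outside \<open>H2\<close>, every vector of \<open>H1\<close> could be shifted along
  \<open>v\<close> into \<open>H1 \<inter> H2\<close>, hence would lie in \<open>H3\<close>, and
  then \<open>H1 = H3\<close>.\<close>

lemma hyp_Int_subset:
  assumes "hyp H1" "hyp H2" "hyp H3" "H1 \<inter> H2 \<subseteq> H3" "H3 \<noteq> H1"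
  shows "H1 \<inter> H3 \<subseteq> H2"
proof
  fix v assume v: "v \<in> H1 \<inter> H3"
  show "v \<in> H2"
  proof (rule ccontr)
    assume n: "v \<notin> H2"
    have "H1 \<subseteq> H3"
    proof
      fix u assume u: "u \<in> H1"
      obtain t where t: "u - t *s v \<in> H2" using hyp_shift[OF assms(2) n] by blast
      then have "u - t *s v \<in> H1 \<inter> H2"
        using u v hyp_subspace[OF assms(1)] by (auto simp: subspace_diff subspace_scale)
      then have "u - t *s v \<in> H3" using assms(4) by blast
      then show "u \<in> H3" using v hyp_subspace[OF assms(3)]
        by (metis IntE diff_add_cancel subspace_add subspace_scale)
    qed
    then show False using hyp_subset_eq[OF assms(1,3)] assms(5) by blast
  qed
qed

end

section \<open>Supersolvability by levels\<close>

text \<open>Each step adds one level of a partition in the sense of Bjorner--Edelman--Ziegler.\<close>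

inductive (in cspace) ss :: "'v set set \<Rightarrow> bool" where
  empty: "ss {}"
| step: "ss (A \<union> N)" if "ss A" "N \<noteq> {}" "\<And>H. H \<in> N \<Longrightarrow> hyp H" "\<And>H. H \<in> N \<Longrightarrow> \<not> \<Inter>A \<subseteq> H"
    "\<And>H1 H2. \<lbrakk>H1 \<in> N; H2 \<in> N; H1 \<noteq> H2\<rbrakk> \<Longrightarrow> \<exists>H3\<in>A. H1 \<inter> H2 \<subseteq> H3"

context cspace
begin

abbreviation setsum :: "'v set \<Rightarrow> 'v set \<Rightarrow> 'v set" (infixl \<open>\<boxplus>\<close> 65) where
  "X \<boxplus> Y \<equiv> {x + y | x y. x \<in> X \<and> y \<in> Y}"

lemma setsum_assoc: "X \<boxplus> Y \<boxplus> Z = X \<boxplus> (Y \<boxplus> Z)"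
proof (intro subset_antisym subsetI)
  fix v assume "v \<in> X \<boxplus> Y \<boxplus> Z"
  then obtain x y z where "v = x + y + z" "x \<in> X" "y \<in> Y" "z \<in> Z" by auto
  then show "v \<in> X \<boxplus> (Y \<boxplus> Z)" by (auto simp: add.assoc)
next
  fix v assume "v \<in> X \<boxplus> (Y \<boxplus> Z)"
  then obtain x y z where "v = (x + y) + z" "x \<in> X" "y \<in> Y" "z \<in> Z" by (auto simp: add.assoc)
  then show "v \<in> X \<boxplus> Y \<boxplus> Z" by blast
qed

lemma setsum_comm: "X \<boxplus> Y = Y \<boxplus> X"
  by (auto; metis add.commute)

lemma ss_hyp: "ss A \<Longrightarrow> H \<in> A \<Longrightarrow> hyp H"
  by (induction rule: ss.induct) auto

lemma subspace_INT_hyp: "(\<And>H. H \<in> B \<Longrightarrow> hyp H) \<Longrightarrow> subspace (\<Inter>B)"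
  by (rule subspace_Inter) (auto simp: hyp_subspace)

lemma setsum_absorb: "subspace X \<Longrightarrow> Z \<subseteq> X \<Longrightarrow> 0 \<in> Z \<Longrightarrow> X \<boxplus> Z = X"
  by (auto simp: subspace_add) (metis add.right_neutral)

lemma intersection_lattice_mono: "A \<subseteq> B \<Longrightarrow> intersection_lattice A \<subseteq> intersection_lattice B"
  by (auto simp: intersection_lattice_def)

text \<open>This is the modularity of \<open>\<Inter>A\<close> in the enlarged arrangement. If
  \<open>Y\<close> uses a hyperplane \<open>H1\<close> of the new level, a vector \<open>w\<close>
  of \<open>\<Inter>A\<close> outside \<open>H1\<close> moves any vector into \<open>H1\<close>; the
  other new hyperplanes can then be replaced by members of \<open>A\<close> in the same
  pencils.\<close>

lemma level_elimination:
  assumes A: "\<And>H. H \<in> A \<Longrightarrow> hyp H" and N: "\<And>H. H \<in> N \<Longrightarrow> hyp H" "\<And>H. H \<in> N \<Longrightarrow> \<not> \<Inter>A \<subseteq> H"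
    and ex: "\<And>H1 H2. \<lbrakk>H1 \<in> N; H2 \<in> N; H1 \<noteq> H2\<rbrakk> \<Longrightarrow> \<exists>H3\<in>A. H1 \<inter> H2 \<subseteq> H3"
    and Y: "Y \<in> intersection_lattice (A \<union> N)"
  shows "\<Inter>A \<boxplus> Y \<in> intersection_lattice A"
proof -
  obtain B where B: "B \<subseteq> A \<union> N" "Y = \<Inter>B" using Y by (auto simp: intersection_lattice_def)
  have subA: "subspace (\<Inter>A)" using A by (rule subspace_INT_hyp)
  have subY: "subspace Y" using B A N(1) by (auto intro!: subspace_INT_hyp)
  show ?thesis
  proof (cases "B \<subseteq> A")
    case True
    have "\<Inter>A \<boxplus> Y = Y"
      unfolding setsum_comm[of "\<Inter>A"]
      by (rule setsum_absorb[OF subY]) (use True B subspace_0[OF subA] in auto)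
    then show ?thesis using True B by (auto simp: intersection_lattice_def)
  next
    case False
    then obtain H1 where H1: "H1 \<in> B" "H1 \<in> N" using B by blast
    then obtain w where w: "w \<in> \<Inter>A" "w \<notin> H1" using N(2) by blast
    \<comment> \<open>The old hyperplanes passing through the intersection of \<open>H1\<close> with
      a member of \<open>B\<close>; they contain both \<open>\<Inter>A\<close> and \<open>Y\<close>,
      so they bound the sum from above.\<close>
    define E where "E = {H3\<in>A. \<exists>H2\<in>B. H1 \<inter> H2 \<subseteq> H3}"
    have H1A: "H1 \<notin> A" using w by blast
    have "\<Inter>A \<boxplus> Y = \<Inter>(E \<union> (B \<inter> A))"
    proof
      show "\<Inter>A \<boxplus> Y \<subseteq> \<Inter>(E \<union> (B \<inter> A))"
      proof clarify
        fix a y H assume a: "a \<in> \<Inter>A" and y: "y \<in> Y" and H: "H \<in> E \<union> (B \<inter> A)"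
        have "y \<in> H" using y H B H1 by (auto simp: E_def)
        moreover have "a \<in> H" "H \<in> A" using a H by (auto simp: E_def)
        ultimately show "a + y \<in> H" using hyp_subspace[OF A] by (auto simp: subspace_add)
      qed
      show "\<Inter>(E \<union> (B \<inter> A)) \<subseteq> \<Inter>A \<boxplus> Y"
      proof
        fix v assume v: "v \<in> \<Inter>(E \<union> (B \<inter> A))"
        obtain t where t: "v - t *s w \<in> H1" using hyp_shift[OF N(1)[OF H1(2)] w(2)] by blast
        have tw: "t *s w \<in> \<Inter>A" using w(1) subA subspace_scale by blast
        have vA: "v - t *s w \<in> H" if "H \<in> A" "v \<in> H" for H
          using that tw hyp_subspace[OF A[OF that(1)]] by (auto intro!: subspace_diff)
        have "v - t *s w \<in> H" if HB: "H \<in> B" for H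
        proof (cases "H \<in> A")
          case True then show ?thesis using vA v HB by blast
        next
          case False
          then have HN: "H \<in> N" using HB B by blast
          show ?thesis
          proof (cases "H = H1")
            case False
            then obtain H3 where H3: "H3 \<in> A" "H1 \<inter> H \<subseteq> H3" using ex[OF H1(2) HN] by blast
            then have "v - t *s w \<in> H3" using vA v HB by (auto simp: E_def)
            \<comment> \<open>Within the pencil of \<open>H1\<close> and \<open>H\<close>, the old
              member \<open>H3\<close> together with \<open>H1\<close> determines \<open>H\<close>
              again.\<close>
            moreover have "H1 \<inter> H3 \<subseteq> H"
              using hyp_Int_subset[OF N(1)[OF H1(2)] N(1)[OF HN] A[OF H3(1)] H3(2)] H3 H1A by blast
            ultimately show ?thesis using t by blast
          qed (use t in simp)
        qed
        then have "v - t *s w \<in> Y" using B by blast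
        then show "v \<in> \<Inter>A \<boxplus> Y" using tw by (intro CollectI exI[of _ "t *s w"] exI[of _ "v - t *s w"]) auto
      qed
    qed
    then show ?thesis unfolding intersection_lattice_def
      by (intro CollectI exI[of _ "E \<union> (B \<inter> A)"]) (auto simp: E_def)
  qed
qed

text \<open>On \<open>\<Inter>A\<close> all hyperplanes of the level cut out the same subspace,
  because any two of them meet inside a member of \<open>A\<close>; hence one level raises the rank
  by exactly one.\<close>

lemma level_Inter:
  assumes A: "\<And>H. H \<in> A \<Longrightarrow> hyp H" and N: "\<And>H. H \<in> N \<Longrightarrow> hyp H" "\<And>H. H \<in> N \<Longrightarrow> \<not> \<Inter>A \<subseteq> H"
    and ex: "\<And>H1 H2. \<lbrakk>H1 \<in> N; H2 \<in> N; H1 \<noteq> H2\<rbrakk> \<Longrightarrow> \<exists>H3\<in>A. H1 \<inter> H2 \<subseteq> H3"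
    and H: "H \<in> N"
  shows "\<Inter>(A \<union> N) = \<Inter>A \<inter> H"
proof -
  have "\<Inter>A \<inter> H \<subseteq> H'" if H': "H' \<in> N" for H'
  proof (cases "H' = H")
    case False
    then obtain H3 where H3: "H3 \<in> A" "H \<inter> H' \<subseteq> H3" using ex[OF H H'] by blast
    then have "H3 \<noteq> H" using N(2)[OF H] by blast
    then show ?thesis
      using hyp_Int_subset[OF N(1)[OF H] N(1)[OF H'] A[OF H3(1)] H3(2)] H3(1) by blast
  qed auto
  then show ?thesis using H by blast
qed

lemma dim_Int_hyp:
  assumes X: "subspace X" and H: "hyp H" and n: "\<not> X \<subseteq> H"
  shows "dim (X \<inter> H) + 1 = dim X"
proof -
  obtain f where f: "lform f" "\<exists>v. f v \<noteq> 0" "H = {v. f v = 0}" using H hyp_def by auto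
  then have "is_hyperplane scale X (X \<inter> H)"
    unfolding is_hyperplane_iff[OF X] using n by (intro exI[of _ f]) auto
  then show ?thesis by (simp add: is_hyperplane_def)
qed

text \<open>The chain for \<open>A\<close> is prolonged by \<open>\<Inter>(A \<union> N)\<close>.
  Old chain members stay modular because \<open>X i \<boxplus> Y\<close> equals
  \<open>X i \<boxplus> (\<Inter>A \<boxplus> Y)\<close>, where the inner sum is a flat of
  \<open>A\<close> by \<open>level_elimination\<close>.\<close>

lemma ss_supersolvable: "ss A \<Longrightarrow> supersolvable scale A"
proof (induction rule: ss.induct)
  case empty
  have "\<exists>x y. u = x + y" for u :: 'v
    by (rule exI[of _ 0], rule exI[of _ u]) simp
  then show ?case
    by (auto simp: supersolvable_def codim_def modular_element_def intersection_lattice_def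
      intro!: exI[of _ "\<lambda>_. UNIV"])
next
  case (step A N)
  note hA = ss_hyp[OF step(1)]
  have elim: "\<Inter>A \<boxplus> Y \<in> intersection_lattice A" if "Y \<in> intersection_lattice (A \<union> N)" for Y
    using hA step(3,4,5) that by (rule level_elimination)
  obtain X where XX: "X 0 = UNIV \<and> X (codim scale (\<Inter>A)) = \<Inter>A \<and>
        (\<forall>i \<le> codim scale (\<Inter>A). modular_element A (X i)) \<and>
        (\<forall>i < codim scale (\<Inter>A). X (Suc i) \<subset> X i \<and>
           \<not> (\<exists>Y\<in>intersection_lattice A. X (Suc i) \<subset> Y \<and> Y \<subset> X i))"
    using step.IH unfolding supersolvable_def by (elim exE)
  then have X: "X 0 = UNIV" "X (codim scale (\<Inter>A)) = \<Inter>A"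
    and Xm: "\<And>i. i \<le> codim scale (\<Inter>A) \<Longrightarrow> modular_element A (X i)"
    and Xc: "\<And>i. i < codim scale (\<Inter>A) \<Longrightarrow> X (Suc i) \<subset> X i"
      "\<And>i Y. i < codim scale (\<Inter>A) \<Longrightarrow> Y \<in> intersection_lattice A \<Longrightarrow> X (Suc i) \<subset> Y \<Longrightarrow> \<not> Y \<subset> X i"
    by simp_all
  let ?n = "codim scale (\<Inter>A)"
  obtain H where H: "H \<in> N" using step by blast
  have I: "\<Inter>(A \<union> N) = \<Inter>A \<inter> H" using hA step(3,4,5) H by (rule level_Inter)
  have subA: "subspace (\<Inter>A)" using hA by (rule subspace_INT_hyp)
  have d: "dim (\<Inter>A \<inter> H) + 1 = dim (\<Inter>A)"
    using dim_Int_hyp[OF subA step(3)[OF H] step(4)[OF H]] .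
  have "dim (\<Inter>A) \<le> dim UNIV" using dim_subset by blast
  then have cod: "codim scale (\<Inter>(A \<union> N)) = Suc ?n"
    unfolding codim_def I using d by simp
  define X' where "X' i = (if i \<le> ?n then X i else \<Inter>(A \<union> N))" for i
  have hAN: "hyp K" if "K \<in> A \<union> N" for K using that hA step(3) by blast
  have subL: "subspace Y" if "Y \<in> intersection_lattice (A \<union> N)" for Y
    using that hAN by (auto simp: intersection_lattice_def intro!: subspace_INT_hyp)
  have A_L: "intersection_lattice A \<subseteq> intersection_lattice (A \<union> N)"
    by (rule intersection_lattice_mono) simp
  have L_absorb: "Y \<boxplus> \<Inter>B = Y" if "Y \<in> intersection_lattice B" "B \<subseteq> A \<union> N" for Y B
  proof (rule setsum_absorb)
    show "subspace Y" using subL that intersection_lattice_mono by blast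
    show "\<Inter>B \<subseteq> Y" using that(1) by (auto simp: intersection_lattice_def)
    show "0 \<in> \<Inter>B" using that(2) hAN hyp_subspace subspace_0 by blast
  qed
  have modX: "modular_element (A \<union> N) (X i)" if "i \<le> ?n" for i
    unfolding modular_element_def
  proof (intro conjI ballI)
    have XL: "X i \<in> intersection_lattice A" using Xm[OF that] by (simp add: modular_element_def)
    then show "X i \<in> intersection_lattice (A \<union> N)" using A_L by blast
    fix Y assume Y: "Y \<in> intersection_lattice (A \<union> N)"
    have "X i \<boxplus> Y = X i \<boxplus> (\<Inter>A \<boxplus> Y)"
      using L_absorb[OF XL] setsum_assoc[of "X i" "\<Inter>A" Y] by simp
    also have "\<dots> \<in> intersection_lattice A"
      using Xm[OF that] unfolding modular_element_def by (rule conjE) (erule bspec[OF _ elim[OF Y]])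
    finally show "X i \<boxplus> Y \<in> intersection_lattice (A \<union> N)" using A_L by blast
  qed
  have modT: "modular_element (A \<union> N) (\<Inter>(A \<union> N))"
    unfolding modular_element_def
  proof (intro conjI ballI)
    show "\<Inter>(A \<union> N) \<in> intersection_lattice (A \<union> N)" by (auto simp: intersection_lattice_def)
    fix Y assume Y: "Y \<in> intersection_lattice (A \<union> N)"
    then show "\<Inter>(A \<union> N) \<boxplus> Y \<in> intersection_lattice (A \<union> N)"
      using L_absorb[OF Y] setsum_comm[of Y "\<Inter>(A \<union> N)"] by simp
  qed
  show ?case unfolding supersolvable_def cod
  proof (intro exI[of _ X'] conjI allI impI)
    show "X' 0 = UNIV" using X by (simp add: X'_def)
    show "X' (Suc ?n) = \<Inter>(A \<union> N)" by (simp add: X'_def)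
    fix i
    show "modular_element (A \<union> N) (X' i)" if "i \<le> Suc ?n"
      using modX modT by (simp add: X'_def)
    assume i: "i < Suc ?n"
    show "X' (Suc i) \<subset> X' i"
    proof (cases "i = ?n")
      case True
      then show ?thesis using X(2) I step(4)[OF H] by (auto simp: X'_def)
    next
      case False
      then show ?thesis using Xc(1)[of i] i by (simp add: X'_def)
    qed
    show "\<not> (\<exists>Y\<in>intersection_lattice (A \<union> N). X' (Suc i) \<subset> Y \<and> Y \<subset> X' i)"
    proof (rule notI, elim bexE conjE)
      fix Y assume Y: "Y \<in> intersection_lattice (A \<union> N)" "X' (Suc i) \<subset> Y" "Y \<subset> X' i"
      show False
      proof (cases "i = ?n")
        case True
        then have Y2: "\<Inter>A \<inter> H \<subset> Y" "Y \<subset> \<Inter>A" using Y X(2) I by (auto simp: X'_def)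
        then obtain y where y: "y \<in> Y" "y \<notin> H" by blast
        \<comment> \<open>A vector \<open>y\<close> of \<open>Y\<close> outside \<open>H\<close> and
          the part of \<open>\<Inter>A\<close> inside \<open>H\<close> generate
          \<open>\<Inter>A\<close>, so nothing fits between the last two chain members.\<close>
        have "\<Inter>A \<subseteq> Y"
        proof
          fix z assume z: "z \<in> \<Inter>A"
          obtain t where t: "z - t *s y \<in> H" using hyp_shift[OF step(3)[OF H] y(2)] by blast
          have "t *s y \<in> \<Inter>A" using y Y2 subA subspace_scale by blast
          then have "z - t *s y \<in> \<Inter>A" using z subA subspace_diff by blast
          then have "z - t *s y \<in> Y" using t Y2 by blast
          then have "(z - t *s y) + t *s y \<in> Y" using subL[OF Y(1)] y(1) subspace_add subspace_scale by blast
          then show "z \<in> Y" by simp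
        qed
        then show False using Y2 by blast
      next
        case False
        then have i': "i < ?n" using i by simp
        have "X (Suc i) \<in> intersection_lattice A"
          using Xm[of "Suc i"] i' by (simp add: modular_element_def)
        then have "\<Inter>A \<subseteq> X (Suc i)" by (auto simp: intersection_lattice_def)
        \<comment> \<open>A flat between two old chain members contains \<open>\<Inter>A\<close>, so
          elimination makes it a flat of \<open>A\<close>, where the old chain has no gap.\<close>
        then have "\<Inter>A \<subseteq> Y" using Y i' by (auto simp: X'_def)
        then have "Y \<boxplus> \<Inter>A = Y" using setsum_absorb[OF subL[OF Y(1)]] subspace_0[OF subA] by blast
        then have "Y \<in> intersection_lattice A" using elim[OF Y(1)] setsum_comm[of Y "\<Inter>A"] by simp
        then show False using Xc(2)[OF i', of Y] Y i' by (auto simp: X'_def)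
      qed
    qed
  qed
qed

text \<open>The condition on sums says that the two arrangements live on complementary spaces. The
  levels of \<open>B\<close> are put on top of \<open>A\<close>: a vector showing that a hyperplane
  is new over \<open>B\<close> can be corrected so as to lie in \<open>\<Inter>A\<close> as
  well.\<close>

lemma ss_union:
  assumes "ss B" "ss A" "\<And>v. \<exists>a\<in>\<Inter>A. \<exists>b\<in>\<Inter>B. v = a + b"
  shows "ss (A \<union> B)"
  using assms(1,3)
proof (induction rule: ss.induct)
  case empty then show ?case using assms(2) by simp
next
  case (step B N)
  have IH: "ss (A \<union> B)"
  proof (rule step(6))
    fix v
    obtain a b where "a \<in> \<Inter>A" "b \<in> \<Inter>(B \<union> N)" "v = a + b" using step(7) by blast
    then show "\<exists>a\<in>\<Inter>A. \<exists>b\<in>\<Inter>B. v = a + b" by blast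
  qed
  have "ss ((A \<union> B) \<union> N)"
  proof (rule ss.step[OF IH step(2)])
    fix H assume H: "H \<in> N"
    then show "hyp H" by (rule step)
    obtain x where x: "x \<in> \<Inter>B" "x \<notin> H" using step(4)[OF H] by blast
    obtain a b where ab: "a \<in> \<Inter>A" "b \<in> \<Inter>(B \<union> N)" "x = a + b" using step(7) by blast
    \<comment> \<open>\<open>b\<close> lies in every hyperplane of \<open>B \<union> N\<close>, so
      subtracting it from \<open>x\<close> preserves membership in \<open>\<Inter>B\<close> and
      avoidance of \<open>H\<close>.\<close>
    have "a = x - b" using ab by simp
    then have "a \<in> \<Inter>B"
      using x(1) ab(2) hyp_subspace[OF ss_hyp[OF step(1)]] by (auto intro!: subspace_diff)
    moreover have "a \<notin> H" using ab x H hyp_subspace[OF step(3)[OF H]] subspace_add by blast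
    ultimately show "\<not> \<Inter>(A \<union> B) \<subseteq> H" using ab(1) by blast
  qed (use step(5) in blast)
  then show ?case by (simp add: Un_assoc)
qed

end

section \<open>Coefficients with respect to a basis of modular lines\<close>

text \<open>Multiplication by an element \<open>z\<close> permutes \<open>S\<close>, so the product
  of all elements is multiplied by \<open>z ^ card S\<close> and yet unchanged. As there are only
  \<open>card S\<close> roots of unity of that order, \<open>S\<close> is all of them.\<close>

lemma finite_mult_closed_roots_of_unity:
  fixes S :: "complex set"
  assumes fin: "finite S" and ne: "S \<noteq> {}" and "0 \<notin> S" and cl: "\<And>x y. x \<in> S \<Longrightarrow> y \<in> S \<Longrightarrow> x * y \<in> S"
  shows "S = {z. z ^ card S = 1}" "card S > 0"
proof -
  show pos: "card S > 0" using fin ne by (simp add: card_gt_0_iff)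
  have "z ^ card S = 1" if z: "z \<in> S" for z
  proof -
    have nz: "z \<noteq> 0" using z assms(3) by blast
    have inj: "inj_on (\<lambda>w. z * w) S" using nz by (auto intro: inj_onI)
    have im: "(\<lambda>w. z * w) ` S = S"
      by (rule card_subset_eq[OF fin]) (use cl z inj in \<open>auto simp: card_image\<close>)
    have "(\<Prod>w\<in>S. w) = (\<Prod>w\<in>(\<lambda>w. z * w) ` S. w)" using im by simp
    also have "\<dots> = (\<Prod>w\<in>S. z * w)" using inj by (subst prod.reindex) auto
    also have "\<dots> = z ^ card S * (\<Prod>w\<in>S. w)" by (simp add: prod.distrib)
    finally have "(\<Prod>w\<in>S. w) * (z ^ card S - 1) = 0" by (simp add: algebra_simps)
    moreover have "(\<Prod>w\<in>S. w) \<noteq> 0" using fin assms(3) by auto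
    ultimately show ?thesis by simp
  qed
  then show "S = {z. z ^ card S = 1}"
    by (intro card_subset_eq) (use pos in \<open>auto simp: card_roots_unity_eq finite_roots_unity\<close>)
qed

text \<open>
  \<open>R a\<close> says that \<open>\<Sum>i<l. a i * x i\<close> vanishes on a hyperplane of the arrangement, where the
  coordinates \<open>x i\<close> are dual to a basis of modular lines; \<open>modular\<close> expresses the modularity of
  the \<open>i\<close>-th line, and \<open>coord\<close> that a sum of modular lines is a flat.
\<close>

locale modular_coeffs =
  fixes l :: nat and R :: "(nat \<Rightarrow> complex) \<Rightarrow> bool"
  assumes R_scale: "R a \<Longrightarrow> c \<noteq> 0 \<Longrightarrow> R (\<lambda>i. c * a i)"
    and R_cong: "R a \<Longrightarrow> (\<And>i. i < l \<Longrightarrow> a i = b i) \<Longrightarrow> R b"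
    and coord: "i < l \<Longrightarrow> R (\<lambda>j. if j = i then 1 else 0)"
    and modular: "R a \<Longrightarrow> R b \<Longrightarrow> i < l \<Longrightarrow> a i \<noteq> 0 \<Longrightarrow> b i \<noteq> 0 \<Longrightarrow>
      \<exists>j<l. a j / a i \<noteq> b j / b i \<Longrightarrow> R (\<lambda>j. a j / a i - b j / b i)"
    and R_finite: "i < l \<Longrightarrow> j < l \<Longrightarrow> i \<noteq> j \<Longrightarrow>
      finite {c. R (\<lambda>k. if k = i then 1 else if k = j then - c else 0)}"
    and R_nonzero: "R a \<Longrightarrow> \<exists>i<l. a i \<noteq> 0"
begin

text \<open>The coefficients of x_i - c x_j; the sign makes \<open>c\<close> the ratio of x_i to x_j
  on the hyperplane, so that ratios multiply along chains of indices.\<close>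

definition pairform :: "nat \<Rightarrow> nat \<Rightarrow> complex \<Rightarrow> nat \<Rightarrow> complex" where
  "pairform i j c k = (if k = i then 1 else if k = j then - c else 0)"

lemma sum_pairform:
  assumes "s < l" "t < l" "s \<noteq> t"
  shows "(\<Sum>m<l. pairform s t c m * v m) = v s - c * v t"
proof -
  have "(\<Sum>m<l. pairform s t c m * v m) =
      (\<Sum>m<l. (if m = s then v m else 0) + (if m = t then - c * v m else 0))"
    by (rule sum.cong) (use assms in \<open>auto simp: pairform_def\<close>)
  also have "\<dots> = v s - c * v t" using assms by (simp add: sum.distrib)
  finally show ?thesis .
qed

lemma sum_coord: "k < l \<Longrightarrow> (\<Sum>m<l. (if m = k then 1 else 0) * v m) = (v k :: complex)"
  by (simp add: if_distrib[of "\<lambda>x. x * _"] cong: if_cong)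

text \<open>Zero is excluded because \<open>pairform i j 0\<close> is a coordinate form, which
  always satisfies \<open>R\<close>; the remaining ratios are the candidates for a multiplicative
  group.\<close>

definition D :: "nat \<Rightarrow> nat \<Rightarrow> complex set" where
  "D i j = {c. c \<noteq> 0 \<and> R (pairform i j c)}"

text \<open>Modularity is applied to \<open>a\<close> and the i-th coordinate form: their normalized
  difference loses the entry at \<open>i\<close>, and the entry at \<open>j\<close> keeps it from
  being zero.\<close>

lemma R_drop:
  assumes "R a" "i < l" "j < l" "j \<noteq> i" "a j \<noteq> 0"
  shows "R (a(i := 0))"
proof (cases "a i = 0")
  case True then show ?thesis using assms(1) by (metis fun_upd_triv)
next
  case False
  let ?d = "\<lambda>j. if j = i then 1 else (0::complex)"
  have "R (\<lambda>k. a k / a i - ?d k / ?d i)"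
    by (rule modular[OF assms(1) coord[OF assms(2)] assms(2) False]) (use assms in auto)
  from R_scale[OF this False] show ?thesis
    by (rule R_cong) (use False in auto)
qed

lemma R_restrict:
  assumes "R a" "j < l" "j \<in> T" "a j \<noteq> 0"
  shows "R (\<lambda>i. if i \<in> T then a i else 0)"
proof -
  have "R (\<lambda>i. if i \<in> S then 0 else a i)" if "finite S" "S \<subseteq> {..<l} - T" for S
    using that
  proof (induction S rule: finite_induct)
    case empty then show ?case using assms by simp
  next
    case (insert x S)
    have "R ((\<lambda>i. if i \<in> S then 0 else a i)(x := 0))"
      by (rule R_drop[OF _ _ assms(2)]) (use insert assms in auto)
    then show ?case by (rule R_cong) auto
  qed
  from this[of "{..<l} - T"] show ?thesis by (auto intro: R_cong)
qed

lemma R_D: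
  assumes "R a" "i < l" "j < l" "i \<noteq> j" "a i \<noteq> 0" "a j \<noteq> 0"
  shows "- (a j / a i) \<in> D i j"
proof -
  have "R (\<lambda>k. if k \<in> {i, j} then a k else 0)" using R_restrict[of a i "{i, j}"] assms by auto
  from R_scale[OF this, of "1 / a i"] have "R (pairform i j (- (a j / a i)))"
    using assms by (auto elim!: R_cong simp: pairform_def)
  then show ?thesis using assms by (simp add: D_def)
qed

lemma D_sym: "c \<in> D i j \<Longrightarrow> i < l \<Longrightarrow> j < l \<Longrightarrow> i \<noteq> j \<Longrightarrow> 1 / c \<in> D j i"
  using R_D[of "pairform i j c" j i] by (auto simp: D_def pairform_def)

text \<open>Modularity at the middle index: x_j - x_i / c and x_j - d x_k have a difference
  proportional to x_i - c d x_k.\<close>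

lemma D_trans:
  assumes c: "c \<in> D i j" and d: "d \<in> D j k" and l: "i < l" "j < l" "k < l" and ne: "i \<noteq> j" "j \<noteq> k" "i \<noteq> k"
  shows "c * d \<in> D i k"
proof -
  let ?a = "pairform j i (1 / c)" and ?b = "pairform j k d"
  have "1 / c \<in> D j i" using D_sym c l ne by blast
  then have ab: "R ?a" "R ?b" and "c \<noteq> 0" "d \<noteq> 0" using d c by (auto simp: D_def)
  have "R (\<lambda>m. ?a m / ?a j - ?b m / ?b j)"
    by (rule modular[OF ab]) (use l ne \<open>c \<noteq> 0\<close> in \<open>auto simp: pairform_def intro!: exI[of _ i]\<close>)
  from R_D[OF this, of i k] show ?thesis
    using l ne \<open>c \<noteq> 0\<close> \<open>d \<noteq> 0\<close> by (simp add: pairform_def mult.commute)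
qed

text \<open>The hypothesis \<open>conn\<close> is what irreducibility provides. The set of indices
  reached from 0 absorbs every index linked to one of its members, by \<open>D_trans\<close>, so it
  cannot be a proper subset.\<close>

lemma D_0_nonempty:
  assumes conn: "\<And>S. S \<subseteq> {..<l} \<Longrightarrow> S \<noteq> {} \<Longrightarrow> S \<noteq> {..<l} \<Longrightarrow>
      \<exists>a i j. R a \<and> i \<in> S \<and> j < l \<and> j \<notin> S \<and> a i \<noteq> 0 \<and> a j \<noteq> 0"
    and "0 < l" "j < l" "j \<noteq> 0"
  shows "D 0 j \<noteq> {}"
proof (rule ccontr)
  assume e: "\<not> D 0 j \<noteq> {}"
  define S where "S = {k. k < l \<and> (k = 0 \<or> D 0 k \<noteq> {})}"
  have "j \<notin> S" using e assms by (simp add: S_def)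
  moreover have "0 \<in> S" "S \<subseteq> {..<l}" using assms(2) by (auto simp: S_def)
  ultimately have "\<exists>a s t. R a \<and> s \<in> S \<and> t < l \<and> t \<notin> S \<and> a s \<noteq> 0 \<and> a t \<noteq> 0"
    by (intro conn) (use assms(3) in auto)
  then obtain a s t where a: "R a" "s \<in> S" "t < l" "t \<notin> S" "a s \<noteq> 0" "a t \<noteq> 0" by blast
  have st: "s < l" "s \<noteq> t" "t \<noteq> 0" using a assms(2) by (auto simp: S_def)
  have D: "- (a t / a s) \<in> D s t" using R_D a st by blast
  then have "D 0 t \<noteq> {}"
  proof (cases "s = 0")
    case False
    then obtain c where "c \<in> D 0 s" using a(2) by (auto simp: S_def)
    from D_trans[OF this D] show ?thesis using False st a assms(2) by auto
  qed auto
  then show False using a(3,4) by (simp add: S_def)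
qed

end

text \<open>The situation after rescaling the coordinates so that every x_0 = x_j is a hyperplane.
  The bound on \<open>l\<close> supplies the third index through which ratios are compared.\<close>

locale normalized_coeffs = modular_coeffs +
  assumes l3: "3 \<le> l" and one_D: "0 < j \<Longrightarrow> j < l \<Longrightarrow> 1 \<in> D 0 j"
begin

lemma one_D': assumes "i < l" "j < l" "i \<noteq> j" shows "1 \<in> D i j"
proof (cases "i = 0 \<or> j = 0")
  case True
  then show ?thesis using one_D D_sym[of 1 0 i] assms l3 by (cases "i = 0") auto
next
  case False
  then have "1 \<in> D i 0" using one_D[of i] D_sym[of 1 0 i] assms by auto
  then show ?thesis using D_trans[of 1 i 0 1 j] one_D[of j] False assms by auto
qed

lemma D_mono:
  assumes "i < l" "j < l" "k < l" "i \<noteq> j" "i \<noteq> k" "j \<noteq> k"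
  shows "D i j \<subseteq> D i k" "D i j \<subseteq> D k j"
proof -
  show "D i j \<subseteq> D i k" using D_trans[of _ i j 1 k] one_D'[of j k] assms by auto
  show "D i j \<subseteq> D k j" using D_trans[of 1 k i _ j] one_D'[of k i] assms by auto
qed

text \<open>Composition with the ratio 1, through a third index, replaces either index of
  \<open>D\<close> by another one.\<close>

lemma D_eq: assumes "i < l" "j < l" "i \<noteq> j" shows "D i j = D 0 1"
proof -
  have step: "D i j = D i k" if "i < l" "j < l" "k < l" "i \<noteq> j" "i \<noteq> k" for i j k
    using D_mono(1)[of i j k] D_mono(1)[of i k j] that by (cases "j = k") auto
  have step': "D i j = D k j" if "i < l" "j < l" "k < l" "i \<noteq> j" "j \<noteq> k" for i j k
    using D_mono(2)[of i j k] D_mono(2)[of k j i] that by (cases "i = k") auto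
  \<comment> \<open>The pair is reversed with the help of the index 2: \<open>D 1 0\<close>,
    \<open>D 1 2\<close>, \<open>D 0 2\<close> and \<open>D 0 1\<close> agree in turn.\<close>
  have sw: "D 1 0 = D 0 1" using step[of 1 0 2] step'[of 1 2 0] step[of 0 2 1] l3 by auto
  show ?thesis
  proof (cases "i = 0")
    case True then show ?thesis using step[of 0 j 1] assms l3 by auto
  next
    case i0: False
    have "D i j = D i 0" using step[of i j 0] i0 assms l3 by auto
    also have "\<dots> = D 1 0" using step'[of i 0 1] i0 assms l3 by auto
    finally show ?thesis using sw by simp
  qed
qed

definition r :: nat where "r = card (D 0 1)"

lemma D_roots: "D 0 1 = {z. z ^ r = 1}" and r_pos: "0 < r"
proof -
  have "finite {c. R (\<lambda>k. if k = 0 then 1 else if k = 1 then - c else 0)}"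
    using R_finite[of 0 1] l3 by simp
  then have fin: "finite (D 0 1)"
    by (rule rev_finite_subset) (auto simp: D_def pairform_def[abs_def] simp del: One_nat_def)
  \<comment> \<open>The second factor is read in \<open>D 1 2\<close>, so that the composition along
    0, 1, 2 ends in \<open>D 0 2\<close>.\<close>
  have cl: "c * d \<in> D 0 1" if "c \<in> D 0 1" "d \<in> D 0 1" for c d
    using D_trans[of c 0 1 d 2] D_eq[of 1 2] D_eq[of 0 2] that l3 by auto
  have "D 0 1 \<noteq> {}" using one_D[of 1] l3 by auto
  moreover have "0 \<notin> D 0 1" by (simp add: D_def)
  ultimately show "D 0 1 = {z. z ^ r = 1}" "0 < r"
    unfolding r_def using fin cl by (intro finite_mult_closed_roots_of_unity; blast)+
qed

lemma D_iff: "i < l \<Longrightarrow> j < l \<Longrightarrow> i \<noteq> j \<Longrightarrow> c \<in> D i j \<longleftrightarrow> c ^ r = 1"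
  using D_eq[of i j] D_roots by simp

text \<open>All ratios have absolute value one. A form with three nonzero entries, normalized at
  \<open>i\<close>, first shows that -1 is an r-th root of unity; subtracting x_i - b_j x_j from it
  then gives a ratio of absolute value 1/2.\<close>

lemma no_three_support:
  assumes "R a" "i < l" "j < l" "k < l" "i \<noteq> j" "j \<noteq> k" "i \<noteq> k" "a i \<noteq> 0" "a j \<noteq> 0" "a k \<noteq> 0"
  shows False
proof -
  define b where "b m = (1 / a i) * (if m \<in> {i, j, k} then a m else 0)" for m
  have "R (\<lambda>m. if m \<in> {i, j, k} then a m else 0)" using R_restrict[of a i "{i, j, k}"] assms by auto
  then have b: "R b" unfolding b_def by (rule R_scale) (use assms in simp)
  have bi: "b i = 1" "b j \<noteq> 0" "b k \<noteq> 0" using assms by (auto simp: b_def)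
  have 1: "(- b j) ^ r = 1" using R_D[OF b, of i j] bi assms D_iff by auto
  have 2: "(- b k) ^ r = 1" using R_D[OF b, of i k] bi assms D_iff by auto
  have 3: "(- (b k / b j)) ^ r = 1" using R_D[OF b, of j k] bi assms D_iff by auto
  \<comment> \<open>The ratio between \<open>j\<close> and \<open>k\<close> is minus the quotient of
    the ratios at \<open>i\<close>; as all three are r-th roots of unity, so is -1.\<close>
  have "(- 1) ^ r = (1::complex)"
  proof -
    have "(- 1) ^ r * ((- b k) ^ r / (- b j) ^ r) = (- (b k / b j)) ^ r"
      by (simp flip: power_divide power_mult_distrib)
    then show ?thesis using 1 2 3 by simp
  qed
  then have "(b j) ^ r = 1" using 1 by (metis mult_minus1 mult.left_neutral power_mult_distrib)
  then have "b j \<in> D i j" using D_iff assms by blast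
  then have p: "R (pairform i j (b j))" by (simp add: D_def)
  \<comment> \<open>The subtraction cancels the entry at \<open>i\<close> and doubles the one at
    \<open>j\<close>: the result is 2 b_j x_j + b_k x_k on these three indices.\<close>
  let ?c = "\<lambda>m. b m / b i - pairform i j (b j) m / pairform i j (b j) i"
  have "R ?c"
    by (rule modular[OF b p]) (use assms bi in \<open>auto simp: pairform_def intro!: exI[of _ k]\<close>)
  from R_D[OF this, of j k] have "- (b k / (2 * b j)) \<in> D j k"
    using assms bi by (auto simp: pairform_def)
  then have "(- (b k / (2 * b j))) ^ r = 1" using D_iff assms by blast
  moreover have "- (b k / (2 * b j)) = - (b k / b j) * (1 / 2)" by simp
  ultimately have "(- (b k / b j) * (1 / 2)) ^ r = 1" by metis
  then have "(1 / 2 :: complex) ^ r = 1" using 3 by (metis mult.left_neutral power_mult_distrib)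
  then have "norm ((1 / 2 :: complex) ^ r) = 1" by simp
  then have "(1 / 2 :: real) ^ r = 1" by (simp add: norm_power norm_divide)
  moreover have "(1 / 2 :: real) ^ r < 1" using r_pos by (simp add: power_less_one_iff)
  ultimately show False by simp
qed

lemma R_support2:
  assumes "R a" "i < l" "j < l" "k < l" "i \<noteq> j" "j \<noteq> k" "i \<noteq> k" "a i \<noteq> 0" "a j \<noteq> 0"
  shows "a k = 0"
  using no_three_support assms by blast

lemma R_cases:
  assumes "R a"
  obtains i c where "i < l" "c \<noteq> 0" "\<And>k. k < l \<Longrightarrow> a k = c * (if k = i then 1 else 0)"
  | i j c z where "i < l" "j < l" "i \<noteq> j" "c \<noteq> 0" "z ^ r = 1" "\<And>k. k < l \<Longrightarrow> a k = c * pairform i j z k"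
proof -
  obtain i where i: "i < l" "a i \<noteq> 0" using R_nonzero[OF assms] by blast
  show thesis
  proof (cases "\<exists>j<l. j \<noteq> i \<and> a j \<noteq> 0")
    case False
    show thesis by (rule that(1)[OF i]) (use False in auto)
  next
    case True
    then obtain j where j: "j < l" "j \<noteq> i" "a j \<noteq> 0" by blast
    then have 1: "(- (a j / a i)) ^ r = 1" using R_D[OF assms, of i j] i D_iff by auto
    have 2: "a k = a i * pairform i j (- (a j / a i)) k" if "k < l" for k
      using R_support2[OF assms, of i j k] i j that by (auto simp: pairform_def)
    show thesis by (rule that(2)[OF i(1) j(1) j(2)[symmetric] i(2) 1 2])
  qed
qed

lemma R_pairform: "i < l \<Longrightarrow> j < l \<Longrightarrow> i \<noteq> j \<Longrightarrow> z ^ r = 1 \<Longrightarrow> R (pairform i j z)"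
  using D_iff[of i j z] by (simp add: D_def)

lemma third_index: obtains k where "k < l" "k \<noteq> i" "k \<noteq> (j::nat)"
proof -
  have "card {i, j} < card {..<l}" using l3 by (simp add: card_insert_if)
  then have "\<exists>k\<in>{..<l}. k \<notin> {i, j}" by (meson card_mono finite.emptyI finite.insertI not_le subsetI)
  then show thesis using that by auto
qed

text \<open>
  The dual action of \<open>u \<mapsto> u + (\<Sum>i<l. a i * x i u) v\<close> takes the coefficients \<open>b\<close> to
  \<open>b + (\<Sum>j<l. b j * v j) a\<close>.
\<close>

lemma swap_root:
  assumes ij: "i < l" "j < l" "i \<noteq> j" "z ^ r = 1"
    and inv: "\<And>b. R b \<Longrightarrow> R (\<lambda>k. b k + pairform i j z k * (\<Sum>m<l. b m * v m))"
    and nz: "1 + (\<Sum>m<l. pairform i j z m * v m) \<noteq> 0" and v: "\<exists>m<l. v m \<noteq> 0" and m: "m < l"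
  shows "v m = (if m = i then - 1 else if m = j then 1 / z else 0)"
proof -
  have z: "z \<noteq> 0" using ij r_pos by (auto simp: power_0_left)
  \<comment> \<open>Otherwise the image of the coordinate form x_k would involve the three indices
    i, j and k.\<close>
  have v0: "v k = 0" if k: "k < l" "k \<noteq> i" "k \<noteq> j" for k
  proof (rule ccontr)
    assume vk: "v k \<noteq> 0"
    have "R (\<lambda>s. (if s = k then 1 else 0) + pairform i j z s * v k)"
      using inv[OF coord[OF k(1)]] sum_coord[OF k(1)] by simp
    from no_three_support[OF this ij(1,2) k(1)] show False
      using ij k vk z by (auto simp: pairform_def)
  qed
  obtain k where k: "k < l" "k \<noteq> i" "k \<noteq> j" by (rule third_index)
  \<comment> \<open>The form x_j - x_k tests \<open>v j\<close>: its image has the entries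
    \<open>v j\<close>, \<open>1 - z * v j\<close> and -1 at i, j and k, so one of the first two
    vanishes.\<close>
  have "R (pairform j k 1)" using R_pairform k ij by simp
  from inv[OF this] have 1: "R (\<lambda>s. pairform j k 1 s + pairform i j z s * v j)"
    using sum_pairform[of j k 1] k ij v0 by simp
  have a: "v j = 0 \<or> 1 - z * v j = 0"
    using no_three_support[OF 1 ij(1,2) k(1)] ij k by (auto simp: pairform_def)
  have "R (pairform i k 1)" using R_pairform k ij by simp
  from inv[OF this] have 2: "R (\<lambda>s. pairform i k 1 s + pairform i j z s * v i)"
    using sum_pairform[of i k 1] k ij v0 by simp
  have b: "v i = 0 \<or> 1 + v i = 0"
    using no_three_support[OF 2 ij(1,2) k(1)] ij k z by (auto simp: pairform_def)
  have c: "1 + v i - z * v j \<noteq> 0" using nz unfolding sum_pairform[OF ij(1-3), of z v] by (simp add: algebra_simps)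
  have d: "\<not> (v i = 0 \<and> v j = 0)" using v v0 by metis
  \<comment> \<open>Four combinations are left. Both entries being zero would make \<open>v\<close>
    vanish, and the two mixed cases make \<open>1 + v i - z * v j\<close> zero, against
    \<open>nz\<close>.\<close>
  have "v i = -1" "v j = 1 / z" using a b c d z by (auto simp: field_simps add_eq_0_iff)
  then show ?thesis using v0 m by auto
qed

text \<open>A second root of unity \<open>w\<close> exists besides 1, so x_m - x_k and x_m - w x_k
  both satisfy \<open>R\<close>. Neither image may acquire an entry at \<open>i\<close>, whence
  \<open>v\<close> is supported at \<open>i\<close>. The image of x_i - x_k then exhibits the
  inverse of \<open>1 + v i\<close> as a ratio.\<close>

lemma coord_root_ge2:
  assumes i: "i < l" and r2: "2 \<le> r"
    and inv: "\<And>b. R b \<Longrightarrow> R (\<lambda>k. b k + (if k = i then 1 else 0) * (\<Sum>m<l. b m * v m))"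
    and nz: "1 + v i \<noteq> 0"
  shows "m < l \<Longrightarrow> m \<noteq> i \<Longrightarrow> v m = 0" "(1 + v i) ^ r = 1"
proof -
  have "card {z::complex. z ^ r = 1} = r" using r_pos by (simp add: card_roots_unity_eq)
  then have "\<not> {z::complex. z ^ r = 1} \<subseteq> {1}" using r2 card_mono[of "{1::complex}" "{z. z ^ r = 1}"] by auto
  then obtain w :: complex where w: "w ^ r = 1" "w \<noteq> 1" by auto
  show v0: "v m = 0" if m: "m < l" "m \<noteq> i" for m
  proof -
    obtain k where k: "k < l" "k \<noteq> i" "k \<noteq> m" by (rule third_index)
    have *: "v m = y * v k" if y: "y ^ r = 1" for y
    proof -
      have y0: "y \<noteq> 0" using y r_pos by (auto simp: power_0_left)
      have "R (pairform m k y)" using R_pairform k m y by simp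
      from inv[OF this] have 1: "R (\<lambda>s. pairform m k y s + (if s = i then 1 else 0) * (v m - y * v k))"
        using sum_pairform[of m k y] k m by simp
      show ?thesis using no_three_support[OF 1 i m(1) k(1)] k m y0 by (auto simp: pairform_def)
    qed
    have "v k * (w - 1) = 0" using *[of 1] *[OF w(1)] by (simp add: algebra_simps)
    then show ?thesis using w *[of 1] by simp
  qed
  obtain k where k: "k < l" "k \<noteq> i" "k \<noteq> i" by (rule third_index)
  have "R (pairform i k 1)" using R_pairform k i by simp
  from inv[OF this] have 1: "R (\<lambda>s. pairform i k 1 s + (if s = i then 1 else 0) * v i)"
    using sum_pairform[of i k 1] k i v0[of k] by simp
  have "1 / (1 + v i) \<in> D i k"
    using R_D[OF 1 i k(1)] k nz by (auto simp: pairform_def)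
  then have "(1 / (1 + v i)) ^ r = 1" using D_iff i k by blast
  then show "(1 + v i) ^ r = 1" by (simp add: power_divide)
qed

text \<open>With 1 as the only ratio, the entries of \<open>v\<close> off \<open>i\<close> are all
  equal, and each is 0 or -1; the value 0 would force \<open>v\<close> to vanish. What remains is
  the root of the reflection exchanging e_i with the negative sum of all e_j.\<close>

lemma coord_root_1:
  assumes i: "i < l" and r1: "r = 1"
    and inv: "\<And>b. R b \<Longrightarrow> R (\<lambda>k. b k + (if k = i then 1 else 0) * (\<Sum>m<l. b m * v m))"
    and nz: "1 + v i \<noteq> 0" and v: "\<exists>m<l. v m \<noteq> 0"
  shows "m < l \<Longrightarrow> v m = (if m = i then - 2 else - 1)"
proof -
  have eq: "v m = v k" if "m < l" "m \<noteq> i" "k < l" "k \<noteq> i" "k \<noteq> m" for m k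
  proof -
    have "R (pairform m k 1)" using R_pairform that by simp
    from inv[OF this] have 1: "R (\<lambda>s. pairform m k 1 s + (if s = i then 1 else 0) * (v m - v k))"
      using sum_pairform[of m k 1] that by simp
    show ?thesis using no_three_support[OF 1 i that(1,3)] that by (auto simp: pairform_def)
  qed
  have c: "v m = 0 \<or> v m = -1" if m: "m < l" "m \<noteq> i" for m
  proof -
    have 1: "R (\<lambda>s. (if s = m then 1 else 0) + (if s = i then 1 else 0) * v m)"
      using inv[OF coord[OF m(1)]] sum_coord[OF m(1)] by simp
    show ?thesis using R_D[OF 1 m(1) i m(2)] D_iff[of m i] m i r1
      by (cases "v m = 0") (auto simp: equation_minus_iff)
  qed
  have a: "1 + v i - v m = 0 \<or> 1 + v i - v m = 1" if m: "m < l" "m \<noteq> i" for m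
  proof -
    have "R (pairform i m 1)" using R_pairform m i by simp
    from inv[OF this] have 1: "R (\<lambda>s. pairform i m 1 s + (if s = i then 1 else 0) * (v i - v m))"
      using sum_pairform[of i m 1] m i by simp
    show ?thesis using R_D[OF 1 i m(1)] D_iff[of i m] m i r1
      by (cases "1 + v i - v m = 0") (auto simp: pairform_def algebra_simps)
  qed
  obtain k where k: "k < l" "k \<noteq> i" "k \<noteq> i" by (rule third_index)
  have vk: "v k = -1"
  proof (rule ccontr)
    assume "v k \<noteq> -1"
    then have k0: "v k = 0" using c k by blast
    then have "v i = 0" using a[of k] k nz by auto
    moreover have "v m = 0" if "m < l" "m \<noteq> i" for m using eq[of m k] that k k0 by (cases "m = k") auto
    ultimately show False using v by metis
  qed
  \<comment> \<open>The test with x_i - x_k leaves 0 or 1 for \<open>v i + 2\<close>; the value 1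
    would mean \<open>1 + v i = 0\<close>, against \<open>nz\<close>.\<close>
  have "v i + 2 = 0" using a[of k] k nz vk by (auto simp: algebra_simps)
  then have "v i = -2" by (simp add: eq_neg_iff_add_eq_0)
  then show "v m = (if m = i then - 2 else - 1)" if "m < l"
    using vk eq[of m k] that k by (cases "m = k") auto
qed

end

section \<open>Irreducible factors and their modular lines\<close>

text \<open>The monoid generated by \<open>S\<close>, which keeps inductions free of a case for
  inverses. For the reflection groups below it is the whole group, since the inverse of a reflection
  is again a reflection.\<close>

inductive_set mcl :: "('a \<Rightarrow> 'a) set \<Rightarrow> ('a \<Rightarrow> 'a) set" for S where
  id: "id \<in> mcl S"
| step: "s \<in> S \<Longrightarrow> g \<in> mcl S \<Longrightarrow> s \<circ> g \<in> mcl S"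

lemma mcl_incl: "s \<in> S \<Longrightarrow> s \<in> mcl S"
  using mcl.step[OF _ mcl.id, of s S] by simp

lemma mcl_mult: "g \<in> mcl S \<Longrightarrow> h \<in> mcl S \<Longrightarrow> g \<circ> h \<in> mcl S"
  by (induction rule: mcl.induct) (auto simp: comp_assoc intro: mcl.step)

lemma mcl_least: assumes "S \<subseteq> mcl T" shows "mcl S \<subseteq> mcl T"
proof
  fix g assume "g \<in> mcl S"
  then show "g \<in> mcl T"
  proof (induction rule: mcl.induct)
    case (step s g)
    then show ?case using assms mcl_mult by blast
  qed (rule mcl.id)
qed

context cspace
begin

text \<open>Identity plus form times root. Within a finite group this agrees with
  \<open>is_reflection\<close> by \<open>is_reflection_UNIV\<close>, the finite order coming from
  the group.\<close>

definition reflection :: "('v \<Rightarrow> 'v) \<Rightarrow> bool" where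
  "reflection g \<longleftrightarrow> (\<exists>f v. lform f \<and> (\<exists>u. f u \<noteq> 0) \<and> v \<noteq> 0 \<and> g = (\<lambda>u. u + f u *s v))"

definition arr :: "('v \<Rightarrow> 'v) set \<Rightarrow> 'v set set" where
  "arr G = {{u. g u = u} | g. g \<in> G \<and> reflection g}"

lemma arrE:
  assumes "H \<in> arr G"
  obtains f v where "lform f" "\<exists>u. f u \<noteq> 0" "v \<noteq> 0" "(\<lambda>u. u + f u *s v) \<in> G" "H = {u. f u = 0}"
proof -
  obtain g where g: "g \<in> G" "reflection g" "H = {u. g u = u}" using assms by (auto simp: arr_def)
  then obtain f v where "lform f" "\<exists>u. f u \<noteq> 0" "v \<noteq> 0" and gf: "g = (\<lambda>u. u + f u *s v)"
    by (auto simp: reflection_def)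
  moreover have "H = {u. f u = 0}" unfolding g(3) gf using \<open>v \<noteq> 0\<close> by auto
  ultimately show thesis using that[of f v] g(1) by simp
qed

lemma arrI:
  assumes "lform f" "f w \<noteq> 0" "v \<noteq> 0" "(\<lambda>u. u + f u *s v) \<in> G"
  shows "{u. f u = 0} \<in> arr G"
proof -
  have "reflection (\<lambda>u. u + f u *s v)" unfolding reflection_def using assms by blast
  moreover have "{u. f u = 0} = {u. u + f u *s v = u}" using assms(3) by auto
  ultimately show ?thesis unfolding arr_def using assms(4)
    by (intro CollectI exI[of _ "\<lambda>u. u + f u *s v"]) simp
qed

lemma arr_hyp: "H \<in> arr G \<Longrightarrow> hyp H"
  by (erule arrE) (auto simp: hyp_def)

text \<open>A basis \<open>e\<close> of \<open>U\<close> with its dual coordinates, extended by zero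
  to the complement \<open>C\<close>. The forms are defined on the whole space, so hyperplanes and
  transformations can be written without restricting them to \<open>U\<close>.\<close>

definition coords :: "'v set \<Rightarrow> 'v set \<Rightarrow> nat \<Rightarrow> (nat \<Rightarrow> 'v) \<Rightarrow> (nat \<Rightarrow> 'v \<Rightarrow> complex) \<Rightarrow> bool" where
  "coords U C l e x \<longleftrightarrow> (\<forall>i<l. lform (x i)) \<and>
     (\<forall>i<l. \<forall>j<l. x i (e j) = (if i = j then 1 else 0)) \<and> (\<forall>i<l. e i \<in> U) \<and>
     (\<forall>i<l. \<forall>c\<in>C. x i c = 0) \<and> (\<forall>u\<in>U. u = (\<Sum>i<l. x i u *s e i))"

text \<open>
  \<open>sw\<close> exchanges \<open>z e\<^sub>i\<close> and \<open>e\<^sub>j\<close>, \<open>dg\<close> multiplies \<open>e\<^sub>i\<close> by \<open>t\<close>, and \<open>sg\<close> exchanges \<open>e\<^sub>i\<close> and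
  \<open>- (e\<^sub>0 + \<dots> + e\<^bsub>l-1\<^esub>)\<close>, the additional vector permuted by the symmetric group on \<open>l + 1\<close> letters.
\<close>

definition sw :: "(nat \<Rightarrow> 'v) \<Rightarrow> (nat \<Rightarrow> 'v \<Rightarrow> complex) \<Rightarrow> nat \<Rightarrow> nat \<Rightarrow> complex \<Rightarrow> 'v \<Rightarrow> 'v" where
  "sw e x i j z u = u + (x i u - z * x j u) *s ((1 / z) *s e j - e i)"

definition dg :: "(nat \<Rightarrow> 'v) \<Rightarrow> (nat \<Rightarrow> 'v \<Rightarrow> complex) \<Rightarrow> nat \<Rightarrow> complex \<Rightarrow> 'v \<Rightarrow> 'v" where
  "dg e x i t u = u + x i u *s ((t - 1) *s e i)"

definition sg :: "nat \<Rightarrow> (nat \<Rightarrow> 'v) \<Rightarrow> (nat \<Rightarrow> 'v \<Rightarrow> complex) \<Rightarrow> nat \<Rightarrow> 'v \<Rightarrow> 'v" where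
  "sg l e x i u = u + x i u *s (- e i - (\<Sum>j<l. e j))"

definition comb :: "nat \<Rightarrow> (nat \<Rightarrow> 'v \<Rightarrow> complex) \<Rightarrow> (nat \<Rightarrow> complex) \<Rightarrow> 'v \<Rightarrow> complex" where
  "comb l x a u = (\<Sum>i<l. a i * x i u)"

end

text \<open>
  An irreducible factor of a reflection group, kept as a group \<open>G\<close> of transformations of the whole
  space that is trivial on the complement \<open>C\<close> of \<open>U\<close>.
\<close>

locale refl_factor = cspace scale Basis
  for scale :: "complex \<Rightarrow> 'v::ab_group_add \<Rightarrow> 'v" (infixr \<open>*s\<close> 75) and Basis :: "'v set" +
  fixes U C :: "'v set" and G :: "('v \<Rightarrow> 'v) set"
  assumes subU: "subspace U" and subC: "subspace C"
    and UC_Int: "u \<in> U \<Longrightarrow> u \<in> C \<Longrightarrow> u = 0"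
    and UC_sum: "\<exists>u\<in>U. \<exists>c\<in>C. v = u + c"
    and G_lin: "g \<in> G \<Longrightarrow> lin g" and G_bij: "g \<in> G \<Longrightarrow> bij g"
    and G_C: "g \<in> G \<Longrightarrow> c \<in> C \<Longrightarrow> g c = c" and G_U: "g \<in> G \<Longrightarrow> u \<in> U \<Longrightarrow> g u \<in> U"
    and G_inv: "g \<in> G \<Longrightarrow> inv_into UNIV g \<in> G" and G_finite: "finite G"
    and G_gen: "G = mcl {g \<in> G. reflection g}"
    and irr: "subspace S \<Longrightarrow> S \<subseteq> U \<Longrightarrow> (\<And>g u. g \<in> G \<Longrightarrow> u \<in> S \<Longrightarrow> g u \<in> S) \<Longrightarrow> S = {0} \<or> S = U"
    and U_ne: "U \<noteq> {0}"
begin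

lemma G_id: "id \<in> G" using mcl.id G_gen by blast

lemma G_comp: "g \<in> G \<Longrightarrow> h \<in> G \<Longrightarrow> g \<circ> h \<in> G" using mcl_mult G_gen by blast

text \<open>Triviality on \<open>C\<close> makes the form vanish there, so it is nonzero at some
  vector of \<open>U\<close>, and the root is a multiple of the displacement of that vector.\<close>

lemma root_in_U:
  assumes g: "(\<lambda>u. u + f u *s v) \<in> G" and f: "lform f" "\<exists>u. f u \<noteq> 0" and v: "v \<noteq> 0"
  shows "v \<in> U" "c \<in> C \<Longrightarrow> f c = 0"
proof -
  show fC: "f c = 0" if "c \<in> C" for c using G_C[OF g that] v by simp
  obtain w where w: "f w \<noteq> 0" using f by blast
  obtain u c where u: "u \<in> U" "c \<in> C" "w = u + c" using UC_sum by blast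
  then have fu: "f u \<noteq> 0" using w fC f(1) by (auto simp: lform_add)
  have "u + f u *s v \<in> U" using G_U[OF g u(1)] .
  then have "f u *s v \<in> U" using subU u(1) by (metis add_diff_cancel_left' subspace_diff)
  then have "(1 / f u) *s (f u *s v) \<in> U" using subU subspace_scale by blast
  then show "v \<in> U" using fu by simp
qed

lemma arr_C: "H \<in> arr G \<Longrightarrow> C \<subseteq> H"
  using root_in_U(2) by (elim arrE) blast

lemma arr_finite: "finite (arr G)"
proof -
  have "arr G \<subseteq> (\<lambda>g. {u. g u = u}) ` G" by (auto simp: arr_def)
  then show ?thesis using G_finite finite_surj by blast
qed

text \<open>Conjugating the reflection with form \<open>f\<close> and root \<open>v\<close> gives
  one whose form is \<open>f\<close> composed with \<open>g\<close> and whose root is the preimage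
  of \<open>v\<close> under \<open>g\<close>.\<close>

lemma arr_vimage:
  assumes g: "g \<in> G" and H: "H \<in> arr G"
  shows "{u. g u \<in> H} \<in> arr G"
proof -
  obtain f v where f: "lform f" "\<exists>u. f u \<noteq> 0" "v \<noteq> 0" "(\<lambda>u. u + f u *s v) \<in> G" "H = {u. f u = 0}"
    using arrE[OF H] by blast
  let ?h = "inv_into UNIV g"
  have h: "?h \<in> G" "lin ?h" "lin g" "bij g" using g G_inv G_lin G_bij by auto
  have hg: "?h (g u) = u" for u using h(4) by (simp add: bij_is_inj)
  have gh: "g (?h u) = u" for u using h(4) by (simp add: bij_is_surj surj_f_inv_f)
  have "?h \<circ> ((\<lambda>u. u + f u *s v) \<circ> g) = (\<lambda>u. u + f (g u) *s ?h v)"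
    by (rule ext) (simp add: lin_simps[OF h(2)] hg)
  then have 1: "(\<lambda>u. u + f (g u) *s ?h v) \<in> G" using G_comp[OF h(1) G_comp[OF f(4) g]] by simp
  have 2: "?h v \<noteq> 0" using gh[of v] lin_0[OF h(3)] f(3) by metis
  obtain w where "f w \<noteq> 0" using f(2) by blast
  then have 3: "f (g (?h w)) \<noteq> 0" using gh by simp
  show ?thesis using arrI[OF lform_comp[OF f(1) h(3)] 3 2 1] f(5) by simp
qed

abbreviation "LL \<equiv> intersection_lattice (arr G)"

lemma LL_vimage: assumes g: "g \<in> G" and Y: "Y \<in> LL" shows "{u. g u \<in> Y} \<in> LL"
proof -
  obtain B where B: "B \<subseteq> arr G" "Y = \<Inter>B" using Y by (auto simp: intersection_lattice_def)
  have "{u. g u \<in> Y} = \<Inter>((\<lambda>H. {u. g u \<in> H}) ` B)" using B by auto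
  moreover have "(\<lambda>H. {u. g u \<in> H}) ` B \<subseteq> arr G" using B arr_vimage[OF g] by auto
  ultimately show ?thesis unfolding intersection_lattice_def by blast
qed

lemma LL_C: "Y \<in> LL \<Longrightarrow> C \<subseteq> Y"
  using arr_C by (auto simp: intersection_lattice_def)

lemma LL_hyp: assumes "Y \<in> LL" "hyp Y" shows "Y \<in> arr G"
proof -
  obtain B where B: "B \<subseteq> arr G" "Y = \<Inter>B" using assms by (auto simp: intersection_lattice_def)
  have "Y \<noteq> UNIV" using assms(2) by (auto simp: hyp_def)
  then obtain H where H: "H \<in> B" using B by blast
  then have "Y = H" using hyp_subset_eq[OF assms(2) arr_hyp[of H G]] B by blast
  then show ?thesis using H B by blast
qed

lemma arr_LL: "H \<in> arr G \<Longrightarrow> H \<in> LL"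
  unfolding intersection_lattice_def by (intro CollectI exI[of _ "{H}"]) auto

lemma Int_LL: "X \<in> LL \<Longrightarrow> Y \<in> LL \<Longrightarrow> X \<inter> Y \<in> LL"
proof -
  assume "X \<in> LL" "Y \<in> LL"
  then obtain A B where "A \<subseteq> arr G" "X = \<Inter>A" "B \<subseteq> arr G" "Y = \<Inter>B"
    by (auto simp: intersection_lattice_def)
  then have "A \<union> B \<subseteq> arr G" "X \<inter> Y = \<Inter>(A \<union> B)" by auto
  then show ?thesis unfolding intersection_lattice_def by blast
qed

text \<open>The flat \<open>C + \<langle>q\<rangle>\<close>, a line modulo \<open>C\<close>, is a modular element.\<close>

definition modular_line :: "'v \<Rightarrow> bool" where
  "modular_line q \<longleftrightarrow> (\<forall>Y\<in>LL. {y + t *s q | y t. y \<in> Y} \<in> LL)"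

text \<open>The group permutes the flats, so \<open>Y\<close> is pulled back along \<open>g\<close>,
  enlarged by the line of \<open>q\<close>, and carried forward again.\<close>

lemma modular_line_image: assumes g: "g \<in> G" and q: "modular_line q" shows "modular_line (g q)"
  unfolding modular_line_def
proof
  fix Y assume Y: "Y \<in> LL"
  let ?h = "inv_into UNIV g"
  have h: "?h \<in> G" "lin ?h" "lin g" "bij g" using g G_inv G_lin G_bij by auto
  have hg: "?h (g u) = u" for u using h(4) by (simp add: bij_is_inj)
  have gh: "g (?h u) = u" for u using h(4) by (simp add: bij_is_surj surj_f_inv_f)
  let ?Z = "{y + t *s q | y t. y \<in> {u. g u \<in> Y}}"
  have "?Z \<in> LL" using q LL_vimage[OF g Y] unfolding modular_line_def by blast
  then have 1: "{u. ?h u \<in> ?Z} \<in> LL" by (rule LL_vimage[OF h(1)])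
  have "{u. ?h u \<in> ?Z} = {y + t *s g q | y t. y \<in> Y}"
  proof (intro subset_antisym subsetI)
    fix u assume "u \<in> {u. ?h u \<in> ?Z}"
    then obtain y t where "?h u = y + t *s q" "g y \<in> Y" by auto
    then have "u = g y + t *s g q" using gh[of u] h(3) by (simp add: lin_simps)
    then show "u \<in> {y + t *s g q | y t. y \<in> Y}" using \<open>g y \<in> Y\<close> by blast
  next
    fix u assume "u \<in> {y + t *s g q | y t. y \<in> Y}"
    then obtain y t where "u = y + t *s g q" "y \<in> Y" by auto
    then have "?h u = ?h y + t *s q" "g (?h y) \<in> Y" using hg gh h(2) by (auto simp: lin_simps)
    then show "u \<in> {u. ?h u \<in> ?Z}" by blast
  qed
  then show "{y + t *s g q | y t. y \<in> Y} \<in> LL" using 1 by simp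
qed

text \<open>Every flat contains \<open>C\<close>, so a line matters only modulo \<open>C\<close>;
  this allows a modular line to be moved into \<open>U\<close>.\<close>

lemma modular_line_shift:
  assumes q: "modular_line q" and c: "c \<in> C" shows "modular_line (q + c)"
  unfolding modular_line_def
proof
  fix Y assume Y: "Y \<in> LL"
  have sY: "subspace Y" using Y arr_hyp by (auto simp: intersection_lattice_def intro!: subspace_INT_hyp)
  have cY: "t *s c \<in> Y" for t using c LL_C[OF Y] sY subspace_scale by blast
  have "{y + t *s (q + c) | y t. y \<in> Y} = {y + t *s q | y t. y \<in> Y}"
  proof (intro subset_antisym subsetI)
    fix u assume "u \<in> {y + t *s (q + c) | y t. y \<in> Y}"
    then obtain y t where "u = y + t *s (q + c)" "y \<in> Y" by blast
    then have "u = (y + t *s c) + t *s q" "y + t *s c \<in> Y"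
      using subspace_add[OF sY _ cY] by (auto simp: scale_right_distrib)
    then show "u \<in> {y + t *s q | y t. y \<in> Y}" by blast
  next
    fix u assume "u \<in> {y + t *s q | y t. y \<in> Y}"
    then obtain y t where "u = y + t *s q" "y \<in> Y" by blast
    then have "u = (y - t *s c) + t *s (q + c)" "y - t *s c \<in> Y"
      using subspace_diff[OF sY _ cY] by (auto simp: scale_right_distrib)
    then show "u \<in> {y + t *s (q + c) | y t. y \<in> Y}" by blast
  qed
  then show "{y + t *s (q + c) | y t. y \<in> Y} \<in> LL" using q Y unfolding modular_line_def by simp
qed

lemma projection: obtains p where "lin p" "\<And>v. p v \<in> U" "\<And>u. u \<in> U \<Longrightarrow> p u = u" "\<And>c. c \<in> C \<Longrightarrow> p c = 0"
proof -
  have "\<forall>v. \<exists>u. u \<in> U \<and> v - u \<in> C" using UC_sum by (metis add_diff_cancel_left')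
  then obtain p where p: "\<And>v. p v \<in> U" "\<And>v. v - p v \<in> C" by metis
  have uniq: "p v = u" if "u \<in> U" "v - u \<in> C" for u v
  proof -
    have "p v - u \<in> U" using subspace_diff[OF subU p(1) that(1)] .
    moreover have "(v - u) - (v - p v) \<in> C" using subspace_diff[OF subC that(2) p(2)] .
    then have "p v - u \<in> C" by simp
    ultimately show ?thesis using UC_Int by fastforce
  qed
  have "p (a + b) = p a + p b" for a b
  proof (rule uniq)
    show "p a + p b \<in> U" using p subU subspace_add by blast
    show "a + b - (p a + p b) \<in> C" using subspace_add[OF subC p(2)[of a] p(2)[of b]] by (simp add: algebra_simps)
  qed
  moreover have "p (c *s a) = c *s p a" for c a
  proof (rule uniq)
    show "c *s p a \<in> U" using p subU subspace_scale by blast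
    show "c *s a - c *s p a \<in> C" using subspace_scale[OF subC p(2)[of a]] by (simp add: scale_right_diff_distrib)
  qed
  ultimately have "lin p" by (simp add: lin_def)
  moreover have "p u = u" if "u \<in> U" for u using uniq[OF that] subspace_0[OF subC] by simp
  moreover have "p c = 0" if "c \<in> C" for c using uniq[OF subspace_0[OF subU]] that by simp
  ultimately show thesis using that p(1) by blast
qed

lemma coords_of_basis:
  assumes B: "independent B" "span B = U" and e: "bij_betw e {..<l} B"
  shows "\<exists>x. coords U C l e x"
proof -
  obtain p where p: "lin p" "\<And>v. p v \<in> U" "\<And>u. u \<in> U \<Longrightarrow> p u = u" "\<And>c. c \<in> C \<Longrightarrow> p c = 0"
    using projection by blast
  define x where "x i v = representation B (p v) (e i)" for i v
  have eB: "e i \<in> B" if "i < l" for i using e that by (auto simp: bij_betw_def)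
  have eU: "e i \<in> U" if "i < l" for i using eB[OF that] B(2) span_base by blast
  have "lform (x i)" for i
    unfolding lform_def x_def using p B by (simp add: lin_simps representation_add representation_scale)
  moreover have "x i (e j) = (if i = j then 1 else 0)" if "i < l" "j < l" for i j
  proof -
    have "e j = e i \<longleftrightarrow> i = j" using e that by (auto simp: bij_betw_def inj_on_def)
    then show ?thesis unfolding x_def using p(3)[OF eU] that B eB by (auto simp: representation_basis)
  qed
  moreover have "x i c = 0" if "c \<in> C" for i c unfolding x_def by (simp add: p(4)[OF that] representation_zero)
  moreover have "u = (\<Sum>i<l. x i u *s e i)" if u: "u \<in> U" for u
  proof -
    have "finite B" using e bij_betw_finite by blast
    have "u = (\<Sum>b\<in>B. representation B u b *s b)"
      using sum_representation_eq[OF B(1) _ \<open>finite B\<close>, of u] u B(2) by simp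
    also have "\<dots> = (\<Sum>i<l. x i u *s e i)"
      unfolding x_def p(3)[OF u] by (rule sum.reindex_bij_betw[OF e, symmetric])
    finally show ?thesis .
  qed
  ultimately show ?thesis using eU unfolding coords_def by blast
qed

lemma modular_line_basis:
  assumes q: "modular_line q" "q \<notin> C"
  obtains e x where "coords U C (dim U) e x" "\<And>i. i < dim U \<Longrightarrow> modular_line (e i)"
proof -
  \<comment> \<open>Only the component in \<open>U\<close> is kept, so that its orbit stays in
    \<open>U\<close> and irreducibility applies to its span.\<close>
  obtain p c where p: "p \<in> U" "c \<in> C" "q = p + c" using UC_sum by blast
  have "p \<noteq> 0" using p q by auto
  have "p = q + - c" using p by simp
  then have mp: "modular_line p" using modular_line_shift[OF q(1), of "- c"] p(2) subC subspace_neg by metis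
  define Orb where "Orb = {g p | g. g \<in> G}"
  have OU: "Orb \<subseteq> U" using G_U p(1) by (auto simp: Orb_def)
  have Og: "g u \<in> Orb" if "g \<in> G" "u \<in> Orb" for g u
    using that G_comp by (auto simp: Orb_def) (metis comp_apply)
  have pO: "p \<in> Orb" using G_id unfolding Orb_def by (intro CollectI exI[of _ id]) simp
  have "span Orb = {0} \<or> span Orb = U"
  proof (rule irr)
    show "subspace (span Orb)" by simp
    show "span Orb \<subseteq> U" using OU subU span_minimal by blast
    fix g u assume g: "g \<in> G" and u: "u \<in> span Orb"
    from u show "g u \<in> span Orb"
    proof (induction rule: span_induct_alt)
      case base then show ?case using lin_0[OF G_lin[OF g]] span_zero by simp
    next
      case (step c x y)
      then show ?case using G_lin[OF g] Og[OF g, of x]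
        by (simp add: lin_simps span_add span_scale span_base)
    qed
  qed
  then have sp: "span Orb = U" using pO \<open>p \<noteq> 0\<close> span_base by blast
  obtain B where B: "B \<subseteq> Orb" "independent B" "Orb \<subseteq> span B"
    using maximal_independent_subset by metis
  have spB: "span B = U" using B sp by (metis span_mono span_span subset_antisym)
  have "finite B" using B(2) finiteI_independent by blast
  have card: "card B = dim U" using B(2) spB by (metis dim_span_eq_card_independent)
  obtain e where e: "bij_betw e {..<dim U} B"
    using ex_bij_betw_nat_finite[OF \<open>finite B\<close>] card by (auto simp: atLeast0LessThan)
  obtain x where x: "coords U C (dim U) e x" using coords_of_basis[OF B(2) spB e] by blast
  have "modular_line (e i)" if "i < dim U" for i
  proof -
    have "e i \<in> Orb" using e that B by (auto simp: bij_betw_def)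
    then show ?thesis using modular_line_image mp by (auto simp: Orb_def)
  qed
  then show thesis using that x by blast
qed

end

context cspace
begin

lemma coords_dual:
  assumes "coords U C l e x" "i < l" "j < l" shows "x i (e j) = (if i = j then 1 else 0)"
  using assms by (simp add: coords_def)

lemma coords_lform: "coords U C l e x \<Longrightarrow> i < l \<Longrightarrow> lform (x i)"
  by (simp add: coords_def)

lemma comb_lform: "coords U C l e x \<Longrightarrow> lform (comb l x a)"
  unfolding lform_def comb_def
  by (auto simp: lform_simps coords_lform sum.distrib sum_distrib_left algebra_simps intro!: sum.cong)

lemma comb_e: "coords U C l e x \<Longrightarrow> j < l \<Longrightarrow> comb l x a (e j) = a j"
  by (simp add: comb_def coords_dual if_distrib[of "\<lambda>z. _ * z"] cong: if_cong)

lemma comb_scale: "comb l x (\<lambda>i. c * a i) u = c * comb l x a u"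
  by (simp add: comb_def sum_distrib_left mult.assoc)

lemma comb_add: "comb l x (\<lambda>i. a i + b i) u = comb l x a u + comb l x b u"
  by (simp add: comb_def sum.distrib algebra_simps)

lemma comb_cong: "(\<And>i. i < l \<Longrightarrow> a i = b i) \<Longrightarrow> comb l x a = comb l x b"
  by (auto simp: comb_def intro!: sum.cong)

lemma comb_coord: "i < l \<Longrightarrow> comb l x (\<lambda>j. if j = i then 1 else 0) = x i"
  by (auto simp: comb_def if_distrib[of "\<lambda>z. z * _"] cong: if_cong)

lemma coords_rescale:
  assumes "coords U C l e x" "\<And>i. i < l \<Longrightarrow> c i \<noteq> 0" "subspace U"
  shows "coords U C l (\<lambda>i. (1 / c i) *s e i) (\<lambda>i u. c i * x i u)"
proof -
  have "lform (\<lambda>u. c i * x i u)" if "i < l" for i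
    using coords_lform[OF assms(1) that] by (simp add: lform_def algebra_simps)
  then show ?thesis using assms unfolding coords_def
    by (auto simp: lform_simps subspace_scale)
qed

end

context refl_factor
begin

lemma form_comb:
  assumes x: "coords U C l e x" and f: "lform f" "\<And>c. c \<in> C \<Longrightarrow> f c = 0"
  shows "f = comb l x (\<lambda>i. f (e i))"
proof
  fix v
  obtain u c where u: "u \<in> U" "c \<in> C" "v = u + c" using UC_sum by blast
  have "f u = f (\<Sum>i<l. x i u *s e i)" using x u by (simp add: coords_def)
  also have "\<dots> = comb l x (\<lambda>i. f (e i)) u" using f by (simp add: lform_simps comb_def mult.commute)
  finally have "f u = comb l x (\<lambda>i. f (e i)) u" .
  moreover have "comb l x (\<lambda>i. f (e i)) c = 0" using x u by (simp add: coords_def comb_def)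
  ultimately show "f v = comb l x (\<lambda>i. f (e i)) v"
    using u f lform_add[OF comb_lform[OF x]] by (simp add: lform_add)
qed

lemma U_eqI: assumes x: "coords U C l e x" and "u \<in> U" "w \<in> U" "\<And>i. i < l \<Longrightarrow> x i u = x i w" shows "u = w"
proof -
  have "u = (\<Sum>i<l. x i u *s e i)" "w = (\<Sum>i<l. x i w *s e i)" using x assms(2,3) unfolding coords_def by blast+
  moreover have "(\<Sum>i<l. x i u *s e i) = (\<Sum>i<l. x i w *s e i)" using assms(4) by simp
  ultimately show ?thesis by simp
qed

text \<open>The predicate \<open>R\<close> of \<open>modular_coeffs\<close> for the arrangement of
  \<open>G\<close>.\<close>

definition coeff_rel :: "nat \<Rightarrow> (nat \<Rightarrow> 'v \<Rightarrow> complex) \<Rightarrow> (nat \<Rightarrow> complex) \<Rightarrow> bool" where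
  "coeff_rel l x a \<longleftrightarrow> {u. comb l x a u = 0} \<in> arr G"

lemma coeff_rel_nz: assumes x: "coords U C l e x" and a: "coeff_rel l x a" shows "\<exists>i<l. a i \<noteq> 0"
proof (rule ccontr)
  assume "\<not> (\<exists>i<l. a i \<noteq> 0)"
  then have "{u. comb l x a u = 0} = UNIV" by (auto simp: comb_def)
  then have "hyp UNIV" using arr_hyp a unfolding coeff_rel_def by metis
  then show False by (auto simp: hyp_def)
qed

lemma hyp_comb: assumes x: "coords U C l e x" "i < l" "a i \<noteq> 0" shows "hyp {u. comb l x a u = 0}"
  unfolding hyp_def using comb_lform[OF x(1)] comb_e[OF x(1,2), of a] x(3) by metis

text \<open>A modular line may be added to any flat, and \<open>C\<close> is the flat from which the
  induction starts.\<close>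

lemma sum_modular_lines:
  assumes x: "coords U C l e x" and m: "\<And>i. i < l \<Longrightarrow> modular_line (e i)" and CL: "C \<in> LL"
  shows "finite J \<Longrightarrow> J \<subseteq> {..<l} \<Longrightarrow> {c + (\<Sum>j\<in>J. t j *s e j) | c t. c \<in> C} \<in> LL"
proof (induction J rule: finite_induct)
  case empty then show ?case using CL by simp
next
  case (insert j J)
  let ?Y = "{c + (\<Sum>j\<in>J. t j *s e j) | c t. c \<in> C}"
  have "{y + t *s e j | y t. y \<in> ?Y} \<in> LL"
    using m[of j] insert unfolding modular_line_def by auto
  moreover have "{y + t *s e j | y t. y \<in> ?Y} = {c + (\<Sum>j\<in>insert j J. t j *s e j) | c t. c \<in> C}"
  proof (intro subset_antisym subsetI)
    fix u assume "u \<in> {y + t *s e j | y t. y \<in> ?Y}"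
    then obtain c t s where u: "u = c + (\<Sum>j\<in>J. t j *s e j) + s *s e j" "c \<in> C" by blast
    have "(\<Sum>k\<in>insert j J. (t(j := s)) k *s e k) = (\<Sum>j\<in>J. t j *s e j) + s *s e j"
      using insert(1,2) by (auto simp: add.commute intro!: sum.cong)
    then show "u \<in> {c + (\<Sum>j\<in>insert j J. t j *s e j) | c t. c \<in> C}"
      using u by (intro CollectI exI[of _ c] exI[of _ "t(j := s)"]) (simp add: add.assoc)
  next
    fix u assume "u \<in> {c + (\<Sum>j\<in>insert j J. t j *s e j) | c t. c \<in> C}"
    then obtain c t where u: "u = c + (\<Sum>j\<in>insert j J. t j *s e j)" "c \<in> C" by blast
    then have "u = (c + (\<Sum>j\<in>J. t j *s e j)) + t j *s e j" using insert(1,2) by (simp add: algebra_simps)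
    then show "u \<in> {y + t *s e j | y t. y \<in> ?Y}" using u(2) by blast
  qed
  ultimately show ?case by simp
qed

text \<open>The sum of \<open>C\<close> and all modular lines but the i-th is a flat and equals the
  kernel of the i-th coordinate; a flat that is a hyperplane is a member of the arrangement.\<close>

lemma coord_hyperplane:
  assumes x: "coords U C l e x" and m: "\<And>i. i < l \<Longrightarrow> modular_line (e i)" and CL: "C \<in> LL" and i: "i < l"
  shows "{u. x i u = 0} \<in> arr G"
proof -
  let ?J = "{..<l} - {i}"
  have 1: "{c + (\<Sum>j\<in>?J. t j *s e j) | c t. c \<in> C} \<in> LL"
    using sum_modular_lines[OF x m CL, of ?J] by auto
  have 2: "{c + (\<Sum>j\<in>?J. t j *s e j) | c t. c \<in> C} = {u. x i u = 0}"
  proof (intro subset_antisym subsetI)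
    fix u assume "u \<in> {c + (\<Sum>j\<in>?J. t j *s e j) | c t. c \<in> C}"
    then obtain c t where u: "u = c + (\<Sum>j\<in>?J. t j *s e j)" "c \<in> C" by blast
    have "x i c = 0" using x i u by (simp add: coords_def)
    then show "u \<in> {u. x i u = 0}"
      using u coords_lform[OF x i] i by (simp add: lform_simps coords_dual[OF x])
  next
    fix v assume "v \<in> {u. x i u = 0}"
    then have v: "x i v = 0" by simp
    obtain u c where u: "u \<in> U" "c \<in> C" "v = u + c" using UC_sum by blast
    have "x i c = 0" using x i u by (simp add: coords_def)
    then have xu: "x i u = 0" using v u coords_lform[OF x i] by (simp add: lform_simps)
    have "u = (\<Sum>j<l. x j u *s e j)" using x u by (simp add: coords_def)
    also have "\<dots> = x i u *s e i + (\<Sum>j\<in>?J. x j u *s e j)" using i by (simp add: sum.remove)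
    finally have "v = c + (\<Sum>j\<in>?J. x j u *s e j)" using u xu by (simp add: add.commute)
    then show "v \<in> {c + (\<Sum>j\<in>?J. t j *s e j) | c t. c \<in> C}"
      using u(2) by (intro CollectI exI[of _ c] exI[of _ "\<lambda>j. x j u"]) simp
  qed
  have "hyp {u. x i u = 0}" using hyp_comb[OF x i, of "\<lambda>j. if j = i then 1 else 0"] by (simp add: comb_coord i)
  then show ?thesis using LL_hyp 1 2 by simp
qed

text \<open>Adding the i-th line to the flat \<open>?Y\<close> eliminates x_i from its two
  equations; what is left is one equation, nontrivial because the normalized forms differ.\<close>

lemma modular_difference:
  assumes x: "coords U C l e x" and m: "modular_line (e i)" and i: "i < l"
    and a: "coeff_rel l x a" "a i \<noteq> 0" and b: "coeff_rel l x b" "b i \<noteq> 0"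
    and ne: "\<exists>j<l. a j / a i \<noteq> b j / b i"
  shows "coeff_rel l x (\<lambda>j. a j / a i - b j / b i)"
proof -
  let ?c = "\<lambda>j. a j / a i - b j / b i"
  let ?Y = "{u. comb l x a u = 0} \<inter> {u. comb l x b u = 0}"
  note la = comb_lform[OF x, of a] and lb = comb_lform[OF x, of b]
  have "?Y \<in> LL" using a b Int_LL arr_LL unfolding coeff_rel_def by blast
  then have 1: "{y + t *s e i | y t. y \<in> ?Y} \<in> LL" using m unfolding modular_line_def by blast
  have c: "comb l x ?c u = comb l x a u / a i - comb l x b u / b i" for u
    by (simp add: comb_def sum_subtractf sum_divide_distrib left_diff_distrib)
  have "{y + t *s e i | y t. y \<in> ?Y} = {u. comb l x ?c u = 0}"
  proof (intro subset_antisym subsetI)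
    fix u assume "u \<in> {y + t *s e i | y t. y \<in> ?Y}"
    then show "u \<in> {u. comb l x ?c u = 0}"
      using a(2) b(2) la lb comb_e[OF x i] by (auto simp: c lform_simps)
  next
    fix u assume "u \<in> {u. comb l x ?c u = 0}"
    then have cu: "comb l x a u / a i = comb l x b u / b i" by (simp add: c)
    \<comment> \<open>Subtracting this multiple of \<open>e i\<close> annihilates the first form,
      and by equality of the two quotients also the second.\<close>
    let ?t = "comb l x a u / a i"
    have "comb l x b u = ?t * b i" using cu b(2) by simp
    then have "u - ?t *s e i \<in> ?Y"
      using la lb comb_e[OF x i] a(2) by (auto simp: lform_simps)
    moreover have "u = (u - ?t *s e i) + ?t *s e i" by simp
    ultimately show "u \<in> {y + t *s e i | y t. y \<in> ?Y}" by blast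
  qed
  moreover obtain j where "j < l" "?c j \<noteq> 0" using ne by auto
  then have "hyp {u. comb l x ?c u = 0}" using hyp_comb[OF x, of j ?c] by simp
  ultimately show ?thesis unfolding coeff_rel_def using LL_hyp 1 by simp
qed

lemma coeff_rel_modular:
  assumes x: "coords U C l e x" and m: "\<And>i. i < l \<Longrightarrow> modular_line (e i)" and CL: "C \<in> LL"
  shows "modular_coeffs l (coeff_rel l x)"
proof
  fix a c assume "coeff_rel l x a" "c \<noteq> (0::complex)"
  then show "coeff_rel l x (\<lambda>i. c * a i)" by (simp add: coeff_rel_def comb_scale)
next
  fix a b assume "coeff_rel l x a" "\<And>i. i < l \<Longrightarrow> a i = b i"
  then show "coeff_rel l x b" using comb_cong[of l a b x] by (simp add: coeff_rel_def)
next
  fix i assume "i < l"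
  then show "coeff_rel l x (\<lambda>j. if j = i then 1 else 0)"
    using coord_hyperplane[OF x m CL] by (simp add: coeff_rel_def comb_coord)
next
  fix a b i assume "coeff_rel l x a" "coeff_rel l x b" "i < l" "a i \<noteq> 0" "b i \<noteq> 0" "\<exists>j<l. a j / a i \<noteq> b j / b i"
  then show "coeff_rel l x (\<lambda>j. a j / a i - b j / b i)" using modular_difference[OF x m] by blast
next
  fix a assume "coeff_rel l x a" then show "\<exists>i<l. a i \<noteq> 0" by (rule coeff_rel_nz[OF x])
next
  fix i j assume ij: "i < l" "j < l" "i \<noteq> j"
  let ?p = "\<lambda>c k. if k = i then 1 else if k = j then - c else (0::complex)"
  \<comment> \<open>The vector \<open>d *s e i + e j\<close> lies on the hyperplane of ratio
    \<open>c\<close> only for \<open>d = c\<close>, so distinct ratios give distinct members of the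
    finite arrangement.\<close>
  have e: "comb l x (?p c) (d *s e i + e j) = d - c" for c d
    using lform_simps[OF comb_lform[OF x]] comb_e[OF x] ij by simp
  have "inj_on (\<lambda>c. {u. comb l x (?p c) u = 0}) {c. coeff_rel l x (?p c)}"
  proof (rule inj_onI)
    fix c d assume "{u. comb l x (?p c) u = 0} = {u. comb l x (?p d) u = 0}"
    moreover have "comb l x (?p c) (c *s e i + e j) = 0" by (simp add: e)
    ultimately have "comb l x (?p d) (c *s e i + e j) = 0" by blast
    then show "c = d" by (simp add: e)
  qed
  moreover have "finite ((\<lambda>c. {u. comb l x (?p c) u = 0}) ` {c. coeff_rel l x (?p c)})"
    by (rule finite_subset[OF _ arr_finite]) (auto simp: coeff_rel_def)
  ultimately show "finite {c. coeff_rel l x (?p c)}" using finite_imageD by blast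
qed

lemma reflection_coeffs:
  assumes x: "coords U C l e x" and g: "g \<in> G" "reflection g"
  obtains a v where "coeff_rel l x a" "v \<in> U" "v \<noteq> 0" "g = (\<lambda>u. u + comb l x a u *s v)"
proof -
  obtain f v where f: "lform f" "\<exists>u. f u \<noteq> 0" "v \<noteq> 0" "g = (\<lambda>u. u + f u *s v)"
    using g(2) unfolding reflection_def by blast
  have g': "(\<lambda>u. u + f u *s v) \<in> G" using g f by simp
  have fc: "f = comb l x (\<lambda>i. f (e i))" using form_comb[OF x f(1)] root_in_U(2)[OF g' f(1,2,3)] by blast
  obtain w where "f w \<noteq> 0" using f by blast
  then have "{u. f u = 0} \<in> arr G" using arrI[OF f(1) _ f(3) g'] by blast
  then have "coeff_rel l x (\<lambda>i. f (e i))" unfolding coeff_rel_def using fc by simp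
  then show thesis using that root_in_U(1)[OF g' f(1,2,3)] f fc by metis
qed

text \<open>Forms with the same kernel are proportional, and the factor is absorbed into the
  root.\<close>

lemma coeffs_reflection:
  assumes x: "coords U C l e x" and a: "coeff_rel l x a"
  obtains v where "v \<in> U" "v \<noteq> 0" "(\<lambda>u. u + comb l x a u *s v) \<in> G"
proof -
  obtain f v where f: "lform f" "\<exists>u. f u \<noteq> 0" "v \<noteq> 0" "(\<lambda>u. u + f u *s v) \<in> G"
    "{u. comb l x a u = 0} = {u. f u = 0}"
    using arrE[OF a[unfolded coeff_rel_def]] by blast
  obtain c where c: "\<And>u. f u = c * comb l x a u"
    using lform_ker_subset[OF comb_lform[OF x] f(1)] f(5) by blast
  then have "c \<noteq> 0" using f(2) by auto
  have "(\<lambda>u. u + comb l x a u *s (c *s v)) = (\<lambda>u. u + f u *s v)" using c by (simp add: mult.commute)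
  then show thesis using that[of "c *s v"] f root_in_U(1)[OF f(4,1,2,3)] subspace_scale[OF subU] \<open>c \<noteq> 0\<close> by simp
qed

text \<open>Pulling a hyperplane of the arrangement back along the reflection gives another one, and
  its form at \<open>u\<close> is b(u) + a(u) b(v).\<close>

lemma coeff_action:
  assumes x: "coords U C l e x" and v: "v \<in> U" and g: "(\<lambda>u. u + comb l x a u *s v) \<in> G" and b: "coeff_rel l x b"
  shows "coeff_rel l x (\<lambda>k. b k + a k * (\<Sum>m<l. b m * x m v))"
proof -
  have "comb l x (\<lambda>k. b k + a k * (\<Sum>m<l. b m * x m v)) u = comb l x b (u + comb l x a u *s v)" for u
    using lform_simps[OF comb_lform[OF x, of b]]
    by (simp add: comb_add mult.commute[of "a _"] comb_scale)
       (simp add: comb_def[of l x b v])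
  then show ?thesis using arr_vimage[OF g b[unfolded coeff_rel_def]] by (simp add: coeff_rel_def)
qed

text \<open>Otherwise the reflection would map its own root to 0.\<close>

lemma root_not_minus_one:
  assumes x: "coords U C l e x" and "v \<noteq> 0" and g: "(\<lambda>u. u + comb l x a u *s v) \<in> G"
  shows "1 + (\<Sum>m<l. a m * x m v) \<noteq> 0"
proof
  assume 0: "1 + (\<Sum>m<l. a m * x m v) = 0"
  have "v + comb l x a v *s v = (1 + comb l x a v) *s v" by (simp add: scale_left_distrib)
  then have "v + comb l x a v *s v = 0 + comb l x a 0 *s v"
    using 0 lform_0[OF comb_lform[OF x]] by (simp add: comb_def)
  then have "v = 0" using G_bij[OF g] by (meson bij_is_inj injD)
  then show False using assms by blast
qed

text \<open>Irreducibility expressed by forms. If no form met both \<open>S\<close> and its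
  complement, the span of the e_i with i in \<open>S\<close> would be stable under all reflections,
  hence under \<open>G\<close>.\<close>

lemma coeff_connected:
  assumes x: "coords U C l e x" and S: "S \<subseteq> {..<l}" "S \<noteq> {}" "S \<noteq> {..<l}" and co: "\<And>i. i < l \<Longrightarrow> {u. x i u = 0} \<in> arr G"
  shows "\<exists>a i j. coeff_rel l x a \<and> i \<in> S \<and> j < l \<and> j \<notin> S \<and> a i \<noteq> 0 \<and> a j \<noteq> 0"
proof (rule ccontr)
  assume n: "\<not> ?thesis"
  define T where "T = {u \<in> U. \<forall>j<l. j \<notin> S \<longrightarrow> x j u = 0}"
  have sT: "subspace T"
    using subU coords_lform[OF x] by (auto simp: T_def subspace_def lform_simps)
  have gT: "g u \<in> T" if "g \<in> mcl {g \<in> G. reflection g}" "u \<in> T" for g u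
    using that
  proof (induction rule: mcl.induct)
    case (step s g)
    then have w: "g u \<in> T" by blast
    obtain a v where a: "coeff_rel l x a" "v \<in> U" "v \<noteq> 0" "s = (\<lambda>u. u + comb l x a u *s v)"
      using reflection_coeffs[OF x] step by blast
    have sG: "(\<lambda>u. u + comb l x a u *s v) \<in> G" using a step by blast
    show ?case
    proof (cases "comb l x a (g u) = 0")
      case True then show ?thesis using w a by simp
    next
      case False
      then obtain i where i: "i < l" "a i \<noteq> 0" "x i (g u) \<noteq> 0"
        unfolding comb_def by (metis (mono_tags, lifting) lessThan_iff mult_eq_0_iff sum.not_neutral_contains_not_neutral)
      then have iS: "i \<in> S" using w by (auto simp: T_def)
      \<comment> \<open>The form \<open>a\<close> has a nonzero entry at \<open>i\<close> in
        \<open>S\<close>. If the root had a nonzero coordinate at \<open>j\<close> outside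
        \<open>S\<close>, the reflection would turn the coordinate form x_j into one with entries at
        both \<open>i\<close> and \<open>j\<close>.\<close>
      have "x j v = 0" if j: "j < l" "j \<notin> S" for j
      proof (rule ccontr)
        assume v: "x j v \<noteq> 0"
        let ?b = "\<lambda>k. if k = j then 1 else (0::complex)"
        have "coeff_rel l x ?b" unfolding coeff_rel_def using co j by (simp add: comb_coord)
        from coeff_action[OF x a(2) sG this]
        have R: "coeff_rel l x (\<lambda>k. ?b k + a k * x j v)"
          using j by (simp add: if_distrib[of "\<lambda>z. z * _"] cong: if_cong)
        have "a j = 0" using n a(1) iS i j by blast
        then have "?b j + a j * x j v \<noteq> 0" by simp
        moreover have "?b i + a i * x j v \<noteq> 0" using iS j i v by auto
        ultimately show False using n R iS j by blast
      qed
      then have "v \<in> T" using a(2) by (simp add: T_def)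
      then show ?thesis using w sT a(4) by (simp add: subspace_add subspace_scale)
    qed
  qed simp
  have "T = {0} \<or> T = U"
  proof (rule irr[OF sT])
    show "T \<subseteq> U" by (auto simp: T_def)
    fix g u assume "g \<in> G" "u \<in> T"
    then show "g u \<in> T" using gT[of g u] G_gen by blast
  qed
  moreover obtain i where i: "i \<in> S" "i < l" using S by blast
  then have "e i \<in> T" using x by (auto simp: T_def coords_def)
  moreover have "e i \<noteq> 0" using coords_dual[OF x, of i i] i lform_0[OF coords_lform[OF x i(2)]] by auto
  moreover obtain j where j: "j < l" "j \<notin> S" using S by auto
  moreover have "e j \<in> U" using x j by (simp add: coords_def)
  moreover have "e j \<notin> T" using j coords_dual[OF x, of j j] by (auto simp: T_def)
  ultimately show False by blast
qed

lemma normalized_modular_basis: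
  assumes q: "modular_line q" "q \<notin> C" and CL: "C \<in> LL" and l: "l = dim U" "3 \<le> l"
  obtains e x where "coords U C l e x" "normalized_coeffs l (coeff_rel l x)"
proof -
  obtain e x where x: "coords U C l e x" and m: "\<And>i. i < l \<Longrightarrow> modular_line (e i)"
    using modular_line_basis[OF q] l by blast
  interpret M: modular_coeffs l "coeff_rel l x" by (rule coeff_rel_modular[OF x m CL])
  have "M.D 0 j \<noteq> {}" if "j < l" "j \<noteq> 0" for j
    using coeff_connected[OF x _ _ _ coord_hyperplane[OF x m CL]] that l by (intro M.D_0_nonempty) auto
  then have "\<forall>j. \<exists>c. j < l \<and> j \<noteq> 0 \<longrightarrow> c \<in> M.D 0 j" by blast
  then obtain c0 where c0: "\<And>j. j < l \<Longrightarrow> j \<noteq> 0 \<Longrightarrow> c0 j \<in> M.D 0 j" by metis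
  \<comment> \<open>For \<open>j \<noteq> 0\<close> this is a ratio in \<open>D 0 j\<close>, so the
    hyperplane x_0 = c_j x_j equates the rescaled coordinates; the 0-th coordinate is kept.\<close>
  define c where "c j = (if j = 0 then 1 else c0 j)" for j
  have cnz: "c j \<noteq> 0" if "j < l" for j using c0[of j] that by (auto simp: c_def M.D_def)
  let ?e = "\<lambda>i. (1 / c i) *s e i" and ?x = "\<lambda>i u. c i * x i u"
  have x': "coords U C l ?e ?x" using x cnz subU by (rule coords_rescale)
  have m': "modular_line (?e i)" if i: "i < l" for i
    unfolding modular_line_def
  proof
    fix Y assume Y: "Y \<in> LL"
    have "{y + t *s ?e i | y t. y \<in> Y} = {y + t *s e i | y t. y \<in> Y}"
    proof (intro subset_antisym subsetI)
      fix u assume "u \<in> {y + t *s ?e i | y t. y \<in> Y}"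
      then obtain y t where "u = y + (t / c i) *s e i" "y \<in> Y" by auto
      then show "u \<in> {y + t *s e i | y t. y \<in> Y}" by blast
    next
      fix u assume "u \<in> {y + t *s e i | y t. y \<in> Y}"
      then obtain y t where "u = y + t *s e i" "y \<in> Y" by auto
      then have "u = y + (t * c i) *s ?e i" "y \<in> Y" using cnz[OF i] by auto
      then show "u \<in> {y + t *s ?e i | y t. y \<in> Y}" by blast
    qed
    then show "{y + t *s ?e i | y t. y \<in> Y} \<in> LL" using m[OF i] Y unfolding modular_line_def by simp
  qed
  interpret N: modular_coeffs l "coeff_rel l ?x" by (rule coeff_rel_modular[OF x' m' CL])
  have "normalized_coeffs l (coeff_rel l ?x)"
  proof (unfold_locales)
    show "3 \<le> l" by fact
    fix j assume j: "0 < j" "j < l"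
    have "comb l ?x (N.pairform 0 j 1) = comb l x (M.pairform 0 j (c0 j))"
      using j unfolding comb_def N.pairform_def M.pairform_def
      by (auto simp: c_def intro!: sum.cong)
    then show "1 \<in> N.D 0 j" using c0[of j] j unfolding N.D_def M.D_def by (simp add: coeff_rel_def)
  qed
  then show thesis using that x' by blast
qed

end

section \<open>Determination of the reflections\<close>

context cspace
begin

text \<open>The monomial transformation taking \<open>e j\<close> to
  \<open>d j *s e (\<sigma> j)\<close>, written as a perturbation of the identity so that it is
  trivial on \<open>C\<close>.\<close>

definition mon :: "nat \<Rightarrow> (nat \<Rightarrow> 'v) \<Rightarrow> (nat \<Rightarrow> 'v \<Rightarrow> complex) \<Rightarrow> (nat \<Rightarrow> nat) \<Rightarrow> (nat \<Rightarrow> complex) \<Rightarrow> 'v \<Rightarrow> 'v" where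
  "mon l e x \<sigma> d u = u + (\<Sum>j<l. x j u *s (d j *s e (\<sigma> j) - e j))"

lemma lin_sum_forms: "(\<And>j. j < l \<Longrightarrow> lform (x j)) \<Longrightarrow> lin (\<lambda>u. u + (\<Sum>j<l. x j u *s w j))"
  unfolding lin_def
  by (auto simp: lform_simps scale_left_distrib scale_right_distrib sum.distrib scale_sum_right algebra_simps
      intro!: sum.cong)

lemma lin_mon: "coords U C l e x \<Longrightarrow> lin (mon l e x \<sigma> d)"
  unfolding mon_def[abs_def] by (rule lin_sum_forms) (simp add: coords_lform)

lemma sum_delta_scale:
  fixes k l :: nat
  shows "(\<Sum>j<l. (if j = k then 1 else 0) *s w j) = (if k < l then w k else (0::'v))"
  "(\<Sum>j<l. (if k = j then 1 else 0) *s w j) = (if k < l then w k else (0::'v))"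
  by (simp_all add: if_distrib[of "\<lambda>z. z *s _"] cong: if_cong)

lemma mon_e:
  assumes x: "coords U C l e x" and k: "k < l"
  shows "mon l e x \<sigma> d (e k) = d k *s e (\<sigma> k)"
proof -
  have "(\<Sum>j<l. x j (e k) *s (d j *s e (\<sigma> j) - e j)) =
      (\<Sum>j<l. (if j = k then 1 else 0) *s (d j *s e (\<sigma> j) - e j))"
    using coords_dual[OF x _ k] by (intro sum.cong) auto
  then show ?thesis unfolding mon_def sum_delta_scale using k by simp
qed

lemma mon_C: "coords U C l e x \<Longrightarrow> c \<in> C \<Longrightarrow> mon l e x \<sigma> d c = c"
  by (simp add: mon_def coords_def)

lemma lform_diff_scaled: "lform f \<Longrightarrow> lform g \<Longrightarrow> lform (\<lambda>u. f u - z * g u)"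
  by (auto simp: lform_def algebra_simps)

lemma lin_sw: "coords U C l e x \<Longrightarrow> i < l \<Longrightarrow> j < l \<Longrightarrow> lin (sw e x i j z)"
  unfolding sw_def[abs_def] by (intro lin_transvection lform_diff_scaled coords_lform)

lemma lin_dg: "coords U C l e x \<Longrightarrow> i < l \<Longrightarrow> lin (dg e x i t)"
  unfolding dg_def[abs_def] by (rule lin_transvection) (rule coords_lform)

lemma lin_sg: "coords U C l e x \<Longrightarrow> i < l \<Longrightarrow> lin (sg l e x i)"
  unfolding sg_def[abs_def] by (rule lin_transvection) (rule coords_lform)

lemma sw_C: "coords U C l e x \<Longrightarrow> i < l \<Longrightarrow> j < l \<Longrightarrow> c \<in> C \<Longrightarrow> sw e x i j z c = c"
  by (simp add: sw_def coords_def)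

lemma dg_C: "coords U C l e x \<Longrightarrow> i < l \<Longrightarrow> c \<in> C \<Longrightarrow> dg e x i t c = c"
  by (simp add: dg_def coords_def)

lemma sg_C: "coords U C l e x \<Longrightarrow> i < l \<Longrightarrow> c \<in> C \<Longrightarrow> sg l e x i c = c"
  by (simp add: sg_def coords_def)

lemma sw_e:
  assumes "coords U C l e x" "i < l" "j < l" "i \<noteq> j" "z \<noteq> 0" "k < l"
  shows "sw e x i j z (e k) = (if k = i then (1 / z) *s e j else if k = j then z *s e i else e k)"
  using assms by (auto simp: sw_def coords_dual scale_right_diff_distrib)

lemma dg_e: "coords U C l e x \<Longrightarrow> i < l \<Longrightarrow> k < l \<Longrightarrow> dg e x i t (e k) = (if k = i then t *s e i else e k)"
  by (auto simp: dg_def coords_dual scale_left_diff_distrib)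

lemma sg_e:
  "coords U C l e x \<Longrightarrow> i < l \<Longrightarrow> k < l \<Longrightarrow> sg l e x i (e k) = (if k = i then - (\<Sum>j<l. e j) else e k)"
  by (auto simp: sg_def coords_dual)

end

context refl_factor
begin

lemma lin_eqI:
  assumes x: "coords U C l e x" and "lin g" "lin h" "\<And>c. c \<in> C \<Longrightarrow> g c = h c" "\<And>k. k < l \<Longrightarrow> g (e k) = h (e k)"
  shows "g = h"
proof
  fix v
  obtain u c where u: "u \<in> U" "c \<in> C" "v = u + c" using UC_sum by blast
  have uu: "u = (\<Sum>i<l. x i u *s e i)" using x u unfolding coords_def by blast
  have "g (\<Sum>i<l. x i u *s e i) = h (\<Sum>i<l. x i u *s e i)"
    using assms(2,3,5) by (simp add: lin_simps)
  then have "g u = h u" using uu by simp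
  then show "g v = h v" using u assms by (simp add: lin_simps)
qed

lemma root_nz: assumes x: "coords U C l e x" and "v \<in> U" "v \<noteq> 0" shows "\<exists>m<l. x m v \<noteq> 0"
proof (rule ccontr)
  assume n: "\<not> ?thesis"
  have "v = 0"
    by (rule U_eqI[OF x assms(2) subspace_0[OF subU]]) (use n lform_0[OF coords_lform[OF x]] in auto)
  then show False using assms by blast
qed

context
  fixes l e x
  assumes x: "coords U C l e x" and N: "normalized_coeffs l (coeff_rel l x)"
begin

interpretation normalized_coeffs l "coeff_rel l x" by (rule N)

lemma comb_pairform: "i < l \<Longrightarrow> j < l \<Longrightarrow> i \<noteq> j \<Longrightarrow> comb l x (pairform i j z) u = x i u - z * x j u"
  unfolding comb_def using sum_pairform[of i j z "\<lambda>m. x m u"] by simp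

lemma is_swap:
  assumes ij: "i < l" "j < l" "i \<noteq> j" "z ^ r = 1"
    and v: "v \<in> U" "v \<noteq> 0" and g: "(\<lambda>u. u + comb l x (pairform i j z) u *s v) \<in> G"
  shows "(\<lambda>u. u + comb l x (pairform i j z) u *s v) = sw e x i j z"
proof -
  have z: "z \<noteq> 0" using ij r_pos by (auto simp: power_0_left)
  have xv: "x m v = (if m = i then - 1 else if m = j then 1 / z else 0)" if "m < l" for m
    using swap_root[OF ij, of "\<lambda>m. x m v"] coeff_action[OF x v(1) g] root_not_minus_one[OF x v(2) g]
      root_nz[OF x v] that by blast
  have eU: "e i \<in> U" "e j \<in> U" using x ij by (auto simp: coords_def)
  have "v = (1 / z) *s e j - e i"
    by (rule U_eqI[OF x v(1)])
      (use eU subU ij in \<open>auto simp: xv coords_dual[OF x] lform_simps[OF coords_lform[OF x]] subspace_diff subspace_scale\<close>)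
  then show ?thesis using comb_pairform[OF ij(1-3)] by (simp add: sw_def[abs_def])
qed

lemma is_coord_reflection:
  assumes i: "i < l" and v: "v \<in> U" "v \<noteq> 0" and g: "(\<lambda>u. u + x i u *s v) \<in> G"
  shows "r = 1 \<Longrightarrow> (\<lambda>u. u + x i u *s v) = sg l e x i"
    and "2 \<le> r \<Longrightarrow> \<exists>t. t \<noteq> 1 \<and> t ^ r = 1 \<and> (\<lambda>u. u + x i u *s v) = dg e x i t"
proof -
  let ?d = "\<lambda>k. if k = i then 1 else (0::complex)"
  have g': "(\<lambda>u. u + comb l x ?d u *s v) \<in> G" using g i by (simp add: comb_coord)
  have nz: "1 + x i v \<noteq> 0"
    using root_not_minus_one[OF x v(2) g'] i by (simp add: sum_coord)
  have act: "coeff_rel l x b \<Longrightarrow> coeff_rel l x (\<lambda>k. b k + (if k = i then 1 else 0) * (\<Sum>m<l. b m * x m v))" for b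
    using coeff_action[OF x v(1) g'] by blast
  have eU: "e k \<in> U" if "k < l" for k using x that by (auto simp: coords_def)
  show "(\<lambda>u. u + x i u *s v) = sg l e x i" if r1: "r = 1"
  proof -
    have xv: "x m v = (if m = i then - 2 else - 1)" if "m < l" for m
      using coord_root_1[OF i r1, of "\<lambda>m. x m v"] act nz root_nz[OF x v] that by blast
    have "v = - e i - (\<Sum>j<l. e j)"
    proof (rule U_eqI[OF x v(1)])
      show "- e i - (\<Sum>j<l. e j) \<in> U" using eU i subU by (auto intro!: subspace_diff subspace_neg subspace_sum)
      fix m assume m: "m < l"
      then show "x m v = x m (- e i - (\<Sum>j<l. e j))"
        using xv[OF m] i by (simp add: lform_simps[OF coords_lform[OF x]] coords_dual[OF x])
    qed
    then show ?thesis by (simp add: sg_def[abs_def])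
  qed
  show "\<exists>t. t \<noteq> 1 \<and> t ^ r = 1 \<and> (\<lambda>u. u + x i u *s v) = dg e x i t" if r2: "2 \<le> r"
  proof -
    have xv: "m < l \<Longrightarrow> m \<noteq> i \<Longrightarrow> x m v = 0" and t: "(1 + x i v) ^ r = 1" for m
      using coord_root_ge2[OF i r2, of "\<lambda>m. x m v"] act nz by blast+
    have "x i v \<noteq> 0" using root_nz[OF x v] xv by metis
    moreover have ve: "v = x i v *s e i"
      by (rule U_eqI[OF x v(1)])
        (use eU[OF i] subU i xv in \<open>auto simp: coords_dual[OF x] lform_simps[OF coords_lform[OF x]] subspace_scale\<close>)
    have "(\<lambda>u. u + x i u *s v) = dg e x i (1 + x i v)"
      unfolding dg_def by (subst ve) simp
    ultimately show ?thesis using t by (intro exI[of _ "1 + x i v"]) auto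
  qed
qed

lemma swap_in_G: assumes "i < l" "j < l" "i \<noteq> j" "z ^ r = 1" shows "sw e x i j z \<in> G"
proof -
  obtain v where v: "v \<in> U" "v \<noteq> 0" "(\<lambda>u. u + comb l x (pairform i j z) u *s v) \<in> G"
    using coeffs_reflection[OF x R_pairform[OF assms]] by blast
  then show ?thesis using is_swap[OF assms v] by simp
qed

lemma coord_in_G:
  assumes i: "i < l"
  shows "r = 1 \<Longrightarrow> sg l e x i \<in> G" "2 \<le> r \<Longrightarrow> \<exists>t. t \<noteq> 1 \<and> dg e x i t \<in> G"
proof -
  obtain v where v: "v \<in> U" "v \<noteq> 0" "(\<lambda>u. u + x i u *s v) \<in> G"
    using coeffs_reflection[OF x coord[OF i]] by (auto simp: comb_coord i)
  show "r = 1 \<Longrightarrow> sg l e x i \<in> G" using is_coord_reflection(1)[OF i v] v(3) by simp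
  show "2 \<le> r \<Longrightarrow> \<exists>t. t \<noteq> 1 \<and> dg e x i t \<in> G" using is_coord_reflection(2)[OF i v] v(3) by metis
qed

lemma reflection_cases:
  assumes g: "g \<in> G" "reflection g"
  shows "(\<exists>i j z. i < l \<and> j < l \<and> i \<noteq> j \<and> z ^ r = 1 \<and> g = sw e x i j z) \<or>
    (\<exists>i<l. (r = 1 \<longrightarrow> g = sg l e x i) \<and> (2 \<le> r \<longrightarrow> (\<exists>t. t ^ r = 1 \<and> g = dg e x i t)))"
proof -
  obtain a v where a: "coeff_rel l x a" "v \<in> U" "v \<noteq> 0" "g = (\<lambda>u. u + comb l x a u *s v)"
    using reflection_coeffs[OF x g] by blast
  have cU: "c *s v \<in> U" for c using a(2) subU subspace_scale by blast
  from a(1) show ?thesis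
  proof (cases rule: R_cases)
    case (1 i c)
    have "comb l x a u = c * x i u" for u
      using comb_cong[of l a "\<lambda>k. c * (if k = i then 1 else 0)" x] 1 comb_scale[of l x c] by (simp add: comb_coord)
    then have gg: "g = (\<lambda>u. u + x i u *s (c *s v))" using a(4) by (simp add: mult.commute)
    have cv: "c *s v \<noteq> 0" using 1 a(3) by simp
    show ?thesis using is_coord_reflection[OF 1(1) cU cv g(1)[unfolded gg]] gg 1(1) by blast
  next
    case (2 i j c z)
    have "comb l x a u = c * comb l x (pairform i j z) u" for u
      using comb_cong[of l a "\<lambda>k. c * pairform i j z k" x] 2 comb_scale[of l x c] by simp
    then have gg: "g = (\<lambda>u. u + comb l x (pairform i j z) u *s (c *s v))" using a(4) by (simp add: mult.commute)
    have cv: "c *s v \<noteq> 0" using 2 a(3) by simp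
    show ?thesis using is_swap[OF 2(1-3,5) cU cv g(1)[unfolded gg]] gg 2 by blast
  qed
qed

end

definition swaps :: "nat \<Rightarrow> (nat \<Rightarrow> 'v) \<Rightarrow> (nat \<Rightarrow> 'v \<Rightarrow> complex) \<Rightarrow> nat \<Rightarrow> ('v \<Rightarrow> 'v) set" where
  "swaps l e x r = {sw e x i j z | i j z. i < l \<and> j < l \<and> i \<noteq> j \<and> z ^ r = 1}"

definition diags :: "nat \<Rightarrow> (nat \<Rightarrow> 'v) \<Rightarrow> (nat \<Rightarrow> 'v \<Rightarrow> complex) \<Rightarrow> nat \<Rightarrow> ('v \<Rightarrow> 'v) set" where
  "diags l e x m = {dg e x i t | i t. i < l \<and> t ^ m = 1}"

text \<open>Conjugation by a swap carries diagonal reflections from one coordinate to another, so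
  all coordinates will admit the same eigenvalues.\<close>

lemma conj_dg:
  assumes x: "coords U C l e x" and "i < l" "j < l" "i \<noteq> j"
  shows "sw e x i j 1 \<circ> (dg e x j t \<circ> sw e x i j 1) = dg e x i t"
  using assms by (intro lin_eqI[OF x] lin_comp lin_sw[OF x] lin_dg[OF x])
    (auto simp: sw_C[OF x] dg_C[OF x] sw_e[OF x] dg_e[OF x] lin_scale[OF lin_sw[OF x]])

text \<open>In the second case \<open>r\<close> is the number of ratios and \<open>m\<close> the
  order of the group \<open>T\<close> of scalars by which \<open>G\<close> can multiply e_0 alone.
  Conjugation by swaps shows that all coordinates share \<open>T\<close>, and \<open>T\<close> is
  nontrivial because x_0 = 0 is a reflecting hyperplane.\<close>

theorem modular_line_classification:
  assumes q: "modular_line q" "q \<notin> C" and CL: "C \<in> LL" and l: "l = dim U" "3 \<le> l"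
  obtains (A) e x where "coords U C l e x" "G = mcl (swaps l e x 1 \<union> sg l e x ` {..<l})"
  | (M) e x r m where "coords U C l e x" "2 \<le> m" "m dvd r" "r > 0" "G = mcl (swaps l e x r \<union> diags l e x m)"
proof -
  obtain e x where x: "coords U C l e x" and N: "normalized_coeffs l (coeff_rel l x)"
    using normalized_modular_basis[OF q CL l] by blast
  interpret normalized_coeffs l "coeff_rel l x" by (rule N)
  have sub: "G = mcl S" if "{g \<in> G. reflection g} \<subseteq> S" "S \<subseteq> G" for S
  proof (rule subset_antisym)
    have "{g \<in> G. reflection g} \<subseteq> mcl S" using that mcl_incl by blast
    then show "G \<subseteq> mcl S" using mcl_least G_gen by blast
    show "mcl S \<subseteq> G" using mcl_least[of S "{g \<in> G. reflection g}"] that(2) G_gen by simp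
  qed
  note refl = reflection_cases[OF x N]
  have sG: "swaps l e x r \<subseteq> G" using swap_in_G[OF x N] by (auto simp: swaps_def)
  show thesis
  proof (cases "r = 1")
    case True
    have "G = mcl (swaps l e x 1 \<union> sg l e x ` {..<l})"
    proof (rule sub)
      show "{g \<in> G. reflection g} \<subseteq> swaps l e x 1 \<union> sg l e x ` {..<l}"
        using refl True unfolding swaps_def by fastforce
      show "swaps l e x 1 \<union> sg l e x ` {..<l} \<subseteq> G" using sG coord_in_G(1)[OF x N] True by auto
    qed
    then show thesis using A x by blast
  next
    case False
    then have r2: "2 \<le> r" using r_pos by simp
    define T where "T = {t. dg e x 0 t \<in> G}"
    have l0: "0 < l" using l by simp
    have dgmult: "dg e x 0 s \<circ> dg e x 0 t = dg e x 0 (s * t)" for s t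
      by (rule lin_eqI[OF x]) (auto simp: l0 lin_comp lin_dg[OF x l0] dg_C[OF x l0] dg_e[OF x l0] lin_scale[OF lin_dg[OF x l0]] mult.commute)
    have dg1: "dg e x i 1 = id" for i by (auto simp: dg_def)
    have dgi: "dg e x i t \<in> G \<longleftrightarrow> dg e x 0 t \<in> G" if i: "i < l" for i t
    proof (cases "i = 0")
      case False
      have "sw e x i 0 1 \<in> G" "sw e x 0 i 1 \<in> G" using swap_in_G[OF x N] False i l0 by auto
      then show ?thesis using conj_dg[OF x i l0 False, of t] conj_dg[OF x l0 i, of t] G_comp False by metis
    qed simp
    \<comment> \<open>For \<open>t \<noteq> 1\<close> the transformation is a reflection in x_0 = 0,
      and the analysis of coefficients allows only r-th roots of unity as its eigenvalue.\<close>
    have Tr: "t ^ r = 1" if t: "t \<in> T" for t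
    proof (cases "t = 1")
      case False
      have tG: "dg e x 0 t \<in> G" using t by (simp add: T_def)
      have "e 0 \<noteq> 0" using coords_dual[OF x l0 l0] lform_0[OF coords_lform[OF x l0]] by auto
      moreover have "e 0 \<in> U" using x l0 by (simp add: coords_def)
      ultimately have v: "(t - 1) *s e 0 \<in> U" "(t - 1) *s e 0 \<noteq> 0"
        using False subU by (auto simp: subspace_scale)
      obtain s where s: "s ^ r = 1" "dg e x 0 t = dg e x 0 s"
        using is_coord_reflection(2)[OF x N l0 v] tG r2 by (auto simp: dg_def[abs_def])
      have "t = s" using fun_cong[OF s(2), of "e 0"] dg_e[OF x l0 l0] v(2) by auto
      then show ?thesis using s by simp
    qed simp
    define m where "m = card T"
    have finT: "finite T" using finite_subset[of T "{z. z ^ r = 1}"] Tr r_pos finite_roots_unity[of r] by auto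
    have 1: "1 \<in> T" using G_id by (simp add: T_def dg1)
    have Tm: "T = {t. t ^ m = 1}" "m > 0"
    proof -
      have "0 \<notin> T" using Tr[of 0] r_pos by (auto simp: power_0_left)
      moreover have "s * t \<in> T" if "s \<in> T" "t \<in> T" for s t
        using that G_comp dgmult[of s t] by (metis T_def mem_Collect_eq)
      ultimately show "T = {t. t ^ m = 1}" "m > 0"
        unfolding m_def using finT 1 by (intro finite_mult_closed_roots_of_unity; blast)+
    qed
    obtain t where t: "t \<noteq> 1" "t \<in> T" using coord_in_G(2)[OF x N l0 r2] by (auto simp: T_def)
    have m2: "2 \<le> m"
    proof -
      have "card {1, t} \<le> m" unfolding m_def using finT 1 t by (intro card_mono) auto
      then show ?thesis using t by simp
    qed
    \<comment> \<open>Otherwise all \<open>m\<close> elements of \<open>T\<close> would be roots of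
      unity of the positive order \<open>r mod m\<close>, which is smaller than
      \<open>m\<close>.\<close>
    have mr: "m dvd r"
    proof (rule ccontr)
      assume "\<not> m dvd r"
      then have k: "0 < r mod m" by (simp add: mod_greater_zero_iff_not_dvd)
      have "T \<subseteq> {z. z ^ (r mod m) = 1}"
      proof
        fix z assume z: "z \<in> T"
        have "z ^ r = (z ^ m) ^ (r div m) * z ^ (r mod m)" by (simp flip: power_mult power_add)
        then show "z \<in> {z. z ^ (r mod m) = 1}" using z Tr Tm by auto
      qed
      then have "m \<le> r mod m" unfolding m_def[symmetric]
        using card_mono[of "{z::complex. z ^ (r mod m) = 1}" T] k card_roots_unity_eq[of "r mod m"] finite_roots_unity[of "r mod m"]
        by (simp add: m_def)
      then show False using mod_less_divisor[OF Tm(2), of r] by linarith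
    qed
    have "G = mcl (swaps l e x r \<union> diags l e x m)"
    proof (rule sub)
      show "swaps l e x r \<union> diags l e x m \<subseteq> G"
      proof -
        have "dg e x i t \<in> G" if "i < l" "t ^ m = 1" for i t
        proof -
          have "t \<in> T" using that(2) Tm(1) by simp
          then show ?thesis using dgi[OF that(1)] by (simp add: T_def)
        qed
        then show ?thesis using sG by (auto simp: diags_def)
      qed
      show "{g \<in> G. reflection g} \<subseteq> swaps l e x r \<union> diags l e x m"
      proof
        fix g assume "g \<in> {g \<in> G. reflection g}"
        then have g: "g \<in> G" "reflection g" by auto
        from refl[OF this] show "g \<in> swaps l e x r \<union> diags l e x m"
        proof
          assume "\<exists>i<l. (r = 1 \<longrightarrow> g = sg l e x i) \<and> (2 \<le> r \<longrightarrow> (\<exists>t. t ^ r = 1 \<and> g = dg e x i t))"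
          then obtain i t where i: "i < l" "g = dg e x i t" using r2 by blast
          then have "t \<in> T" using g(1) dgi[of i t] by (simp add: T_def)
          then have "t ^ m = 1" using Tm(1) by simp
          then show ?thesis using i by (auto simp: diags_def)
        qed (auto simp: swaps_def)
      qed
    qed
    then show thesis using M x m2 mr r_pos by blast
  qed
qed

end

section \<open>Monomial groups and Coxeter groups\<close>

context refl_factor
begin

text \<open>The group G(r,p,l) in the basis \<open>e\<close>, with \<open>m\<close> standing for
  r/p, as transformations of the whole space.\<close>

definition mons :: "nat \<Rightarrow> (nat \<Rightarrow> 'v) \<Rightarrow> (nat \<Rightarrow> 'v \<Rightarrow> complex) \<Rightarrow> nat \<Rightarrow> nat \<Rightarrow> ('v \<Rightarrow> 'v) set" where
  "mons l e x r m = {mon l e x \<sigma> d | \<sigma> d. \<sigma> permutes {..<l} \<and> (\<forall>j<l. d j ^ r = 1) \<and> (\<Prod>j<l. d j) ^ m = 1}"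

lemma mon_comp:
  assumes x: "coords U C l e x" and \<tau>: "\<tau> permutes {..<l}"
  shows "mon l e x \<sigma> d \<circ> mon l e x \<tau> c = mon l e x (\<sigma> \<circ> \<tau>) (\<lambda>k. c k * d (\<tau> k))"
proof (rule lin_eqI[OF x])
  fix k assume k: "k < l"
  then have "\<tau> k < l" using permutes_in_image[OF \<tau>] by auto
  then show "(mon l e x \<sigma> d \<circ> mon l e x \<tau> c) (e k) = mon l e x (\<sigma> \<circ> \<tau>) (\<lambda>k. c k * d (\<tau> k)) (e k)"
    using k by (simp add: mon_e[OF x] lin_scale[OF lin_mon[OF x]])
qed (auto simp: lin_comp lin_mon[OF x] mon_C[OF x])

lemma mon_id: assumes x: "coords U C l e x" shows "mon l e x id (\<lambda>_. 1) = id"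
  by (rule lin_eqI[OF x]) (auto simp: lin_id lin_mon[OF x] mon_C[OF x] mon_e[OF x])

lemma mons_comp: assumes x: "coords U C l e x" and "g \<in> mons l e x r m" "h \<in> mons l e x r m"
  shows "g \<circ> h \<in> mons l e x r m"
proof -
  obtain \<sigma> d where s: "\<sigma> permutes {..<l}" "\<And>j. j < l \<Longrightarrow> d j ^ r = 1" "(\<Prod>j<l. d j) ^ m = 1" "g = mon l e x \<sigma> d"
    using assms(2) by (auto simp: mons_def)
  obtain \<tau> c where t: "\<tau> permutes {..<l}" "\<And>j. j < l \<Longrightarrow> c j ^ r = 1" "(\<Prod>j<l. c j) ^ m = 1" "h = mon l e x \<tau> c"
    using assms(3) by (auto simp: mons_def)
  have "(\<Prod>j<l. d (\<tau> j)) = (\<Prod>j<l. d j)" using prod.permute[OF t(1), of d] by (simp add: comp_def)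
  then have "(\<Prod>j<l. c j * d (\<tau> j)) ^ m = 1" using s(3) t(3) by (simp add: prod.distrib power_mult_distrib)
  moreover have "\<forall>j<l. (c j * d (\<tau> j)) ^ r = 1"
    using s(2) t(1,2) permutes_in_image[OF t(1)] by (auto simp: power_mult_distrib)
  moreover have "(\<sigma> \<circ> \<tau>) permutes {..<l}" using s(1) t(1) permutes_compose by blast
  ultimately show ?thesis unfolding s(4) t(4) mon_comp[OF x t(1)] mons_def by blast
qed

lemma sw_mon:
  assumes x: "coords U C l e x" and ij: "i < l" "j < l" "i \<noteq> j" "z \<noteq> 0"
  shows "sw e x i j z = mon l e x (transpose i j) (\<lambda>k. if k = i then 1 / z else if k = j then z else 1)"
  by (rule lin_eqI[OF x]) (use ij in \<open>auto simp: lin_sw[OF x] lin_mon[OF x] sw_C[OF x] mon_C[OF x] mon_e[OF x] sw_e[OF x] transpose_def\<close>)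

lemma dg_mon:
  assumes x: "coords U C l e x" and i: "i < l"
  shows "dg e x i t = mon l e x id (\<lambda>k. if k = i then t else 1)"
  by (rule lin_eqI[OF x]) (use i in \<open>auto simp: lin_dg[OF x] lin_mon[OF x] dg_C[OF x] mon_C[OF x] mon_e[OF x] dg_e[OF x]\<close>)

lemma prod_two:
  fixes i j l :: nat
  assumes "i < l" "j < l" "i \<noteq> j"
  shows "(\<Prod>k<l. if k = i then a else if k = j then b else (1::complex)) = a * b"
proof -
  have "(\<Prod>k<l. if k = i then a else if k = j then b else 1) = (\<Prod>k<l. (if k = i then a else 1) * (if k = j then b else 1))"
    using assms by (intro prod.cong) auto
  then show ?thesis using assms by (simp add: prod.distrib)
qed

text \<open>The swaps give all permutations and, in pairs, diagonal transformations with entries 1/d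
  and d. Diagonal coefficients can thus be collected at index 0, where their product, an m-th root
  of unity, is realized by a single \<open>dg\<close>.\<close>

lemma mcl_mons:
  assumes x: "coords U C l e x" and m: "m dvd r" "0 < r" and l: "0 < l"
  shows "mcl (swaps l e x r \<union> diags l e x m) = mons l e x r m"
proof (rule subset_antisym)
  have sw_in: "sw e x i j z \<in> mons l e x r m" if "i < l" "j < l" "i \<noteq> j" "z ^ r = 1" for i j z
  proof -
    have z: "z \<noteq> 0" using that m by (auto simp: power_0_left)
    have "transpose i j permutes {..<l}" using that by (simp add: permutes_swap_id)
    moreover have "(\<Prod>k<l. if k = i then 1 / z else if k = j then z else 1) = 1" using prod_two[of i l j "1 / z" z] that z by simp
    moreover have "\<forall>k<l. (if k = i then 1 / z else if k = j then z else 1) ^ r = 1" using that by (auto simp: power_divide)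
    ultimately show ?thesis unfolding sw_mon[OF x that(1-3) z] mons_def by fastforce
  qed
  have dg_in: "dg e x i t \<in> mons l e x r m" if "i < l" "t ^ m = 1" for i t
  proof -
    have "t ^ r = 1" using that m by (metis dvdE power_mult power_one)
    then have "\<forall>k<l. (if k = i then t else 1) ^ r = 1" by auto
    moreover have "(\<Prod>k<l. if k = i then t else 1) ^ m = 1" using that by simp
    moreover have "id permutes {..<l}" by (rule permutes_id)
    ultimately show ?thesis unfolding dg_mon[OF x that(1)] mons_def by blast
  qed
  show "mcl (swaps l e x r \<union> diags l e x m) \<subseteq> mons l e x r m"
  proof
    fix g assume "g \<in> mcl (swaps l e x r \<union> diags l e x m)"
    then show "g \<in> mons l e x r m"
    proof (induction rule: mcl.induct)
      case id
      have "mon l e x id (\<lambda>_. 1) \<in> mons l e x r m" unfolding mons_def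
        by (intro CollectI exI[of _ id] exI[of _ "\<lambda>_. 1"]) (auto simp: permutes_id)
      then show ?case unfolding mon_id[OF x] .
    next
      case (step s g)
      then have "s \<in> mons l e x r m" using sw_in dg_in by (auto simp: swaps_def diags_def)
      then show ?case using mons_comp[OF x] step by blast
    qed
  qed
  let ?M = "mcl (swaps l e x r \<union> diags l e x m)"
  have swM: "sw e x i j z \<in> ?M" if "i < l" "j < l" "i \<noteq> j" "z ^ r = 1" for i j z
    using that by (intro mcl_incl) (auto simp: swaps_def)
  have perm: "mon l e x \<sigma> (\<lambda>_. 1) \<in> ?M" if "\<sigma> permutes {..<l}" for \<sigma>
    using that finite_lessThan[of l]
  proof (induction rule: permutes_induct)
    case id show ?case unfolding mon_id[OF x] by (rule mcl.id)
  next
    case (swap a b p)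
    show ?case
    proof (cases "a = b")
      case False
      have "sw e x a b 1 \<circ> mon l e x p (\<lambda>_. 1) = mon l e x (transpose a b \<circ> p) (\<lambda>_. 1)"
        using swap False by (subst sw_mon[OF x]) (auto simp: mon_comp[OF x] intro!: arg_cong2[of _ _ _ _ "mon l e x"])
      moreover have "sw e x a b 1 \<in> ?M" using swM[of a b 1] swap.hyps False by simp
      ultimately show ?thesis using mcl_mult[OF _ swap.IH, of "sw e x a b 1"] by metis
    qed (use swap in simp)
  qed
  have diag: "mon l e x id d \<in> ?M" if "k \<le> l" "0 < k" "\<And>j. j < l \<Longrightarrow> d j ^ r = 1" "(\<Prod>j<l. d j) ^ m = 1"
    "\<And>j. k \<le> j \<Longrightarrow> d j = 1" for k d
    using that
  proof (induction k arbitrary: d)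
    case (Suc k)
    show ?case
    proof (cases "k = 0")
      case True
      have d: "d = (\<lambda>j. if j = 0 then d 0 else 1)" using Suc(6) True by (auto simp: Suc_le_eq)
      have "(\<Prod>j<l. d j) = (\<Prod>j<l. if j = 0 then d 0 else 1)" using d by metis
      also have "\<dots> = d 0" using l by simp
      finally have "(\<Prod>j<l. d j) = d 0" .
      then have "d 0 ^ m = 1" using Suc(5) by simp
      then have "dg e x 0 (d 0) \<in> ?M" using l by (intro mcl_incl) (auto simp: diags_def)
      then show ?thesis using dg_mon[OF x l, of "d 0"] d by metis
    next
      case False
      then have k: "k < l" "k \<noteq> 0" using Suc by auto
      have dk: "d k ^ r = 1" using Suc(4) k by blast
      then have dk0: "d k \<noteq> 0" using m by (auto simp: power_0_left)
      \<comment> \<open>The coefficient at \<open>k\<close> is multiplied onto the one at 0, which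
        leaves the product unchanged and frees the index \<open>k\<close>.\<close>
      define c where "c = d(k := 1, 0 := d 0 * d k)"
      have "mon l e x id c \<in> ?M"
      proof (rule Suc(1))
        show "k \<le> l" "0 < k" using k by auto
        show "c j ^ r = 1" if "j < l" for j using Suc(4)[OF that] Suc(4)[OF l] dk by (auto simp: c_def power_mult_distrib)
        show "c j = 1" if "k \<le> j" for j using that k Suc(6)[of j] by (cases "j = k") (auto simp: c_def)
        have "(\<Prod>j<l. c j) = (\<Prod>j<l. d j)"
        proof -
          have s: "{..<l} = insert 0 (insert k ({..<l} - {0, k}))" using k by auto
          have e: "(\<Prod>j\<in>{..<l} - {0, k}. c j) = (\<Prod>j\<in>{..<l} - {0, k}. d j)" by (rule prod.cong) (auto simp: c_def)
          show ?thesis by (subst (1 2) s) (use k e in \<open>auto simp: c_def\<close>)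
        qed
        then show "(\<Prod>j<l. c j) ^ m = 1" using Suc(5) by simp
      qed
      \<comment> \<open>The two swaps compose to the diagonal transformation with
        \<open>1 / d k\<close> at 0 and \<open>d k\<close> at \<open>k\<close>, which undoes the
        move.\<close>
      moreover have "sw e x 0 k (1 / d k) \<circ> (sw e x 0 k 1 \<circ> mon l e x id c) = mon l e x id d"
      proof (rule lin_eqI[OF x])
        fix j assume j: "j < l"
        show "(sw e x 0 k (1 / d k) \<circ> (sw e x 0 k 1 \<circ> mon l e x id c)) (e j) = mon l e x id d (e j)"
          using j k l dk0
          by (auto simp: mon_e[OF x] sw_e[OF x] lin_scale[OF lin_sw[OF x]] c_def)
      qed (use k l in \<open>auto simp: lin_comp lin_mon[OF x] lin_sw[OF x] mon_C[OF x] sw_C[OF x]\<close>)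
      ultimately show ?thesis
        using mcl_mult[OF swM[of 0 k "1 / d k"] mcl_mult[OF swM[of 0 k 1]]] k l dk
        by (metis div_by_1 power_one power_one_over)
    qed
  qed simp
  show "mons l e x r m \<subseteq> ?M"
  proof
    fix g assume "g \<in> mons l e x r m"
    then obtain \<sigma> d where s: "\<sigma> permutes {..<l}" "\<And>j. j < l \<Longrightarrow> d j ^ r = 1" "(\<Prod>j<l. d j) ^ m = 1" "g = mon l e x \<sigma> d"
      by (auto simp: mons_def)
    define c where "c j = (if j < l then d j else 1)" for j
    have "mon l e x id c \<in> ?M"
      by (rule diag[of l]) (use s l in \<open>auto simp: c_def\<close>)
    moreover have "mon l e x \<sigma> (\<lambda>_. 1) \<circ> mon l e x id c = g"
      unfolding s(4) by (rule lin_eqI[OF x])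
        (auto simp: lin_comp lin_mon[OF x] mon_C[OF x] mon_e[OF x] lin_scale[OF lin_mon[OF x]] c_def)
    ultimately show "g \<in> ?M" using mcl_mult[OF perm[OF s(1)]] by metis
  qed
qed

text \<open>Adjacent transpositions of the l + 1 vectors e_0, ..., e_(l-1) and their negative sum;
  the last generator involves the additional vector.\<close>

definition simple_A :: "nat \<Rightarrow> (nat \<Rightarrow> 'v) \<Rightarrow> (nat \<Rightarrow> 'v \<Rightarrow> complex) \<Rightarrow> nat \<Rightarrow> 'v \<Rightarrow> 'v" where
  "simple_A l e x k = (if Suc k < l then sw e x k (Suc k) 1 else sg l e x k)"

definition simple_B :: "nat \<Rightarrow> (nat \<Rightarrow> 'v) \<Rightarrow> (nat \<Rightarrow> 'v \<Rightarrow> complex) \<Rightarrow> nat \<Rightarrow> 'v \<Rightarrow> 'v" where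
  "simple_B l e x k = (if Suc k < l then sw e x k (Suc k) 1 else dg e x k (- 1))"

lemma sw_sym: "z \<noteq> 0 \<Longrightarrow> sw e x i j z = sw e x j i (1 / z)"
  by (rule ext) (simp add: sw_def scale_right_diff_distrib algebra_simps diff_divide_distrib)

lemma swaps_1_generated:
  assumes x: "coords U C l e x" and S: "\<And>k. Suc k < l \<Longrightarrow> sw e x k (Suc k) 1 \<in> S" and ij: "i < l" "j < l" "i \<noteq> j"
  shows "sw e x i j 1 \<in> mcl S"
proof -
  have up: "sw e x i (i + Suc n) 1 \<in> mcl S" if "i + Suc n < l" for i n
    using that
  proof (induction n)
    case 0 then show ?case using S[of i] mcl_incl by auto
  next
    case (Suc n)
    let ?j = "i + Suc n"
    have j: "?j < l" "Suc ?j < l" "i < l" using Suc by auto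
    \<comment> \<open>The transposition of \<open>i\<close> and \<open>?j\<close>, conjugated by the
      adjacent one at \<open>?j\<close>, exchanges \<open>i\<close> with the successor of
      \<open>?j\<close>.\<close>
    have "sw e x ?j (Suc ?j) 1 \<circ> (sw e x i ?j 1 \<circ> sw e x ?j (Suc ?j) 1) = sw e x i (Suc ?j) 1"
      by (rule lin_eqI[OF x])
        (use j in \<open>auto simp: lin_comp lin_sw[OF x] sw_C[OF x] sw_e[OF x]\<close>)
    moreover have "sw e x ?j (Suc ?j) 1 \<in> mcl S" using S j mcl_incl by blast
    ultimately show ?case using Suc mcl_mult by (metis add_Suc_right Suc_lessD)
  qed
  show ?thesis
  proof (cases "i < j")
    case True
    then obtain n where "j = i + Suc n" using less_imp_Suc_add by fastforce
    then show ?thesis using up[of i n] ij by simp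
  next
    case False
    then obtain n where "i = j + Suc n" using less_imp_Suc_add[of j i] ij by fastforce
    then show ?thesis using up[of j n] ij sw_sym[of 1 e x i j] by simp
  qed
qed

text \<open>A swap fixes the sum of all e_k, and therefore carries the reflection at
  \<open>j\<close> to the one at \<open>i\<close>.\<close>

lemma conj_sg:
  assumes x: "coords U C l e x" and "i < l" "j < l" "i \<noteq> j"
  shows "sw e x i j 1 \<circ> (sg l e x j \<circ> sw e x i j 1) = sg l e x i"
proof -
  have "(\<Sum>k<l. sw e x i j 1 (e k)) = (\<Sum>k<l. e (transpose i j k))"
    using assms by (intro sum.cong) (auto simp: sw_e[OF x] transpose_def)
  also have "\<dots> = (\<Sum>k<l. e k)"
    using sum.permute[of "transpose i j" "{..<l}" e] assms by (simp add: permutes_swap_id comp_def)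
  finally have s: "sw e x i j 1 (\<Sum>k<l. e k) = (\<Sum>k<l. e k)"
    unfolding lin_sum[OF lin_sw[OF x assms(2,3)]] .
  show ?thesis
    using assms by (intro lin_eqI[OF x] lin_comp lin_sw[OF x] lin_sg[OF x])
      (auto simp: sw_C[OF x] sg_C[OF x] sw_e[OF x] sg_e[OF x] lin_neg[OF lin_sw[OF x]] s)
qed

lemma mcl_simple_A:
  assumes x: "coords U C l e x" and l: "0 < l"
  shows "mcl (swaps l e x 1 \<union> sg l e x ` {..<l}) = mcl (simple_A l e x ` {..<l})" (is "mcl ?S = mcl ?T")
proof (rule subset_antisym)
  have sw_in: "sw e x i j 1 \<in> mcl ?T" if "i < l" "j < l" "i \<noteq> j" for i j
    using that by (intro swaps_1_generated[OF x]) (force simp: simple_A_def)+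
  have last: "sg l e x (l - 1) \<in> mcl ?T" using l by (intro mcl_incl image_eqI[of _ _ "l - 1"]) (auto simp: simple_A_def)
  have "sg l e x i \<in> mcl ?T" if i: "i < l" for i
  proof (cases "i = l - 1")
    case False
    then have ij: "i < l" "l - 1 < l" "i \<noteq> l - 1" using i by auto
    show ?thesis using conj_sg[OF x ij] mcl_mult[OF sw_in[OF ij] mcl_mult[OF last sw_in[OF ij]]] by simp
  qed (use last in simp)
  then have "?S \<subseteq> mcl ?T" using sw_in by (auto simp: swaps_def)
  then show "mcl ?S \<subseteq> mcl ?T" by (rule mcl_least)
  have "simple_A l e x k \<in> ?S" if "k < l" for k
    using that by (auto simp: simple_A_def swaps_def) (metis Suc_lessD n_not_Suc_n)
  then have "?T \<subseteq> mcl ?S" using mcl_incl by blast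
  then show "mcl ?T \<subseteq> mcl ?S" by (rule mcl_least)
qed

lemma mcl_simple_B:
  assumes x: "coords U C l e x" and l: "0 < l"
  shows "mcl (swaps l e x 2 \<union> diags l e x 2) = mcl (simple_B l e x ` {..<l})" (is "mcl ?S = mcl ?T")
proof (rule subset_antisym)
  have sw_in: "sw e x i j 1 \<in> mcl ?T" if "i < l" "j < l" "i \<noteq> j" for i j
    using that by (intro swaps_1_generated[OF x]) (force simp: simple_B_def)+
  have last: "dg e x (l - 1) (- 1) \<in> mcl ?T" using l by (intro mcl_incl image_eqI[of _ _ "l - 1"]) (auto simp: simple_B_def)
  have dg_in: "dg e x i (- 1) \<in> mcl ?T" if i: "i < l" for i
  proof (cases "i = l - 1")
    case False
    then have ij: "i < l" "l - 1 < l" "i \<noteq> l - 1" using i by auto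
    show ?thesis using conj_dg[OF x ij] mcl_mult[OF sw_in[OF ij] mcl_mult[OF last sw_in[OF ij]]] by simp
  qed (use last in simp)
  have pm: "z = 1 \<or> z = - 1" if "z ^ 2 = 1" for z :: complex using that by (simp add: power2_eq_1_iff)
  \<comment> \<open>The swap with ratio -1 is the ordinary swap conjugated by a sign change.\<close>
  have neg: "sw e x i j (- 1) \<in> mcl ?T" if ij: "i < l" "j < l" "i \<noteq> j" for i j
  proof -
    have "dg e x i (- 1) \<circ> (sw e x i j 1 \<circ> dg e x i (- 1)) = sw e x i j (- 1)"
      using ij by (intro lin_eqI[OF x] lin_comp lin_sw[OF x] lin_dg[OF x])
        (auto simp: sw_C[OF x] dg_C[OF x] sw_e[OF x] dg_e[OF x] lin_neg[OF lin_sw[OF x]] lin_neg[OF lin_dg[OF x]])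
    then show ?thesis using mcl_mult[OF dg_in[OF ij(1)] mcl_mult[OF sw_in[OF ij] dg_in[OF ij(1)]]] by simp
  qed
  have one: "dg e x i 1 \<in> mcl ?T" for i
  proof -
    have "dg e x i 1 = id" by (auto simp: dg_def)
    then show ?thesis using mcl.id by metis
  qed
  have "?S \<subseteq> mcl ?T" using sw_in neg dg_in one pm by (auto simp: swaps_def diags_def) (metis, metis)
  then show "mcl ?S \<subseteq> mcl ?T" by (rule mcl_least)
  have "simple_B l e x k \<in> ?S" if "k < l" for k
  proof (cases "Suc k < l")
    case True
    then have "sw e x k (Suc k) 1 \<in> swaps l e x 2" unfolding swaps_def
      by (intro CollectI exI[of _ k] exI[of _ "Suc k"] exI[of _ 1]) auto
    then show ?thesis using True by (simp add: simple_B_def)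
  next
    case False
    then show ?thesis using that unfolding simple_B_def diags_def
      by (auto intro!: exI[of _ k] exI[of _ "-1"])
  qed
  then have "?T \<subseteq> mcl ?S" using mcl_incl by blast
  then show "mcl ?T \<subseteq> mcl ?S" by (rule mcl_least)
qed

end

section \<open>Transformations given by matrices\<close>

context cspace
begin

text \<open>Multiplication by \<open>M\<close> in the basis \<open>e\<close>, the columns being the
  images of the basis vectors, and again trivial on \<open>C\<close>.\<close>

definition op :: "nat \<Rightarrow> (nat \<Rightarrow> 'v) \<Rightarrow> (nat \<Rightarrow> 'v \<Rightarrow> complex) \<Rightarrow> complex mat \<Rightarrow> 'v \<Rightarrow> 'v" where
  "op l e x M u = u + (\<Sum>j<l. x j u *s ((\<Sum>i<l. M $$ (i, j) *s e i) - e j))"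

lemma lin_op: "coords U C l e x \<Longrightarrow> lin (op l e x M)"
  unfolding op_def[abs_def] by (rule lin_sum_forms) (simp add: coords_lform)

lemma op_e:
  assumes x: "coords U C l e x" and k: "k < l"
  shows "op l e x M (e k) = (\<Sum>i<l. M $$ (i, k) *s e i)"
proof -
  have "(\<Sum>j<l. x j (e k) *s ((\<Sum>i<l. M $$ (i, j) *s e i) - e j)) =
      (\<Sum>j<l. (if j = k then 1 else 0) *s ((\<Sum>i<l. M $$ (i, j) *s e i) - e j))"
    using coords_dual[OF x _ k] by (intro sum.cong) auto
  then show ?thesis unfolding op_def sum_delta_scale using k by simp
qed

lemma op_C: "coords U C l e x \<Longrightarrow> c \<in> C \<Longrightarrow> op l e x M c = c"
  by (simp add: op_def coords_def)

lemma coord_sum: 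
  assumes x: "coords U C l e x" and i: "i < l"
  shows "x i (\<Sum>k<l. a k *s e k) = a i"
  using i by (simp add: lform_simps[OF coords_lform[OF x i]] coords_dual[OF x i] if_distrib[of "\<lambda>z. _ * z"] cong: if_cong)

lemma op_entry: "coords U C l e x \<Longrightarrow> i < l \<Longrightarrow> k < l \<Longrightarrow> x i (op l e x M (e k)) = M $$ (i, k)"
  using op_e[of U C l e x k M] coord_sum[of U C l e x i "\<lambda>i. M $$ (i, k)"] by simp

end

context refl_factor
begin

lemma e_in_U: "coords U C l e x \<Longrightarrow> i < l \<Longrightarrow> e i \<in> U"
  by (simp add: coords_def)

lemma sum_in_U: "coords U C l e x \<Longrightarrow> (\<Sum>k<l. a k *s e k) \<in> U"
  using e_in_U subU by (auto intro!: subspace_sum subspace_scale)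

lemma op_eqI:
  assumes x: "coords U C l e x" and g: "lin g" "\<And>c. c \<in> C \<Longrightarrow> g c = c" "\<And>u. u \<in> U \<Longrightarrow> g u \<in> U"
    and M: "\<And>i k. i < l \<Longrightarrow> k < l \<Longrightarrow> x i (g (e k)) = M $$ (i, k)"
  shows "g = op l e x M"
proof (rule lin_eqI[OF x g(1) lin_op[OF x]])
  fix k assume k: "k < l"
  show "g (e k) = op l e x M (e k)" unfolding op_e[OF x k]
    by (rule U_eqI[OF x g(3)[OF e_in_U[OF x k]] sum_in_U[OF x]]) (simp add: M k coord_sum[OF x])
qed (simp add: g(2) op_C[OF x])

lemma op_mult:
  assumes x: "coords U C l e x" and "M \<in> carrier_mat l l" "N \<in> carrier_mat l l"
  shows "op l e x (M * N) = op l e x M \<circ> op l e x N"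
proof (rule op_eqI[OF x, symmetric])
  show "lin (op l e x M \<circ> op l e x N)" using lin_comp lin_op[OF x] by blast
  show "(op l e x M \<circ> op l e x N) c = c" if "c \<in> C" for c using that by (simp add: op_C[OF x])
  have opU: "op l e x K u \<in> U" if "u \<in> U" for K u
    unfolding op_def using that subU e_in_U[OF x] by (intro subspace_add subspace_sum subspace_scale subspace_diff) auto
  show "(op l e x M \<circ> op l e x N) u \<in> U" if "u \<in> U" for u using that opU by simp
  fix i k assume ik: "i < l" "k < l"
  have "x i ((op l e x M \<circ> op l e x N) (e k)) = x i (\<Sum>j<l. N $$ (j, k) *s op l e x M (e j))"
    using ik by (simp add: op_e[OF x ik(2), of N] lin_simps[OF lin_op[OF x]])
  also have "\<dots> = (\<Sum>j<l. N $$ (j, k) * M $$ (i, j))"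
    using ik by (simp add: lform_simps[OF coords_lform[OF x]] op_entry[OF x])
  also have "\<dots> = (M * N) $$ (i, k)"
    using assms ik by (auto simp: scalar_prod_def mult.commute atLeast0LessThan intro!: sum.cong)
  finally show "x i ((op l e x M \<circ> op l e x N) (e k)) = (M * N) $$ (i, k)" .
qed

lemma op_one: assumes x: "coords U C l e x" shows "op l e x (1\<^sub>m l) = id"
  by (rule op_eqI[OF x, symmetric]) (auto simp: lin_id coords_dual[OF x])

lemma op_inj:
  assumes x: "coords U C l e x" and "M \<in> carrier_mat l l" "N \<in> carrier_mat l l" "op l e x M = op l e x N"
  shows "M = N"
  using assms(2-4) by (intro eq_matI) (auto simp flip: op_entry[OF x])

lemma isomorphicI:
  assumes x: "coords U C l e x" and MM: "MM \<subseteq> carrier_mat l l" and G: "G = op l e x ` MM"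
  shows "isomorphic_reflection_group scale U ((\<lambda>g. restrict g U) ` G) l MM"
proof -
  define \<phi> where "\<phi> u = vec l (\<lambda>i. x i u)" for u
  define \<psi> where "\<psi> v = (\<Sum>i<l. v $ i *s e i)" for v
  have \<psi>U: "\<psi> v \<in> U" for v unfolding \<psi>_def by (rule sum_in_U[OF x])
  have \<phi>\<psi>: "\<phi> (\<psi> v) = v" if "v \<in> carrier_vec l" for v
    using that by (auto simp: \<phi>_def \<psi>_def coord_sum[OF x])
  have \<psi>\<phi>: "\<psi> (\<phi> u) = u" if "u \<in> U" for u
    by (rule U_eqI[OF x \<psi>U that]) (simp add: \<phi>_def \<psi>_def coord_sum[OF x])
  have bij: "bij_betw \<phi> U (carrier_vec l)"
    by (rule bij_betw_byWitness[of _ \<psi>]) (use \<phi>\<psi> \<psi>\<phi> \<psi>U in \<open>auto simp: \<phi>_def\<close>)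
  have inv: "inv_into U \<phi> v = \<psi> v" if "v \<in> carrier_vec l" for v
    using inv_into_f_eq[of \<phi> U "\<psi> v" v] bij \<psi>U \<phi>\<psi>[OF that] by (auto simp: bij_betw_def)
  have act: "\<phi> (op l e x M (\<psi> v)) = M *\<^sub>v v" if "M \<in> MM" "v \<in> carrier_vec l" for M v
  proof (rule eq_vecI)
    show "dim_vec (\<phi> (op l e x M (\<psi> v))) = dim_vec (M *\<^sub>v v)" using that MM by (auto simp: \<phi>_def)
    fix i assume "i < dim_vec (M *\<^sub>v v)"
    then have i: "i < l" using that MM by auto
    have "x i (op l e x M (\<psi> v)) = (\<Sum>k<l. v $ k * M $$ (i, k))"
      using i by (simp add: \<psi>_def lin_simps[OF lin_op[OF x]] lform_simps[OF coords_lform[OF x]] op_entry[OF x])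
    moreover have "(M *\<^sub>v v) $ i = (\<Sum>k<l. M $$ (i, k) * v $ k)"
      using that MM i by (auto simp: scalar_prod_def atLeast0LessThan intro!: sum.cong)
    ultimately show "\<phi> (op l e x M (\<psi> v)) $ i = (M *\<^sub>v v) $ i" using i by (simp add: \<phi>_def mult.commute)
  qed
  have im: "(\<lambda>g. \<lambda>v\<in>carrier_vec l. \<phi> (g (inv_into U \<phi> v))) ` (\<lambda>g. restrict g U) ` G =
        (\<lambda>M. \<lambda>v\<in>carrier_vec l. M *\<^sub>v v) ` MM"
    unfolding G image_image using inv act \<psi>U by (intro image_cong refl restrict_ext) auto
  have lin1: "\<forall>u\<in>U. \<forall>w\<in>U. \<phi> (u + w) = \<phi> u + \<phi> w"
    by (auto simp: \<phi>_def lform_simps[OF coords_lform[OF x]])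
  have lin2: "\<forall>c. \<forall>u\<in>U. \<phi> (c *s u) = c \<cdot>\<^sub>v \<phi> u"
    by (auto simp: \<phi>_def lform_simps[OF coords_lform[OF x]])
  show ?thesis unfolding isomorphic_reflection_group_def
    by (rule exI[of _ \<phi>]) (use bij lin1 lin2 im in blast)
qed

text \<open>The unit vectors are pulled back to a basis of \<open>U\<close>. The inclusion
  \<open>carr\<close> may depend on coordinates because for Coxeter groups it is obtained through
  \<open>coxeter_group_op\<close>.\<close>

lemma isomorphicD:
  assumes iso: "isomorphic_reflection_group scale U ((\<lambda>g. restrict g U) ` G) l MM"
    and carr: "\<And>e x. coords U C l e x \<Longrightarrow> MM \<subseteq> carrier_mat l l"
  obtains e x where "coords U C l e x" "G = op l e x ` MM"
proof -
  obtain \<phi> where \<phi>: "bij_betw \<phi> U (carrier_vec l) \<and>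
        (\<forall>x\<in>U. \<forall>y\<in>U. \<phi> (x + y) = \<phi> x + \<phi> y) \<and>
        (\<forall>c. \<forall>x\<in>U. \<phi> (scale c x) = c \<cdot>\<^sub>v \<phi> x) \<and>
        (\<lambda>g. \<lambda>v\<in>carrier_vec l. \<phi> (g (inv_into U \<phi> v))) ` (\<lambda>g. restrict g U) ` G =
        (\<lambda>M. \<lambda>v\<in>carrier_vec l. M *\<^sub>v v) ` MM"
    using iso unfolding isomorphic_reflection_group_def by (elim exE)
  have bij: "bij_betw \<phi> U (carrier_vec l)"
    and add: "\<And>u w. u \<in> U \<Longrightarrow> w \<in> U \<Longrightarrow> \<phi> (u + w) = \<phi> u + \<phi> w"
    and scl: "\<And>c u. u \<in> U \<Longrightarrow> \<phi> (c *s u) = c \<cdot>\<^sub>v \<phi> u"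
    and im: "(\<lambda>g. \<lambda>v\<in>carrier_vec l. \<phi> (g (inv_into U \<phi> v))) ` (\<lambda>g. restrict g U) ` G =
        (\<lambda>M. \<lambda>v\<in>carrier_vec l. M *\<^sub>v v) ` MM"
    using \<phi> by simp_all
  obtain p where p: "lin p" "\<And>v. p v \<in> U" "\<And>u. u \<in> U \<Longrightarrow> p u = u" "\<And>c. c \<in> C \<Longrightarrow> p c = 0"
    using projection by blast
  have car: "\<phi> u \<in> carrier_vec l" if "u \<in> U" for u using bij_betw_apply[OF bij that] .
  have inj: "u = w" if "u \<in> U" "w \<in> U" "\<phi> u = \<phi> w" for u w
    using inj_onD[OF bij_betw_imp_inj_on[OF bij]] that by blast
  define e where "e i = inv_into U \<phi> (unit_vec l i)" for i
  define x where "x i v = \<phi> (p v) $ i" for i v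
  have invU: "inv_into U \<phi> v \<in> U" "\<phi> (inv_into U \<phi> v) = v" if "v \<in> carrier_vec l" for v
    using that bij_betw_imp_surj_on[OF bij] inv_into_into[of v \<phi> U] f_inv_into_f[of v \<phi> U] by auto
  have eU: "e i \<in> U" "\<phi> (e i) = unit_vec l i" for i unfolding e_def using invU[of "unit_vec l i"] by auto
  have 1: "lform (x i)" if "i < l" for i
  proof -
    have d: "dim_vec (\<phi> (p u)) = l" for u using car[OF p(2)[of u]] by auto
    then show ?thesis
      unfolding lform_def x_def using that p(2) by (auto simp: lin_simps[OF p(1)] add scl)
  qed
  have 2: "x i (e j) = (if i = j then 1 else 0)" if "i < l" "j < l" for i j
    unfolding x_def using that eU p(3) by (auto simp: unit_vec_def)
  have "0 \<cdot>\<^sub>v \<phi> 0 = 0\<^sub>v l" using car[OF subspace_0[OF subU]] by (intro eq_vecI) auto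
  then have phi0: "\<phi> 0 = 0\<^sub>v l" using scl[OF subspace_0[OF subU], of 0] by simp
  have 3: "x i c = 0" if "i < l" "c \<in> C" for i c
    unfolding x_def using that p(4) phi0 by simp
  have 4: "u = (\<Sum>i<l. x i u *s e i)" if u: "u \<in> U" for u
  proof (rule inj[OF u])
    show s: "(\<Sum>i<l. x i u *s e i) \<in> U" using eU subU by (auto intro!: subspace_sum subspace_scale)
    show "\<phi> u = \<phi> (\<Sum>i<l. x i u *s e i)"
    proof (rule eq_vecI)
      show "dim_vec (\<phi> u) = dim_vec (\<phi> (\<Sum>i<l. x i u *s e i))" using car[OF u] car[OF s] by auto
      fix k assume "k < dim_vec (\<phi> (\<Sum>i<l. x i u *s e i))"
      then have k: "k < l" using car[OF s] by auto
      have "\<phi> (\<Sum>i<l. x i u *s e i) $ k = x k (\<Sum>i<l. x i u *s e i)" unfolding x_def using p(3)[OF s] by (simp add: x_def)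
      also have "\<dots> = x k u"
        using k 2 by (simp add: lform_simps[OF 1] if_distrib[of "\<lambda>z. _ * z"] cong: if_cong)
      finally show "\<phi> u $ k = \<phi> (\<Sum>i<l. x i u *s e i) $ k" using p(3)[OF u] by (simp add: x_def)
    qed
  qed
  have x: "coords U C l e x" unfolding coords_def using 1 2 3 4 eU by blast
  then have MM: "MM \<subseteq> carrier_mat l l" by (rule carr)
  have key: "g = op l e x M"
    if g: "g \<in> G" and M: "M \<in> MM" and eq: "(\<lambda>v\<in>carrier_vec l. \<phi> (restrict g U (inv_into U \<phi> v))) = (\<lambda>v\<in>carrier_vec l. M *\<^sub>v v)" for g M
  proof (rule op_eqI[OF x G_lin[OF g] G_C[OF g] G_U[OF g]])
    fix i k assume ik: "i < l" "k < l"
    have "\<phi> (restrict g U (inv_into U \<phi> (unit_vec l k))) = M *\<^sub>v unit_vec l k"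
      using fun_cong[OF eq, of "unit_vec l k"] by simp
    then have "\<phi> (g (e k)) = M *\<^sub>v unit_vec l k" using eU(1)[of k] by (simp add: e_def)
    moreover have "(M *\<^sub>v unit_vec l k) $ i = M $$ (i, k)" using M MM ik by auto
    ultimately show "x i (g (e k)) = M $$ (i, k)" unfolding x_def using p(3)[OF G_U[OF g eU(1)]] by simp
  qed
  have "G = op l e x ` MM"
  proof (intro subset_antisym subsetI)
    fix g assume g: "g \<in> G"
    then have "(\<lambda>v\<in>carrier_vec l. \<phi> (restrict g U (inv_into U \<phi> v))) \<in> (\<lambda>M. \<lambda>v\<in>carrier_vec l. M *\<^sub>v v) ` MM"
      unfolding im[symmetric] by blast
    then show "g \<in> op l e x ` MM" using key[OF g] by blast
  next
    fix h assume "h \<in> op l e x ` MM"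
    then obtain M where M: "M \<in> MM" "h = op l e x M" by blast
    then have "(\<lambda>v\<in>carrier_vec l. M *\<^sub>v v) \<in> (\<lambda>g. \<lambda>v\<in>carrier_vec l. \<phi> (g (inv_into U \<phi> v))) ` (\<lambda>g. restrict g U) ` G"
      unfolding im by blast
    then obtain g where "g \<in> G" "(\<lambda>v\<in>carrier_vec l. \<phi> (restrict g U (inv_into U \<phi> v))) = (\<lambda>v\<in>carrier_vec l. M *\<^sub>v v)" by auto
    then show "h \<in> G" using key M by metis
  qed
  then show thesis using that x by blast
qed

text \<open>A monomial matrix amounts to the permutation recording the row of the nonzero entry in
  each column, together with these entries; the product over nonzero positions becomes the product
  of the \<open>d j\<close>.\<close>

lemma op_monomial_group:
  assumes x: "coords U C l e x"
    and r: "0 < r"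
  shows "op l e x ` monomial_group r p l = mons l e x r (r div p)"
proof -
  define mm where "mm \<sigma> d = mat l l (\<lambda>(i, j). if i = \<sigma> j then d j else 0)" for \<sigma> :: "nat \<Rightarrow> nat" and d :: "nat \<Rightarrow> complex"
  have opmm: "op l e x (mm \<sigma> d) = mon l e x \<sigma> d" if s: "\<sigma> permutes {..<l}" for \<sigma> d
  proof (rule lin_eqI[OF x lin_op[OF x] lin_mon[OF x]])
    fix k assume k: "k < l"
    have "\<sigma> k < l" using permutes_in_image[OF s] k by auto
    have "(\<Sum>i<l. mm \<sigma> d $$ (i, k) *s e i) = (\<Sum>i<l. (if i = \<sigma> k then 1 else 0) *s (d k *s e i))"
      using k by (intro sum.cong) (auto simp: mm_def)
    then show "op l e x (mm \<sigma> d) (e k) = mon l e x \<sigma> d (e k)"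
      unfolding op_e[OF x k] mon_e[OF x k] sum_delta_scale using \<open>\<sigma> k < l\<close> by simp
  qed (simp add: op_C[OF x] mon_C[OF x])
  have prodmm: "(\<Prod>ij \<in> {(i, j). i < l \<and> j < l \<and> mm \<sigma> d $$ (i, j) \<noteq> 0}. mm \<sigma> d $$ ij) = (\<Prod>j<l. d j)"
    if s: "\<sigma> permutes {..<l}" and d: "\<And>j. j < l \<Longrightarrow> d j \<noteq> 0" for \<sigma> d
  proof -
    have sl: "\<sigma> j < l" if "j < l" for j using permutes_in_image[OF s] that by auto
    have "{(i, j). i < l \<and> j < l \<and> mm \<sigma> d $$ (i, j) \<noteq> 0} = (\<lambda>j. (\<sigma> j, j)) ` {..<l}"
      using sl d by (auto simp: mm_def split: if_splits)
    then have "(\<Prod>ij \<in> {(i, j). i < l \<and> j < l \<and> mm \<sigma> d $$ (i, j) \<noteq> 0}. mm \<sigma> d $$ ij) = (\<Prod>j<l. mm \<sigma> d $$ (\<sigma> j, j))"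
      by (simp add: prod.reindex inj_on_def)
    also have "\<dots> = (\<Prod>j<l. d j)" using sl by (intro prod.cong) (auto simp: mm_def)
    finally show ?thesis .
  qed
  have 1: "mm \<sigma> d \<in> monomial_group r p l"
    if s: "\<sigma> permutes {..<l}" and d: "\<And>j. j < l \<Longrightarrow> d j ^ r = 1" "(\<Prod>j<l. d j) ^ (r div p) = 1" and nz: "\<And>j. j < l \<Longrightarrow> d j \<noteq> 0" for \<sigma> d
  proof -
    have sl: "\<sigma> j < l" if "j < l" for j using permutes_in_image[OF s] that by auto
    have mmn: "mm \<sigma> d $$ (i, j) \<noteq> 0 \<longleftrightarrow> i = \<sigma> j" if "i < l" "j < l" for i j using that nz by (auto simp: mm_def)
    have a: "\<exists>!j. j < l \<and> mm \<sigma> d $$ (i, j) \<noteq> 0" if i: "i < l" for i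
    proof -
      obtain j where j: "j < l" "\<sigma> j = i" using permutes_image[OF s] i by (metis imageE lessThan_iff)
      show ?thesis
        by (rule ex1I[of _ j]) (use i j mmn permutes_inj[OF s] in \<open>auto dest: injD\<close>)
    qed
    have b: "\<exists>!i. i < l \<and> mm \<sigma> d $$ (i, j) \<noteq> 0" if j: "j < l" for j
      by (rule ex1I[of _ "\<sigma> j"]) (use j mmn sl in auto)
    have c: "mm \<sigma> d $$ (i, j) ^ r = 1" if "i < l" "j < l" "mm \<sigma> d $$ (i, j) \<noteq> 0" for i j
      using that d(1) by (auto simp: mm_def split: if_splits)
    show ?thesis unfolding monomial_group_def
      using a b c prodmm[OF s nz] d(2) by (simp add: mm_def)
  qed
  have 2: "\<exists>\<sigma> d. \<sigma> permutes {..<l} \<and> (\<forall>j<l. d j ^ r = 1) \<and> (\<Prod>j<l. d j) ^ (r div p) = 1 \<and> M = mm \<sigma> d"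
    if M: "M \<in> monomial_group r p l" for M
  proof -
    have Mc: "M \<in> carrier_mat l l" and row: "\<And>i. i < l \<Longrightarrow> \<exists>!j. j < l \<and> M $$ (i, j) \<noteq> 0"
      and col: "\<And>j. j < l \<Longrightarrow> \<exists>!i. i < l \<and> M $$ (i, j) \<noteq> 0"
      and rt: "\<And>i j. i < l \<Longrightarrow> j < l \<Longrightarrow> M $$ (i, j) \<noteq> 0 \<Longrightarrow> M $$ (i, j) ^ r = 1"
      and pr: "(\<Prod>ij \<in> {(i, j). i < l \<and> j < l \<and> M $$ (i, j) \<noteq> 0}. M $$ ij) ^ (r div p) = 1"
      using M unfolding monomial_group_def by auto
    have "\<forall>j. \<exists>i. j < l \<longrightarrow> i < l \<and> M $$ (i, j) \<noteq> 0" using col by blast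
    then obtain s where s: "\<And>j. j < l \<Longrightarrow> s j < l \<and> M $$ (s j, j) \<noteq> 0" by metis
    \<comment> \<open>Outside the index range the map is the identity, as \<open>permutes\<close>
      demands.\<close>
    define \<sigma> where "\<sigma> j = (if j < l then s j else j)" for j
    define d where "d j = M $$ (s j, j)" for j
    have "inj_on \<sigma> {..<l}"
    proof (rule inj_onI)
      fix a b assume "a \<in> {..<l}" "b \<in> {..<l}" "\<sigma> a = \<sigma> b"
      then show "a = b" using s[of a] s[of b] row[of "s a"] by (auto simp: \<sigma>_def)
    qed
    moreover have "\<sigma> ` {..<l} \<subseteq> {..<l}" using s by (auto simp: \<sigma>_def)
    ultimately have "bij_betw \<sigma> {..<l} {..<l}" by (simp add: bij_betw_def endo_inj_surj)
    then have perm: "\<sigma> permutes {..<l}" by (intro bij_imp_permutes) (auto simp: \<sigma>_def)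
    have Mmm: "M = mm \<sigma> d"
    proof (rule eq_matI)
      show "dim_row M = dim_row (mm \<sigma> d)" "dim_col M = dim_col (mm \<sigma> d)" using Mc by (auto simp: mm_def)
      fix i j assume "i < dim_row (mm \<sigma> d)" "j < dim_col (mm \<sigma> d)"
      then have ij: "i < l" "j < l" by (auto simp: mm_def)
      show "M $$ (i, j) = mm \<sigma> d $$ (i, j)"
        using ij s[OF ij(2)] col[OF ij(2)] by (auto simp: mm_def \<sigma>_def d_def)
    qed
    have "\<forall>j<l. d j ^ r = 1" using s rt by (auto simp: d_def)
    moreover have "(\<Prod>j<l. d j) ^ (r div p) = 1"
      using pr prodmm[OF perm, of d] s unfolding Mmm by (simp add: Mmm[symmetric] d_def)
    ultimately show ?thesis using perm Mmm by blast
  qed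
  show ?thesis
  proof (intro subset_antisym subsetI)
    fix g assume "g \<in> op l e x ` monomial_group r p l"
    then obtain M where "M \<in> monomial_group r p l" "g = op l e x M" by blast
    then obtain \<sigma> d where s: "\<sigma> permutes {..<l}" "\<forall>j<l. d j ^ r = 1" "(\<Prod>j<l. d j) ^ (r div p) = 1" "g = op l e x (mm \<sigma> d)"
      using 2 by metis
    then have "g = mon l e x \<sigma> d" using opmm[OF s(1)] by simp
    then show "g \<in> mons l e x r (r div p)" unfolding mons_def using s(1-3) by blast
  next
    fix g assume "g \<in> mons l e x r (r div p)"
    then obtain \<sigma> d where s: "\<sigma> permutes {..<l}" "\<forall>j<l. d j ^ r = 1" "(\<Prod>j<l. d j) ^ (r div p) = 1" "g = mon l e x \<sigma> d"
      unfolding mons_def by blast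
    have nz: "d j \<noteq> 0" if "j < l" for j using s(2) that r by (auto simp: power_0_left)
    then show "g \<in> op l e x ` monomial_group r p l"
      using 1[OF s(1) _ s(3)] s(2,4) opmm[OF s(1), of d] by (metis image_eqI)
  qed
qed

end

section \<open>Simple roots of types A and B\<close>

context refl_factor
begin

text \<open>Duality of \<open>x'\<close> and \<open>e'\<close> says
  \<open>B * A = 1\<^sub>m l\<close>, whereas the expansion of vectors of \<open>U\<close> in
  \<open>e'\<close> amounts to \<open>A * B = 1\<^sub>m l\<close>; for square matrices the two are
  equivalent.\<close>

lemma coords_dualI:
  assumes x: "coords U C l e x" and x': "\<And>i. i < l \<Longrightarrow> lform (x' i)"
    and d: "\<And>i j. i < l \<Longrightarrow> j < l \<Longrightarrow> x' i (e' j) = (if i = j then 1 else 0)"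
    and e': "\<And>i. i < l \<Longrightarrow> e' i \<in> U" and c: "\<And>i c. i < l \<Longrightarrow> c \<in> C \<Longrightarrow> x' i c = 0"
  shows "coords U C l e' x'"
proof -
  define A where "A = mat l l (\<lambda>(i, j). x i (e' j))"
  define B where "B = mat l l (\<lambda>(i, j). x' i (e j))"
  have cA: "A \<in> carrier_mat l l" "B \<in> carrier_mat l l" by (auto simp: A_def B_def)
  have x'u: "x' i u = (\<Sum>k<l. x' i (e k) * x k u)" if "i < l" "u \<in> U" for i u
    using form_comb[OF x x'[OF that(1)] c[OF that(1)]] by (metis comb_def)
  have "B * A = 1\<^sub>m l"
  proof (rule eq_matI)
    fix i j assume ij: "i < dim_row (1\<^sub>m l)" "j < dim_col (1\<^sub>m l)"
    then have "(B * A) $$ (i, j) = (\<Sum>k<l. x' i (e k) * x k (e' j))"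
      by (simp add: A_def B_def scalar_prod_def atLeast0LessThan)
    then show "(B * A) $$ (i, j) = 1\<^sub>m l $$ (i, j)" using ij x'u[of i "e' j"] d e' by auto
  qed (auto simp: A_def B_def)
  then have AB: "A * B = 1\<^sub>m l" using mat_mult_left_right_inverse cA by blast
  have AB': "(\<Sum>j<l. x i (e' j) * x' j (e k)) = (if i = k then 1 else 0)" if "i < l" "k < l" for i k
  proof -
    have "(A * B) $$ (i, k) = (\<Sum>j<l. x i (e' j) * x' j (e k))"
      using that by (simp add: A_def B_def scalar_prod_def atLeast0LessThan)
    then show ?thesis using AB that by simp
  qed
  have "u = (\<Sum>j<l. x' j u *s e' j)" if u: "u \<in> U" for u
  proof (rule U_eqI[OF x u])
    show "(\<Sum>j<l. x' j u *s e' j) \<in> U" using e' subU by (auto intro!: subspace_sum subspace_scale)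
    fix i assume i: "i < l"
    have "x i (\<Sum>j<l. x' j u *s e' j) = (\<Sum>j<l. (\<Sum>k<l. x' j (e k) * x k u) * x i (e' j))"
      using i x'u u by (simp add: lform_simps[OF coords_lform[OF x]])
    also have "\<dots> = (\<Sum>k<l. (\<Sum>j<l. x i (e' j) * x' j (e k)) * x k u)"
      unfolding sum_distrib_right by (subst sum.swap) (auto intro!: sum.cong)
    also have "\<dots> = x i u" using i AB' by (simp add: if_distrib[of "\<lambda>z. z * _"] cong: if_cong)
    finally show "x i u = x i (\<Sum>j<l. x' j u *s e' j)" by simp
  qed
  then show ?thesis unfolding coords_def using assms by blast
qed

text \<open>The generator is the reflection with root \<open>f i\<close>; the minus sign in B(e_i,
  e_j) = - cos turns -2 B into the coefficients 2 cos of its form.\<close>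

lemma coxeter_generator_op:
  assumes y: "coords U C l f y" and i: "i < l"
  shows "op l f y (coxeter_generator m l i) =
    (\<lambda>u. u + comb l y (\<lambda>j. 2 * complex_of_real (cos (pi / real (m i j)))) u *s f i)"
proof -
  let ?a = "\<lambda>j. 2 * complex_of_real (cos (pi / real (m i j)))"
  have l: "lin (\<lambda>u. u + comb l y ?a u *s f i)" by (rule lin_transvection[OF comb_lform[OF y]])
  have "(\<lambda>u. u + comb l y ?a u *s f i) = op l f y (coxeter_generator m l i)"
  proof (rule op_eqI[OF y l])
    show "c + comb l y ?a c *s f i = c" if "c \<in> C" for c
      using that y by (simp add: comb_def coords_def)
    show "u + comb l y ?a u *s f i \<in> U" if "u \<in> U" for u
      using that subU e_in_U[OF y i] by (auto intro: subspace_add subspace_scale)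
    fix a k assume "a < l" "k < l"
    then show "y a (f k + comb l y ?a (f k) *s f i) = coxeter_generator m l i $$ (a, k)"
      using i by (simp add: lform_simps[OF coords_lform[OF y]] coords_dual[OF y] comb_e[OF y] coxeter_generator_def)
  qed
  then show ?thesis by simp
qed

text \<open>As \<open>m i i = 1\<close>, the form of a generator takes the value 2 cos pi = -2 at
  its root, so generators are involutions. Inverses then add nothing, and the group generated is the
  monoid \<open>mcl\<close>.\<close>

lemma coxeter_group_op:
  assumes y: "coords U C l f y" and m: "\<And>i. i < l \<Longrightarrow> m i i = 1"
  shows "coxeter_group m l \<subseteq> carrier_mat l l"
    "op l f y ` coxeter_group m l = mcl ((\<lambda>i. op l f y (coxeter_generator m l i)) ` {..<l})"
proof -
  let ?c = "coxeter_generator m l" and ?R = "ring_mat TYPE(complex) l ()"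
  let ?Q = "units_of ?R"
  have cc: "?c i \<in> carrier_mat l l" for i by (simp add: coxeter_generator_def)
  have inv: "?c i * ?c i = 1\<^sub>m l" if i: "i < l" for i
  proof (rule op_inj[OF y])
    let ?a = "\<lambda>j. 2 * complex_of_real (cos (pi / real (m i j)))"
    have "?a i = - 2" using m[OF i] by simp
    then have ai: "comb l y ?a (f i) = - 2" using comb_e[OF y i] by metis
    have "(\<lambda>u. u + comb l y ?a u *s f i) \<circ> (\<lambda>u. u + comb l y ?a u *s f i) = id"
      by (rule ext) (simp add: lform_simps[OF comb_lform[OF y]] ai flip: scale_left_distrib)
    then show "op l f y (?c i * ?c i) = op l f y (1\<^sub>m l)"
      unfolding op_mult[OF y cc cc] op_one[OF y] coxeter_generator_op[OF y i] .
  qed (use mult_carrier_mat[OF cc cc] in auto)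
  interpret R: ring ?R by (rule ring_mat)
  have Rm: "monoid ?R" ..
  interpret Q: group ?Q by (rule R.units_group)
  have multQ: "M \<otimes>\<^bsub>?Q\<^esub> N = M * N" for M N by (simp add: units_of_def ring_mat_def)
  have oneQ: "\<one>\<^bsub>?Q\<^esub> = 1\<^sub>m l" by (simp add: units_of_def ring_mat_def)
  have cQ: "?c i \<in> carrier ?Q" if "i < l" for i
    using inv[OF that] cc[of i] by (auto simp: units_of_def Units_def ring_mat_def)
  have invQ: "inv\<^bsub>?Q\<^esub> (?c i) = ?c i" if "i < l" for i
    by (rule Q.inv_equality) (use cQ[OF that] inv[OF that] in \<open>auto simp: multQ oneQ\<close>)
  have carr: "carrier ?Q \<subseteq> carrier_mat l l" by (auto simp: units_of_def Units_def ring_mat_def)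
  have "coxeter_group m l \<subseteq> carrier ?Q"
    unfolding coxeter_group_def by (rule Q.generate_incl) (use cQ in auto)
  then show sub: "coxeter_group m l \<subseteq> carrier_mat l l" using carr by blast
  let ?T = "mcl ((\<lambda>i. op l f y (?c i)) ` {..<l})"
  have opT: "op l f y (?c i) \<in> ?T" if "i < l" for i using that by (intro mcl_incl) auto
  show "op l f y ` coxeter_group m l = ?T"
  proof (intro subset_antisym subsetI)
    fix g assume "g \<in> op l f y ` coxeter_group m l"
    then obtain M where M: "M \<in> generate ?Q (?c ` {..<l})" "g = op l f y M" unfolding coxeter_group_def by blast
    from M(1) have "op l f y M \<in> ?T"
    proof (induction rule: generate.induct)
      case one then show ?case unfolding oneQ op_one[OF y] by (rule mcl.id)
    next
      case (incl h) then show ?case using opT by auto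
    next
      case (inv h) then show ?case using opT invQ by auto
    next
      case (eng h1 h2)
      then have h: "h1 \<in> carrier_mat l l" "h2 \<in> carrier_mat l l" using sub unfolding coxeter_group_def by auto
      show ?case unfolding multQ op_mult[OF y h] by (rule mcl_mult[OF eng.IH])
    qed
    then show "g \<in> ?T" using M by simp
  next
    fix g assume "g \<in> ?T"
    then show "g \<in> op l f y ` coxeter_group m l"
    proof (induction rule: mcl.induct)
      case id
      have "1\<^sub>m l \<in> coxeter_group m l" unfolding coxeter_group_def oneQ[symmetric] by (rule generate.one)
      then show ?case using op_one[OF y] by (metis image_eqI)
    next
      case (step s g)
      then obtain i M where i: "i < l" "s = op l f y (?c i)" and M: "M \<in> coxeter_group m l" "g = op l f y M" by auto
      have "?c i \<otimes>\<^bsub>?Q\<^esub> M \<in> coxeter_group m l"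
        unfolding coxeter_group_def
        by (rule generate.eng[OF generate.incl]) (use i M in \<open>auto simp: coxeter_group_def\<close>)
      then have "?c i * M \<in> coxeter_group m l" by (simp add: multQ)
      moreover have "op l f y (?c i * M) = s \<circ> g" using op_mult[OF y cc] M sub i by auto
      ultimately show ?case by (metis image_eqI)
    qed
  qed
qed

lemma cos_values: "cos (pi / real (Suc 0)) = - 1" "cos (pi / real 2) = 0" "cos (pi / real 3) = 1 / 2"
  "cos (pi / real 4) = sqrt 2 / 2"
  by (simp_all add: cos_60 cos_45)

text \<open>The simple roots are the differences of consecutive vectors among e_0, ..., e_(l-1) and
  the additional vector; the last difference is e_(l-1) plus the sum of all e_j. In this basis the
  transpositions have the matrices of the Coxeter generators.\<close>

lemma simple_A_op:
  assumes x: "coords U C l e x" and y: "coords U C l f y" and l: "2 \<le> l"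
    and f: "\<And>j. Suc j < l \<Longrightarrow> f j = e j - e (Suc j)" and fl: "f (l - 1) = e (l - 1) + (\<Sum>j<l. e j)" and i: "i < l"
  shows "op l f y (coxeter_generator coxeter_matrix_A l i) = simple_A l e x i"
proof -
  let ?a = "\<lambda>j. 2 * complex_of_real (cos (pi / real (coxeter_matrix_A i j)))"
  \<comment> \<open>The 2 arises because e_(l-1) occurs twice in the last root.\<close>
  have xf: "x k (f j) = (if Suc j < l then (if k = j then 1 else 0) - (if k = Suc j then 1 else 0)
      else (if k = l - 1 then 2 else 1))" if k: "k < l" and j: "j < l" for k j
  proof (cases "Suc j < l")
    case True then show ?thesis using f[OF True] k by (simp add: lform_simps[OF coords_lform[OF x]] coords_dual[OF x])
  next
    case False
    then have "j = l - 1" using j by simp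
    then show ?thesis using fl k l by (simp add: lform_simps[OF coords_lform[OF x]] coords_dual[OF x])
  qed
  have ac: "?a j = (if i = j then - 2 else if j = Suc i \<or> i = Suc j then 1 else 0)" for j
    by (simp add: coxeter_matrix_A_def cos_values cos_60)
  have "simple_A l e x i = (\<lambda>u. u + comb l y ?a u *s f i)"
  proof (rule lin_eqI[OF y])
    show "lin (simple_A l e x i)" using lin_sw[OF x] lin_sg[OF x] i by (simp add: simple_A_def)
    show "lin (\<lambda>u. u + comb l y ?a u *s f i)" by (rule lin_transvection[OF comb_lform[OF y]])
    show "simple_A l e x i c = c + comb l y ?a c *s f i" if "c \<in> C" for c
      using that y sw_C[OF x] sg_C[OF x] i by (auto simp: simple_A_def comb_def coords_def)
    fix j assume j: "j < l"
    show "simple_A l e x i (f j) = f j + comb l y ?a (f j) *s f i"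
    proof (cases "Suc i < l")
      case True
      then have "simple_A l e x i (f j) = f j + (x i (f j) - x (Suc i) (f j)) *s - f i"
        by (simp add: simple_A_def sw_def f[OF True])
      moreover have "- (x i (f j) - x (Suc i) (f j)) = ?a j"
        unfolding ac using True j l by (auto simp: xf)
      ultimately show ?thesis unfolding comb_e[OF y j] by (metis scale_minus_left scale_minus_right)
    next
      case False
      then have i': "i = l - 1" using i by simp
      then have fi: "f i = e i + (\<Sum>j<l. e j)" using fl by simp
      have "simple_A l e x i (f j) = f j + x i (f j) *s - f i"
        using False by (simp add: simple_A_def sg_def fi)
      moreover have "- x i (f j) = ?a j"
        unfolding ac using i' i j l by (auto simp: xf)
      ultimately show ?thesis unfolding comb_e[OF y j] by (metis scale_minus_left scale_minus_right)
    qed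
  qed
  then show ?thesis using coxeter_generator_op[OF y i, of coxeter_matrix_A] by simp
qed

text \<open>The factor sqrt 2 in the last root makes both off-diagonal coefficients between the last
  two roots equal to 2 cos (pi / 4); with e_(l-1) itself they would be 1 and 2.\<close>

lemma simple_B_op:
  assumes x: "coords U C l e x" and y: "coords U C l f y" and l: "2 \<le> l"
    and f: "\<And>j. Suc j < l \<Longrightarrow> f j = e j - e (Suc j)" and fl: "f (l - 1) = complex_of_real (sqrt 2) *s e (l - 1)" and i: "i < l"
  shows "op l f y (coxeter_generator (coxeter_matrix_B l) l i) = simple_B l e x i"
proof -
  let ?s = "complex_of_real (sqrt 2)"
  have ss: "?s * ?s = 2" by (simp flip: of_real_mult)
  let ?a = "\<lambda>j. 2 * complex_of_real (cos (pi / real (coxeter_matrix_B l i j)))"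
  have xf: "x k (f j) = (if Suc j < l then (if k = j then 1 else 0) - (if k = Suc j then 1 else 0)
      else (if k = l - 1 then ?s else 0))" if k: "k < l" and j: "j < l" for k j
  proof (cases "Suc j < l")
    case True then show ?thesis using f[OF True] k by (simp add: lform_simps[OF coords_lform[OF x]] coords_dual[OF x])
  next
    case False
    then have "j = l - 1" using j by simp
    then show ?thesis using fl k l by (simp add: lform_simps[OF coords_lform[OF x]] coords_dual[OF x])
  qed
  have ac: "?a j = (if i = j then - 2 else if j = Suc i \<or> i = Suc j then (if Suc i = l \<or> Suc j = l then ?s else 1) else 0)" for j
    by (simp add: coxeter_matrix_B_def cos_values cos_60 cos_45)
  have "simple_B l e x i = (\<lambda>u. u + comb l y ?a u *s f i)"
  proof (rule lin_eqI[OF y])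
    show "lin (simple_B l e x i)" using lin_sw[OF x] lin_dg[OF x] i by (simp add: simple_B_def)
    show "lin (\<lambda>u. u + comb l y ?a u *s f i)" by (rule lin_transvection[OF comb_lform[OF y]])
    show "simple_B l e x i c = c + comb l y ?a c *s f i" if "c \<in> C" for c
      using that y sw_C[OF x] dg_C[OF x] i by (auto simp: simple_B_def comb_def coords_def)
    fix j assume j: "j < l"
    show "simple_B l e x i (f j) = f j + comb l y ?a (f j) *s f i"
    proof (cases "Suc i < l")
      case True
      then have "simple_B l e x i (f j) = f j + (x i (f j) - x (Suc i) (f j)) *s - f i"
        by (simp add: simple_B_def sw_def f[OF True])
      moreover have "- (x i (f j) - x (Suc i) (f j)) = ?a j"
        unfolding ac using True j l by (auto simp: xf)
      ultimately show ?thesis unfolding comb_e[OF y j] by (metis scale_minus_left scale_minus_right)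
    next
      case False
      then have i': "i = l - 1" using i by simp
      then have fi: "f i = ?s *s e i" using fl by simp
      have "simple_B l e x i (f j) = f j + (- x i (f j) * ?s) *s f i"
        using False by (simp add: simple_B_def dg_def fi ss mult.assoc)
      moreover have "- x i (f j) * ?s = ?a j"
        unfolding ac using i' i j l ss by (auto simp: xf)
      ultimately show ?thesis unfolding comb_e[OF y j] by metis
    qed
  qed
  then show ?thesis using coxeter_generator_op[OF y i, of "coxeter_matrix_B l"] by simp
qed

lemma lform_lincomb: "(\<And>i. i \<in> I \<Longrightarrow> lform (h i)) \<Longrightarrow> lform (\<lambda>u. \<Sum>i\<in>I. a i * h i u)"
  by (auto simp: lform_def sum.distrib sum_distrib_left algebra_simps intro!: sum.cong)

text \<open>The dual basis consists of the fundamental weights: y_k is x_0 + ... + x_k minus (k +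
  1)/(l + 1) times the sum of all coordinates. This fraction makes y_k vanish on the last root for k
  < l - 1.\<close>

lemma simple_roots_A:
  assumes x: "coords U C l e x" and l: "2 \<le> l"
  obtains f y where "coords U C l f y" "\<And>j. Suc j < l \<Longrightarrow> f j = e j - e (Suc j)" "f (l - 1) = e (l - 1) + (\<Sum>j<l. e j)"
proof -
  define f where "f j = (if Suc j < l then e j - e (Suc j) else e j + (\<Sum>j<l. e j))" for j
  define w where "w k i = (if i \<le> k then 1 else 0) - (of_nat (Suc k) / of_nat (Suc l) :: complex)" for k i :: nat
  define y :: "nat \<Rightarrow> 'v \<Rightarrow> complex" where "y k u = (\<Sum>i<l. w k i * x i u)" for k u
  have ye: "y k (e j) = w k j" if "j < l" for k j
    using comb_e[OF x that, of "w k"] by (simp add: y_def comb_def)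
  have yl: "lform (y k)" for k unfolding y_def[abs_def] by (rule lform_lincomb) (use coords_lform[OF x] in auto)
  have sw: "(\<Sum>j<l. w k j) = of_nat (Suc k) / of_nat (Suc l)" if k: "k < l" for k
  proof -
    have "(\<Sum>j<l. if j \<le> k then 1 else (0::complex)) = (\<Sum>j\<in>{..<l} \<inter> {..k}. 1)"
      by (subst sum.inter_restrict) auto
    also have "{..<l} \<inter> {..k} = {..k}" using k by auto
    finally have "(\<Sum>j<l. if j \<le> k then 1 else (0::complex)) = of_nat (Suc k)" by simp
    then have "(\<Sum>j<l. w k j) = of_nat (Suc k) - of_nat l * (of_nat (Suc k) / of_nat (Suc l))"
      by (simp add: w_def sum_subtractf)
    moreover have "of_nat (Suc l) \<noteq> (0::complex)" by (simp only: of_nat_eq_0_iff)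
    ultimately show ?thesis by (simp add: field_simps)
  qed
  have yf: "y k (f j) = (if k = j then 1 else 0)" if k: "k < l" and j: "j < l" for k j
  proof (cases "Suc j < l")
    case True
    then show ?thesis by (auto simp: f_def lform_simps[OF yl] ye w_def)
  next
    case False
    then have j': "j = l - 1" using j by simp
    have "y k (f j) = w k j + (\<Sum>j<l. w k j)" using False j by (simp add: f_def lform_simps[OF yl] ye)
    also have "\<dots> = w k j + of_nat (Suc k) / of_nat (Suc l)" by (simp only: sw[OF k])
    also have "\<dots> = (if k = j then 1 else 0)" unfolding w_def using j' k by auto
    finally show ?thesis .
  qed
  have "coords U C l f y"
  proof (rule coords_dualI[OF x yl yf])
    show "f i \<in> U" if "i < l" for i
      using that e_in_U[OF x] subU by (auto simp: f_def intro!: subspace_diff subspace_add subspace_sum)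
    show "y i c = 0" if "c \<in> C" for i c using that x by (simp add: y_def coords_def)
  qed
  then show thesis by (rule that) (use l in \<open>auto simp: f_def\<close>)
qed

text \<open>The inverse change of basis: the same weights now express e_j through the simple
  roots.\<close>

lemma from_simple_roots_A:
  assumes y: "coords U C l f y" and l: "2 \<le> l"
  obtains e x where "coords U C l e x" "\<And>j. Suc j < l \<Longrightarrow> f j = e j - e (Suc j)" "f (l - 1) = e (l - 1) + (\<Sum>j<l. e j)"
proof -
  define w where "w k j = (if j \<le> k then 1 else 0) - (of_nat (Suc k) / of_nat (Suc l) :: complex)" for k j :: nat
  define e where "e j = (\<Sum>k<l. w k j *s f k)" for j
  \<comment> \<open>The contributions to e_j come from \<open>f j\<close>, negatively from
    \<open>f (j - 1)\<close>, and from the full sum contained in \<open>f (l - 1)\<close>.\<close>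
  define x where "x j u = y j u - (if j = 0 then 0 else y (j - 1) u) + y (l - 1) u" for j u
  have ye: "y k (e j) = w k j" if "k < l" for k j
    unfolding e_def using coord_sum[OF y that, of "\<lambda>k. w k j"] by simp
  have nz: "of_nat (Suc l) \<noteq> (0::complex)" by (simp only: of_nat_eq_0_iff)
  have xl: "lform (x j)" if "j < l" for j
    using coords_lform[OF y, of j] coords_lform[OF y, of "j - 1"] coords_lform[OF y, of "l - 1"] that l
    unfolding x_def lform_def by (auto simp: algebra_simps)
  have xe: "x i (e j) = (if i = j then 1 else 0)" if i: "i < l" and j: "j < l" for i j
  proof -
    have "x i (e j) = w i j - (if i = 0 then 0 else w (i - 1) j) + w (l - 1) j"
      using i l by (simp add: x_def ye)
    also have "\<dots> = (if i = j then 1 else 0)"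
    proof -
      \<comment> \<open>The value 1 - l/(l + 1), which the last weight takes at every index below
        \<open>l\<close>.\<close>
      define q :: complex where "q = 1 / of_nat (Suc l)"
      have wq: "w k j = (if j \<le> k then 1 else 0) - of_nat (Suc k) * q" for k by (simp add: w_def q_def)
      have "of_nat (Suc l) * q = 1" using nz by (simp add: q_def)
      then have ql: "q = 1 - of_nat l * q" by (simp add: algebra_simps)
      have "Suc (l - 1) = l" using l by simp
      then have wl: "w (l - 1) j = q" using j wq[of "l - 1"] ql by auto
      show ?thesis unfolding wl by (cases i) (auto simp: wq algebra_simps)
    qed
    finally show ?thesis .
  qed
  have eU: "e j \<in> U" for j unfolding e_def by (rule sum_in_U[OF y])
  have "coords U C l e x"
  proof (rule coords_dualI[OF y xl xe eU])
    show "x i c = 0" if "i < l" "c \<in> C" for i c using that y l by (simp add: x_def coords_def)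
  qed
  moreover have "f j = e j - e (Suc j)" if j: "Suc j < l" for j
    by (rule U_eqI[OF y])
      (use j subspace_diff[OF subU eU eU] e_in_U[OF y] in
        \<open>auto simp: lform_simps[OF coords_lform[OF y]] coords_dual[OF y] ye w_def\<close>)
  moreover have "f (l - 1) = e (l - 1) + (\<Sum>j<l. e j)"
  proof (rule U_eqI[OF y])
    show "f (l - 1) \<in> U" using e_in_U[OF y] l by simp
    show "e (l - 1) + (\<Sum>j<l. e j) \<in> U" using eU subU by (auto intro!: subspace_add subspace_sum)
    fix k assume k: "k < l"
    have "(\<Sum>j<l. if j \<le> k then 1 else (0::complex)) = (\<Sum>j\<in>{..<l} \<inter> {..k}. 1)"
      by (subst sum.inter_restrict) auto
    also have "{..<l} \<inter> {..k} = {..k}" using k by auto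
    finally have "(\<Sum>j<l. if j \<le> k then 1 else (0::complex)) = of_nat (Suc k)" by simp
    then have "(\<Sum>j<l. w k j) = of_nat (Suc k) - of_nat l * (of_nat (Suc k) / of_nat (Suc l))"
      by (simp add: w_def sum_subtractf)
    then have sw: "(\<Sum>j<l. w k j) = of_nat (Suc k) / of_nat (Suc l)" using nz by (simp add: field_simps)
    have "y k (e (l - 1) + (\<Sum>j<l. e j)) = w k (l - 1) + (\<Sum>j<l. w k j)"
      using k by (simp add: lform_simps[OF coords_lform[OF y]] ye)
    then show "y k (f (l - 1)) = y k (e (l - 1) + (\<Sum>j<l. e j))"
      unfolding sw using k l by (auto simp: coords_dual[OF y] w_def)
  qed
  ultimately show thesis by (rule that)
qed

lemma simple_roots_B:
  assumes x: "coords U C l e x" and l: "2 \<le> l"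
  obtains f y where "coords U C l f y" "\<And>j. Suc j < l \<Longrightarrow> f j = e j - e (Suc j)"
    "f (l - 1) = complex_of_real (sqrt 2) *s e (l - 1)"
proof -
  let ?s = "complex_of_real (sqrt 2)"
  define f where "f j = (if Suc j < l then e j - e (Suc j) else ?s *s e j)" for j
  \<comment> \<open>Partial sums of the coordinates, the full sum being divided by sqrt 2 to match
    the scaling of the last root.\<close>
  define w where "w k i = (if i \<le> k then (if Suc k < l then 1 else 1 / ?s) else 0)" for k i :: nat
  define y :: "nat \<Rightarrow> 'v \<Rightarrow> complex" where "y k u = (\<Sum>i<l. w k i * x i u)" for k u
  have ye: "y k (e j) = w k j" if "j < l" for k j
    using comb_e[OF x that, of "w k"] by (simp add: y_def comb_def)
  have yl: "lform (y k)" for k unfolding y_def[abs_def] by (rule lform_lincomb) (use coords_lform[OF x] in auto)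
  have yf: "y k (f j) = (if k = j then 1 else 0)" if k: "k < l" and j: "j < l" for k j
    using k j by (auto simp: f_def lform_simps[OF yl] ye w_def)
  have "coords U C l f y"
  proof (rule coords_dualI[OF x yl yf])
    show "f i \<in> U" if "i < l" for i
      using that e_in_U[OF x] subU by (auto simp: f_def intro!: subspace_diff subspace_scale)
    show "y i c = 0" if "c \<in> C" for i c using that x by (simp add: y_def coords_def)
  qed
  then show thesis by (rule that) (use l in \<open>auto simp: f_def\<close>)
qed

lemma from_simple_roots_B:
  assumes y: "coords U C l f y" and l: "2 \<le> l"
  obtains e x where "coords U C l e x" "\<And>j. Suc j < l \<Longrightarrow> f j = e j - e (Suc j)"
    "f (l - 1) = complex_of_real (sqrt 2) *s e (l - 1)"
proof -
  let ?s = "complex_of_real (sqrt 2)"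
  define w where "w k j = (if j \<le> k then (if Suc k < l then 1 else 1 / ?s) else 0)" for k j :: nat
  define e where "e j = (\<Sum>k<l. w k j *s f k)" for j
  define x where "x j u = (if Suc j < l then 1 else ?s) * y j u - (if j = 0 then 0 else y (j - 1) u)" for j u
  have ye: "y k (e j) = w k j" if "k < l" for k j
    unfolding e_def using coord_sum[OF y that, of "\<lambda>k. w k j"] by simp
  have xl: "lform (x j)" if "j < l" for j
    using coords_lform[OF y, of j] coords_lform[OF y, of "j - 1"] that l
    unfolding x_def lform_def by (auto simp: algebra_simps)
  have xe: "x i (e j) = (if i = j then 1 else 0)" if i: "i < l" and j: "j < l" for i j
    using i j by (cases i) (auto simp: x_def ye w_def)
  have eU: "e j \<in> U" for j unfolding e_def by (rule sum_in_U[OF y])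
  have "coords U C l e x"
  proof (rule coords_dualI[OF y xl xe eU])
    show "x i c = 0" if "i < l" "c \<in> C" for i c using that y l by (simp add: x_def coords_def)
  qed
  moreover have "f j = e j - e (Suc j)" if j: "Suc j < l" for j
    by (rule U_eqI[OF y])
      (use j subspace_diff[OF subU eU eU] e_in_U[OF y] in
        \<open>auto simp: lform_simps[OF coords_lform[OF y]] coords_dual[OF y] ye w_def\<close>)
  moreover have "f (l - 1) = ?s *s e (l - 1)"
    by (rule U_eqI[OF y])
      (use l subspace_scale[OF subU eU] e_in_U[OF y] in
        \<open>auto simp: lform_simps[OF coords_lform[OF y]] coords_dual[OF y] ye w_def\<close>)
  ultimately show thesis by (rule that)
qed

abbreviation "K \<equiv> (\<lambda>g. restrict g U) ` G"

text \<open>The Coxeter matrices refer to the basis of simple roots, the classification to the basis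
  \<open>e\<close> of modular lines; \<open>simple_roots_A\<close> and
  \<open>from_simple_roots_A\<close> pass between the two.\<close>

lemma isomorphic_A_iff:
  assumes l: "2 \<le> l"
  shows "isomorphic_reflection_group scale U K l (coxeter_group coxeter_matrix_A l) \<longleftrightarrow>
    (\<exists>e x. coords U C l e x \<and> G = mcl (swaps l e x 1 \<union> sg l e x ` {..<l}))" (is "?L \<longleftrightarrow> ?R")
proof -
  have d: "coxeter_matrix_A i i = 1" for i by (simp add: coxeter_matrix_A_def)
  have carr: "coxeter_group coxeter_matrix_A l \<subseteq> carrier_mat l l" if "coords U C l f y" for f y
    using coxeter_group_op(1)[OF that, of coxeter_matrix_A] d by blast
  have eq: "op l f y ` coxeter_group coxeter_matrix_A l = mcl (swaps l e x 1 \<union> sg l e x ` {..<l})"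
    if y: "coords U C l f y" and x: "coords U C l e x" and f: "\<And>j. Suc j < l \<Longrightarrow> f j = e j - e (Suc j)"
      "f (l - 1) = e (l - 1) + (\<Sum>j<l. e j)" for e x f y
  proof -
    have "(\<lambda>i. op l f y (coxeter_generator coxeter_matrix_A l i)) ` {..<l} = simple_A l e x ` {..<l}"
      by (rule image_cong) (use simple_A_op[OF x y l f] in auto)
    then show ?thesis using coxeter_group_op(2)[OF y, of coxeter_matrix_A] d mcl_simple_A[OF x] l by simp
  qed
  show ?thesis
  proof
    assume ?R
    then obtain e x where x: "coords U C l e x" "G = mcl (swaps l e x 1 \<union> sg l e x ` {..<l})" by blast
    obtain f y where f: "coords U C l f y" "\<And>j. Suc j < l \<Longrightarrow> f j = e j - e (Suc j)" "f (l - 1) = e (l - 1) + (\<Sum>j<l. e j)"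
      using simple_roots_A[OF x(1) l] by blast
    show ?L using isomorphicI[OF f(1) carr[OF f(1)]] eq[OF f(1) x(1) f(2,3)] x(2) by simp
  next
    assume L: ?L
    obtain f y where y: "coords U C l f y" "G = op l f y ` coxeter_group coxeter_matrix_A l"
      by (rule isomorphicD[OF L carr])
    obtain e x where x: "coords U C l e x" "\<And>j. Suc j < l \<Longrightarrow> f j = e j - e (Suc j)" "f (l - 1) = e (l - 1) + (\<Sum>j<l. e j)"
      using from_simple_roots_A[OF y(1) l] by blast
    show ?R using eq[OF y(1) x] y(2) x(1) by blast
  qed
qed

lemma isomorphic_B_iff:
  assumes l: "2 \<le> l"
  shows "isomorphic_reflection_group scale U K l (coxeter_group (coxeter_matrix_B l) l) \<longleftrightarrow>
    (\<exists>e x. coords U C l e x \<and> G = mcl (swaps l e x 2 \<union> diags l e x 2))" (is "?L \<longleftrightarrow> ?R")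
proof -
  have d: "coxeter_matrix_B l i i = 1" for i by (simp add: coxeter_matrix_B_def)
  have carr: "coxeter_group (coxeter_matrix_B l) l \<subseteq> carrier_mat l l" if "coords U C l f y" for f y
    using coxeter_group_op(1)[OF that, of "coxeter_matrix_B l"] d by blast
  have eq: "op l f y ` coxeter_group (coxeter_matrix_B l) l = mcl (swaps l e x 2 \<union> diags l e x 2)"
    if y: "coords U C l f y" and x: "coords U C l e x" and f: "\<And>j. Suc j < l \<Longrightarrow> f j = e j - e (Suc j)"
      "f (l - 1) = complex_of_real (sqrt 2) *s e (l - 1)" for e x f y
  proof -
    have "(\<lambda>i. op l f y (coxeter_generator (coxeter_matrix_B l) l i)) ` {..<l} = simple_B l e x ` {..<l}"
      by (rule image_cong) (use simple_B_op[OF x y l f] in auto)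
    then show ?thesis using coxeter_group_op(2)[OF y, of "coxeter_matrix_B l"] d mcl_simple_B[OF x] l by simp
  qed
  show ?thesis
  proof
    assume ?R
    then obtain e x where x: "coords U C l e x" "G = mcl (swaps l e x 2 \<union> diags l e x 2)" by blast
    obtain f y where f: "coords U C l f y" "\<And>j. Suc j < l \<Longrightarrow> f j = e j - e (Suc j)" "f (l - 1) = complex_of_real (sqrt 2) *s e (l - 1)"
      using simple_roots_B[OF x(1) l] by blast
    show ?L using isomorphicI[OF f(1) carr[OF f(1)]] eq[OF f(1) x(1) f(2,3)] x(2) by simp
  next
    assume L: ?L
    obtain f y where y: "coords U C l f y" "G = op l f y ` coxeter_group (coxeter_matrix_B l) l"
      by (rule isomorphicD[OF L carr])
    obtain e x where x: "coords U C l e x" "\<And>j. Suc j < l \<Longrightarrow> f j = e j - e (Suc j)" "f (l - 1) = complex_of_real (sqrt 2) *s e (l - 1)"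
      using from_simple_roots_B[OF y(1) l] by blast
    show ?R using eq[OF y(1) x] y(2) x(1) by blast
  qed
qed

lemma isomorphic_monomial_iff:
  assumes l: "0 < l" and p: "p dvd r" "0 < r"
  shows "isomorphic_reflection_group scale U K l (monomial_group r p l) \<longleftrightarrow>
    (\<exists>e x. coords U C l e x \<and> G = mcl (swaps l e x r \<union> diags l e x (r div p)))" (is "?L \<longleftrightarrow> ?R")
proof -
  have carr: "monomial_group r p l \<subseteq> carrier_mat l l" by (auto simp: monomial_group_def)
  have dvd: "r div p dvd r" using p(1) by (metis dvd_div_mult_self dvd_triv_left)
  have eq: "op l e x ` monomial_group r p l = mcl (swaps l e x r \<union> diags l e x (r div p))"
    if x: "coords U C l e x" for e x
    unfolding mcl_mons[OF x dvd p(2) l] op_monomial_group[OF x p(2)] ..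
  show ?thesis
  proof
    assume ?L
    then obtain e x where "coords U C l e x" "G = op l e x ` monomial_group r p l"
      using isomorphicD carr by metis
    then show ?R using eq by metis
  next
    assume ?R
    then obtain e x where x: "coords U C l e x" "G = mcl (swaps l e x r \<union> diags l e x (r div p))" by blast
    show ?L using isomorphicI[OF x(1) carr] x(2) eq[OF x(1)] by simp
  qed
qed

end

section \<open>The arrangements of the listed groups\<close>

context refl_factor
begin

text \<open>The arrangement of G(r,1,l) in the coordinates \<open>x\<close>. It is also used with
  only the leading coordinates of a longer system, which gives the filtration into levels.\<close>

definition std_arr :: "nat \<Rightarrow> (nat \<Rightarrow> 'v \<Rightarrow> complex) \<Rightarrow> nat \<Rightarrow> 'v set set" where
  "std_arr l x r = {{u. x i u = 0} | i. i < l} \<union>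
     {{u. x i u - z * x j u = 0} | i j z. i < l \<and> j < l \<and> i \<noteq> j \<and> z ^ r = 1}"

text \<open>The new level consists of the hyperplanes whose form involves x_k. The vector e_k lies
  on every old hyperplane and on no new one, and two distinct new equations for x_k imply, by
  equating their right-hand sides, the equation of an old hyperplane.\<close>

lemma ss_std_arr:
  assumes x: "coords U C l e x" and r: "0 < r"
  shows "k \<le> l \<Longrightarrow> ss (std_arr k x r)"
proof (induction k)
  case 0
  have "std_arr 0 x r = {}" by (auto simp: std_arr_def)
  then show ?case using ss.empty by simp
next
  case (Suc k)
  then have k: "k < l" by simp
  define N where "N = {{u. x k u - c * x j u = 0} | j c. j < k \<and> c ^ r = 1} \<union> {{u. x k u = 0}}"
  \<comment> \<open>The hyperplane x_k = 0 is covered by \<open>c = 0\<close>, where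
    \<open>j\<close> is arbitrary.\<close>
  have N: "\<exists>j c. (c = 0 \<or> j < k \<and> c ^ r = 1) \<and> H = {u. x k u - c * x j u = 0}" if "H \<in> N" for H
    using that unfolding N_def by fastforce
  have nz: "z \<noteq> 0" if "z ^ r = 1" for z :: complex using that r by (auto simp: power_0_left)
  have dual: "x i (e k) = (if i = k then 1 else 0)" if "i \<le> k" for i using that k coords_dual[OF x, of i k] by simp
  have eq: "std_arr (Suc k) x r = std_arr k x r \<union> N"
  proof (intro subset_antisym subsetI)
    fix H assume "H \<in> std_arr (Suc k) x r"
    then consider i where "i < Suc k" "H = {u. x i u = 0}"
      | i j z where "i < Suc k" "j < Suc k" "i \<noteq> j" "z ^ r = 1" "H = {u. x i u - z * x j u = 0}"
      unfolding std_arr_def by blast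
    then show "H \<in> std_arr k x r \<union> N"
    proof cases
      case 1 then show ?thesis by (cases "i = k") (auto simp: std_arr_def N_def)
    next
      case 2
      consider "i < k" "j < k" | "i = k" "j < k" | "i < k" "j = k" using 2 by linarith
      then show ?thesis
      proof cases
        case 1 then show ?thesis using 2 unfolding std_arr_def by blast
      next
        case 2 then show ?thesis using \<open>z ^ r = 1\<close> \<open>H = _\<close> unfolding N_def by blast
      next
        case 3
        have "H = {u. x k u - (1 / z) * x i u = 0}" using 2 3 nz[of z] by (auto simp: field_simps)
        moreover have "(1 / z) ^ r = 1" using 2 by (simp add: power_divide)
        ultimately show ?thesis using 3 unfolding N_def by blast
      qed
    qed
  next
    fix H assume "H \<in> std_arr k x r \<union> N"
    then consider i where "i < Suc k" "H = {u. x i u = 0}"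
      | i j z where "i < Suc k" "j < Suc k" "i \<noteq> j" "z ^ r = 1" "H = {u. x i u - z * x j u = 0}"
    proof
      assume "H \<in> std_arr k x r"
      then show thesis unfolding std_arr_def using that less_SucI by blast
    next
      assume "H \<in> N"
      then consider j c where "j < k" "c ^ r = 1" "H = {u. x k u - c * x j u = 0}" | "H = {u. x k u = 0}"
        unfolding N_def by blast
      then show thesis
      proof cases
        case 1 show thesis by (rule that(2)[of k j c]) (use 1 in auto)
      next
        case 2 show thesis by (rule that(1)[of k]) (use 2 in auto)
      qed
    qed
    then show "H \<in> std_arr (Suc k) x r" unfolding std_arr_def by cases blast+
  qed
  have "ss (std_arr k x r \<union> N)"
  proof (rule ss.step)
    show "ss (std_arr k x r)" using Suc by simp
    show "N \<noteq> {}" by (auto simp: N_def)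
    fix H assume "H \<in> N"
    then obtain j c where H: "c = 0 \<or> j < k \<and> c ^ r = 1" "H = {u. x k u - c * x j u = 0}" using N by blast
    have "lform (\<lambda>u. x k u - c * x j u)"
    proof (cases "c = 0")
      case True then show ?thesis using coords_lform[OF x k] by simp
    next
      case False
      then have "j < l" using H k by auto
      then show ?thesis using coords_lform[OF x] k by (intro lform_diff_scaled) auto
    qed
    moreover have xk: "x k (e k) - c * x j (e k) \<noteq> 0" using H(1) dual[of k] dual[of j] by auto
    ultimately show "hyp H" unfolding hyp_def using H(2) by metis
    have "e k \<in> \<Inter>(std_arr k x r)" by (auto simp: std_arr_def dual)
    then show "\<not> \<Inter>(std_arr k x r) \<subseteq> H" using xk H(2) by blast
  next
    fix H1 H2 assume H12: "H1 \<in> N" "H2 \<in> N" "H1 \<noteq> H2"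
    obtain j1 c1 where 1: "c1 = 0 \<or> j1 < k \<and> c1 ^ r = 1" "H1 = {u. x k u - c1 * x j1 u = 0}" using N H12 by blast
    obtain j2 c2 where 2: "c2 = 0 \<or> j2 < k \<and> c2 ^ r = 1" "H2 = {u. x k u - c2 * x j2 u = 0}" using N H12 by blast
    have eqs: "c1 * x j1 u = c2 * x j2 u" if "u \<in> H1 \<inter> H2" for u using that 1 2 by auto
    have X: "{u. x j u = 0} \<in> std_arr k x r" if "j < k" for j using that unfolding std_arr_def by blast
    show "\<exists>H3\<in>std_arr k x r. H1 \<inter> H2 \<subseteq> H3"
    proof (cases "c1 = 0 \<or> c2 = 0 \<or> j1 = j2")
      case True
      have "\<not> (c1 = 0 \<and> c2 = 0)" "j1 = j2 \<Longrightarrow> c1 \<noteq> c2" using H12 1 2 by auto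
      with True consider "c1 = 0" "c2 \<noteq> 0" | "c2 = 0" "c1 \<noteq> 0" | "c1 \<noteq> 0" "c2 \<noteq> 0" "j1 = j2" "c1 \<noteq> c2" by blast
      then show ?thesis
      proof cases
        case a: 1
        then have "H1 \<inter> H2 \<subseteq> {u. x j2 u = 0}" using eqs by fastforce
        then show ?thesis using X[of j2] 2(1) a by blast
      next
        case a: 2
        then have "H1 \<inter> H2 \<subseteq> {u. x j1 u = 0}" using eqs by fastforce
        then show ?thesis using X[of j1] 1(1) a by blast
      next
        case a: 3
        then have "H1 \<inter> H2 \<subseteq> {u. x j1 u = 0}" using eqs by fastforce
        then show ?thesis using X[of j1] 1(1) a by blast
      qed
    next
      case False
      then have c: "c1 \<noteq> 0" "c2 \<noteq> 0" "j1 < k" "j2 < k" "c1 ^ r = 1" "c2 ^ r = 1" "j1 \<noteq> j2" using 1(1) 2(1) by auto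
      then have "H1 \<inter> H2 \<subseteq> {u. x j1 u - (c2 / c1) * x j2 u = 0}" using eqs by (auto simp: field_simps)
      moreover have "(c2 / c1) ^ r = 1" using c by (simp add: power_divide)
      then have "{u. x j1 u - (c2 / c1) * x j2 u = 0} \<in> std_arr k x r" unfolding std_arr_def using c by blast
      ultimately show ?thesis by blast
    qed
  qed
  then show ?case using eq by simp
qed

lemma sw_arr:
  assumes x: "coords U C l e x" and ij: "i < l" "j < l" "i \<noteq> j" "z \<noteq> 0" and g: "sw e x i j z \<in> G"
  shows "{u. x i u - z * x j u = 0} \<in> arr G"
proof (rule arrI)
  show "lform (\<lambda>u. x i u - z * x j u)" using coords_lform[OF x] ij by (intro lform_diff_scaled) auto
  show "x i (e i) - z * x j (e i) \<noteq> 0" using coords_dual[OF x] ij by simp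
  have "x i ((1 / z) *s e j - e i) = - 1" using ij by (simp add: lform_simps[OF coords_lform[OF x]] coords_dual[OF x])
  then show "(1 / z) *s e j - e i \<noteq> 0" using lform_0[OF coords_lform[OF x ij(1)]] by force
  show "(\<lambda>u. u + (x i u - z * x j u) *s ((1 / z) *s e j - e i)) \<in> G" using g by (simp add: sw_def[abs_def])
qed

lemma e_nz: "coords U C l e x \<Longrightarrow> i < l \<Longrightarrow> e i \<noteq> 0"
  using coords_dual[of U C l e x i i] lform_0[OF coords_lform[of U C l e x i]] by force

lemma dg_arr:
  assumes x: "coords U C l e x" and i: "i < l" and t: "t \<noteq> 1" and g: "dg e x i t \<in> G"
  shows "{u. x i u = 0} \<in> arr G"
  by (rule arrI[OF coords_lform[OF x i], of "e i" "(t - 1) *s e i"])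
    (use coords_dual[OF x] i t g e_nz[OF x i] in \<open>auto simp: dg_def[abs_def]\<close>)

lemma sg_arr:
  assumes x: "coords U C l e x" and i: "i < l" and g: "sg l e x i \<in> G"
  shows "{u. x i u = 0} \<in> arr G"
proof (rule arrI[OF coords_lform[OF x i], of "e i" "- e i - (\<Sum>j<l. e j)"])
  show "x i (e i) \<noteq> 0" using coords_dual[OF x] i by simp
  have "x i (- e i - (\<Sum>j<l. e j)) = - 2" using i by (simp add: lform_simps[OF coords_lform[OF x]] coords_dual[OF x])
  then show "- e i - (\<Sum>j<l. e j) \<noteq> 0" using lform_0[OF coords_lform[OF x i]] by force
  show "(\<lambda>u. u + x i u *s (- e i - (\<Sum>j<l. e j))) \<in> G" using g by (simp add: sg_def[abs_def])
qed

lemma form_eqI: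
  assumes x: "coords U C l e x" and f: "lform f" "\<And>c. c \<in> C \<Longrightarrow> f c = 0" and g: "lform g" "\<And>c. c \<in> C \<Longrightarrow> g c = 0"
    and "\<And>k. k < l \<Longrightarrow> f (e k) = g (e k)"
  shows "f = g"
proof -
  have "f = comb l x (\<lambda>i. f (e i))" by (rule form_comb[OF x f])
  also have "\<dots> = comb l x (\<lambda>i. g (e i))" using assms(6) by (rule comb_cong)
  also have "\<dots> = g" by (rule form_comb[OF x g, symmetric])
  finally show ?thesis .
qed

text \<open>A reflection in the group is monomial, so f(e_k) v = d_k e_(\<sigma> k) - e_k for every
  k. At an index where \<open>f\<close> does not vanish this determines everything: either \<sigma>
  fixes \<open>k\<close> and \<open>f\<close> is a multiple of x_k, or \<sigma> exchanges
  \<open>k\<close> with some \<open>i\<close> and \<open>f\<close> is a multiple of x_k - d_i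
  x_i.\<close>

lemma arr_monomial:
  assumes x: "coords U C l e x" and G: "G = mcl (swaps l e x r \<union> diags l e x m)" and m: "m dvd r" "2 \<le> m" "0 < r" and l: "0 < l"
  shows "arr G = std_arr l x r"
proof (intro subset_antisym subsetI)
  fix H assume "H \<in> std_arr l x r"
  then consider i where "i < l" "H = {u. x i u = 0}"
      | i j z where "i < l" "j < l" "i \<noteq> j" "z ^ r = 1" "H = {u. x i u - z * x j u = 0}"
      unfolding std_arr_def by blast
  then show "H \<in> arr G"
  proof cases
    case 1
    have "card {z::complex. z ^ m = 1} = m" using m by (simp add: card_roots_unity_eq)
    then have "\<not> {z::complex. z ^ m = 1} \<subseteq> {1}" using m card_mono[of "{1::complex}" "{z. z ^ m = 1}"] by auto
    then obtain t :: complex where t: "t ^ m = 1" "t \<noteq> 1" by auto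
    have "dg e x i t \<in> G" unfolding G using t 1 by (intro mcl_incl) (auto simp: diags_def)
    then show ?thesis using dg_arr[OF x 1(1) t(2)] 1 by simp
  next
    case 2
    have "z \<noteq> 0" using 2 m by (auto simp: power_0_left)
    moreover have "sw e x i j z \<in> G" unfolding G using 2 by (intro mcl_incl) (auto simp: swaps_def)
    ultimately show ?thesis using sw_arr[OF x 2(1-3)] 2 by simp
  qed
next
  fix H assume "H \<in> arr G"
  then obtain f v where f: "lform f" "\<exists>u. f u \<noteq> 0" "v \<noteq> 0" "(\<lambda>u. u + f u *s v) \<in> G" "H = {u. f u = 0}" by (rule arrE)
  have fC: "f c = 0" if "c \<in> C" for c using root_in_U(2)[OF f(4,1,2,3) that] .
  have "(\<lambda>u. u + f u *s v) \<in> mons l e x r m" using f(4) G mcl_mons[OF x m(1,3) l] by simp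
  then obtain \<sigma> d where s: "\<sigma> permutes {..<l}" "\<And>j. j < l \<Longrightarrow> d j ^ r = 1" "(\<lambda>u. u + f u *s v) = mon l e x \<sigma> d"
    unfolding mons_def by auto
  have sl: "\<sigma> j < l" if "j < l" for j using permutes_in_image[OF s(1)] that by auto
  have fe: "f (e k) *s v = d k *s e (\<sigma> k) - e k" if "k < l" for k
    using fun_cong[OF s(3), of "e k"] mon_e[OF x that, of \<sigma> d] by (metis add_diff_cancel_left')
  have fex: "f (e k) * x a v = d k * (if a = \<sigma> k then 1 else 0) - (if a = k then 1 else 0)" if "k < l" "a < l" for a k
    using arg_cong[OF fe[OF that(1)], of "x a"] that sl
    by (simp add: lform_simps[OF coords_lform[OF x]] coords_dual[OF x])
  obtain k where k: "k < l" "f (e k) \<noteq> 0"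
  proof -
    have "\<exists>k<l. f (e k) \<noteq> 0"
    proof (rule ccontr)
      assume n: "\<not> ?thesis"
      have "f = (\<lambda>_. 0)" by (rule form_eqI[OF x f(1) fC]) (use n in \<open>auto simp: lform_def\<close>)
      then show False using f(2) by simp
    qed
    then show thesis using that by blast
  qed
  show "H \<in> std_arr l x r"
  proof (cases "\<sigma> k = k")
    case True
    have va: "x a v = 0" if "a < l" "a \<noteq> k" for a using fex[OF k(1) that(1)] True that k by simp
    have f0: "f (e j) = 0" if j: "j < l" "j \<noteq> k" for j
    proof -
      have "d j * (if j = \<sigma> j then 1 else 0) = 1" using fex[OF j(1) j(1)] va[OF j] by simp
      then have "\<sigma> j = j" "d j = 1" by (auto split: if_splits)
      then have "f (e j) *s v = 0" using fe[OF j(1)] by simp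
      then show ?thesis using f(3) by simp
    qed
    have "f = (\<lambda>u. f (e k) * x k u)"
      by (rule form_eqI[OF x f(1) fC])
        (use k f0 x coords_dual[OF x] in \<open>auto simp: lform_def lform_simps[OF coords_lform[OF x]] algebra_simps coords_def\<close>)
    then have "f u = 0 \<longleftrightarrow> x k u = 0" for u
      using k(2) by (metis mult_eq_0_iff)
    then have "H = {u. x k u = 0}" unfolding f(5) by simp
    then show ?thesis using k(1) unfolding std_arr_def by blast
  next
    case False
    define i where "i = \<sigma> k"
    have i: "i < l" "i \<noteq> k" "\<sigma> k = i" using sl k False by (auto simp: i_def)
    have va: "x a v = 0" if "a < l" "a \<noteq> k" "a \<noteq> i" for a using fex[OF k(1) that(1)] i that k by simp
    have fx: "\<sigma> j = j \<and> f (e j) = 0" if j: "j < l" "j \<noteq> k" "j \<noteq> i" for j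
    proof -
      have "d j * (if j = \<sigma> j then 1 else 0) = 1" using fex[OF j(1) j(1)] va[OF j] by simp
      then have "\<sigma> j = j" "d j = 1" by (auto split: if_splits)
      then have "f (e j) *s v = 0" using fe[OF j(1)] by simp
      then show ?thesis using f(3) \<open>\<sigma> j = j\<close> by simp
    qed
    \<comment> \<open>If the image of \<open>i\<close> were a third index, it would be fixed by
      \<open>fx\<close>, against injectivity.\<close>
    have si: "\<sigma> i = k"
    proof (rule ccontr)
      assume n: "\<sigma> i \<noteq> k"
      have "\<sigma> i \<noteq> i" using permutes_inj[OF s(1)] i by (metis injD)
      then have "\<sigma> (\<sigma> i) = \<sigma> i" using fx[OF sl[OF i(1)] n] by blast
      then have "\<sigma> i = i" using permutes_inj[OF s(1)] by (metis injD)
      then show False using \<open>\<sigma> i \<noteq> i\<close> by blast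
    qed
    \<comment> \<open>Comparing k-th coordinates at e_k and at e_i gives the ratio of the two
      entries of \<open>f\<close>.\<close>
    have fk: "f (e k) * x k v = - 1" using fex[OF k(1) k(1)] i by simp
    have "f (e i) * x k v = d i" using fex[OF i(1) k(1)] i si by simp
    then have "- d i * f (e k) = - f (e i) * (f (e k) * x k v)" by (simp add: algebra_simps flip: \<open>_ = d i\<close>)
    then have fi: "f (e i) = - d i * f (e k)" using fk by simp
    have "f = (\<lambda>u. f (e k) * (x k u - d i * x i u))"
      by (rule form_eqI[OF x f(1) fC])
        (use k i fi fx x coords_dual[OF x] in \<open>auto simp: lform_def lform_simps[OF coords_lform[OF x]] algebra_simps coords_def\<close>)
    then have "f u = 0 \<longleftrightarrow> x k u - d i * x i u = 0" for u
      using k(2) by (metis mult_eq_0_iff)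
    then have "H = {u. x k u - d i * x i u = 0}" unfolding f(5) by simp
    then show ?thesis using k(1) i(1) i(2)[symmetric] s(2)[OF i(1)] unfolding std_arr_def by auto
  qed
qed

text \<open>The group permutes l + 1 vectors, and a reflection among these permutations is a
  transposition; its hyperplane equates two of l + 1 coordinates, the last of which is set to
  0.\<close>

lemma arr_type_A:
  assumes x: "coords U C l e x" and G: "G = mcl (swaps l e x 1 \<union> sg l e x ` {..<l})" and l: "3 \<le> l"
  shows "arr G = std_arr l x 1"
proof (intro subset_antisym subsetI)
  fix H assume "H \<in> std_arr l x 1"
  then consider i where "i < l" "H = {u. x i u = 0}"
      | i j where "i < l" "j < l" "i \<noteq> j" "H = {u. x i u - 1 * x j u = 0}"
      unfolding std_arr_def by (auto simp del: mult_1)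
  then show "H \<in> arr G"
  proof cases
    case 1
    have "sg l e x i \<in> G" unfolding G using 1 by (intro mcl_incl) auto
    then show ?thesis using sg_arr[OF x] 1 by simp
  next
    case 2
    have "sw e x i j 1 \<in> G" unfolding G using 2 by (intro mcl_incl) (auto simp: swaps_def)
    then show ?thesis using sw_arr[OF x 2(1-3), of 1] 2(4) by simp
  qed
next
  \<comment> \<open>\<open>G\<close> permutes the \<open>l + 1\<close> vectors \<open>E j\<close>, whose sum is zero.\<close>
  define E where "E j = (if j < l then e j else - (\<Sum>j<l. e j))" for j
  \<comment> \<open>The additional index \<open>l\<close> gets the coordinate 0. As the vectors
    \<open>E j\<close> sum to zero, it is only the differences \<open>xx a - xx b\<close> that take
    the expected dual values on them.\<close>
  define xx where "xx a u = (if a < l then x a u else 0)" for a u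
  have xxl: "lform (xx a)" for a using coords_lform[OF x] by (cases "a < l") (auto simp: xx_def[abs_def] lform_def)
  have xxE: "xx a (E j) - xx b (E j) = (if a = j then 1 else 0) - (if b = j then 1 else 0)"
    if "a \<le> l" "b \<le> l" "j \<le> l" for a b j
    using that by (auto simp: xx_def E_def lform_simps[OF coords_lform[OF x]] coords_dual[OF x])
  have swS: "sw e x i j 1 (\<Sum>k<l. e k) = (\<Sum>k<l. e k)" if ij: "i < l" "j < l" "i \<noteq> j" for i j
  proof -
    have "x i (\<Sum>k<l. e k) - 1 * x j (\<Sum>k<l. e k) = 0"
      using ij by (simp add: lform_simps[OF coords_lform[OF x]] coords_dual[OF x])
    then show ?thesis by (simp add: sw_def)
  qed
  have sgS: "sg l e x i (\<Sum>k<l. e k) = - e i" if i: "i < l" for i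
    using i by (simp add: sg_def lform_simps[OF coords_lform[OF x]] coords_dual[OF x])
  have perm: "\<exists>\<sigma>. inj_on \<sigma> {..l} \<and> \<sigma> ` {..l} \<subseteq> {..l} \<and> (\<forall>j\<le>l. g (E j) = E (\<sigma> j))" if "g \<in> G" for g
    using that unfolding G
  proof (induction rule: mcl.induct)
    case id show ?case by (rule exI[of _ id]) auto
  next
    case (step s g)
    then obtain \<sigma> where s: "inj_on \<sigma> {..l}" "\<sigma> ` {..l} \<subseteq> {..l}" "\<And>j. j \<le> l \<Longrightarrow> g (E j) = E (\<sigma> j)" by blast
    have "\<exists>i j. i \<le> l \<and> j \<le> l \<and> (\<forall>k\<le>l. s (E k) = E (transpose i j k))"
    proof -
      from step(1) consider i j where "i < l" "j < l" "i \<noteq> j" "s = sw e x i j 1" | i where "i < l" "s = sg l e x i"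
        by (auto simp: swaps_def)
      then show ?thesis
      proof cases
        case 1
        then show ?thesis
          by (intro exI[of _ i] exI[of _ j])
            (auto simp: E_def sw_e[OF x] transpose_def lin_neg[OF lin_sw[OF x]] swS)
      next
        case 2
        then show ?thesis
          by (intro exI[of _ i] exI[of _ l])
            (auto simp: E_def sg_e[OF x] transpose_def lin_neg[OF lin_sg[OF x]] sgS)
      qed
    qed
    then obtain i j where ij: "i \<le> l" "j \<le> l" "\<And>k. k \<le> l \<Longrightarrow> s (E k) = E (transpose i j k)" by blast
    have "inj_on (transpose i j \<circ> \<sigma>) {..l}" using s(1) by (intro comp_inj_on) auto
    moreover have "(transpose i j \<circ> \<sigma>) ` {..l} \<subseteq> {..l}" using s(2) ij by (auto simp: transpose_def)
    moreover have "\<forall>k\<le>l. (s \<circ> g) (E k) = E ((transpose i j \<circ> \<sigma>) k)" using s(2,3) ij(3) by auto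
    ultimately show ?case by blast
  qed
  fix H assume "H \<in> arr G"
  then obtain f v where f: "lform f" "\<exists>u. f u \<noteq> 0" "v \<noteq> 0" "(\<lambda>u. u + f u *s v) \<in> G" "H = {u. f u = 0}" by (rule arrE)
  have fC: "f c = 0" if "c \<in> C" for c using root_in_U(2)[OF f(4,1,2,3) that] .
  obtain \<sigma> where s: "inj_on \<sigma> {..l}" "\<sigma> ` {..l} \<subseteq> {..l}" "\<And>j. j \<le> l \<Longrightarrow> E j + f (E j) *s v = E (\<sigma> j)"
    using perm[OF f(4)] by auto
  have sl: "\<sigma> j \<le> l" if "j \<le> l" for j using s(2) that by auto
  have fE: "f (E j) *s v = E (\<sigma> j) - E j" if "j \<le> l" for j using s(3)[OF that] by (metis add_diff_cancel_left')
  have fEx: "f (E j) * (xx a v - xx b v) = (xx a (E (\<sigma> j)) - xx b (E (\<sigma> j))) - (xx a (E j) - xx b (E j))" if "j \<le> l" for j a b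
    using arg_cong[OF fE[OF that], of "xx a"] arg_cong[OF fE[OF that], of "xx b"]
    by (simp add: lform_simps[OF xxl] right_diff_distrib)
  obtain k where k: "k \<le> l" "f (E k) \<noteq> 0"
  proof -
    have "\<exists>k<l. f (e k) \<noteq> 0"
    proof (rule ccontr)
      assume n: "\<not> ?thesis"
      have "f = (\<lambda>_. 0)" by (rule form_eqI[OF x f(1) fC]) (use n in \<open>auto simp: lform_def\<close>)
      then show False using f(2) by simp
    qed
    then obtain k where "k < l" "f (e k) \<noteq> 0" by blast
    then show thesis using that[of k] by (simp add: E_def)
  qed
  define i where "i = \<sigma> k"
  have i: "i \<le> l" "\<sigma> k = i" using sl k by (auto simp: i_def)
  have ik: "i \<noteq> k"
  proof
    assume "i = k"
    then have "f (E k) *s v = 0" using fE[OF k(1)] i by simp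
    then show False using f(3) k by simp
  qed
  have va: "xx a v = xx b v" if "a \<le> l" "b \<le> l" "a \<noteq> i" "a \<noteq> k" "b \<noteq> i" "b \<noteq> k" for a b
    using fEx[OF k(1), of a b] xxE[OF that(1,2) i(1)] xxE[OF that(1,2) k(1)] that k i by simp
  have fx: "\<sigma> j = j \<and> f (E j) = 0" if j: "j \<le> l" "j \<noteq> k" "j \<noteq> i" for j
  proof -
    have "\<sigma> j = j"
    proof (rule ccontr)
      assume sj: "\<sigma> j \<noteq> j"
      \<comment> \<open>There are l + 1 \<ge> 4 indices, so one outside {i, k, j} exists;
        \<open>\<sigma> j\<close> is taken where possible. The root has equal coordinates at
        \<open>j\<close> and \<open>t\<close>, which prevents the reflection from moving
        \<open>E j\<close>.\<close>
      obtain t where t: "t \<le> l" "t \<noteq> i" "t \<noteq> k" "t \<noteq> j" "\<sigma> j \<noteq> i \<and> \<sigma> j \<noteq> k \<longrightarrow> t = \<sigma> j"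
      proof (cases "\<sigma> j \<noteq> i \<and> \<sigma> j \<noteq> k")
        case True then show thesis using that[of "\<sigma> j"] sl[OF j(1)] sj by auto
      next
        case False
        have "card {i, k, j} < card {..l}" using l by (simp add: card_insert_if)
        then have "\<exists>t\<in>{..l}. t \<notin> {i, k, j}" by (meson card_mono finite.emptyI finite.insertI not_le subsetI)
        then show thesis using that False by auto
      qed
      have "xx j v = xx t v" using va[OF j(1) t(1)] j t by blast
      then have "(xx j (E (\<sigma> j)) - xx t (E (\<sigma> j))) = (xx j (E j) - xx t (E j))" using fEx[OF j(1), of j t] by simp
      then show False using xxE[OF j(1) t(1) sl[OF j(1)]] xxE[OF j(1) t(1) j(1)] sj t
        by (auto split: if_splits)
    qed
    moreover from this have "f (E j) *s v = 0" using fE[OF j(1)] by simp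
    ultimately show ?thesis using f(3) by simp
  qed
  have si: "\<sigma> i = k"
  proof (rule ccontr)
    assume n: "\<sigma> i \<noteq> k"
    have i1: "\<sigma> i \<noteq> i" using inj_onD[OF s(1), of i k] i k ik by auto
    then have "\<sigma> (\<sigma> i) = \<sigma> i" using fx[OF sl[OF i(1)] n] by blast
    then show False using inj_onD[OF s(1), of "\<sigma> i" i] sl[OF i(1)] i(1) i1 by auto
  qed
  have fi: "f (E i) = - f (E k)"
  proof -
    have "f (E i) *s v = E k - E i" "f (E k) *s v = E i - E k" using fE[OF i(1)] fE[OF k(1)] i si by auto
    then have "(f (E i) + f (E k)) *s v = 0" by (simp add: scale_left_distrib)
    then show ?thesis using f(3) by (simp add: add_eq_0_iff2)
  qed
  have ff: "f = (\<lambda>u. f (E k) * (xx k u - xx i u))"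
  proof (rule form_eqI[OF x f(1) fC])
    show "lform (\<lambda>u. f (E k) * (xx k u - xx i u))" by (auto simp: lform_def lform_simps[OF xxl] algebra_simps)
    show "f (E k) * (xx k c - xx i c) = 0" if "c \<in> C" for c using that x by (auto simp: xx_def coords_def)
    fix j assume j: "j < l"
    then have Ej: "E j = e j" by (simp add: E_def)
    have "f (E j) = f (E k) * ((if k = j then 1 else 0) - (if i = j then 1 else 0))"
      using fx[of j] fi ik j by (cases "j = k"; cases "j = i") auto
    then show "f (e j) = f (E k) * (xx k (e j) - xx i (e j))" using xxE[OF k(1) i(1), of j] j Ej by simp
  qed
  have "f u = 0 \<longleftrightarrow> xx k u - xx i u = 0" for u
    using fun_cong[OF ff, of u] k(2) by (metis mult_eq_0_iff)
  then have "H = {u. xx k u - xx i u = 0}" unfolding f(5) by simp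
  moreover have "\<not> (k = l \<and> i = l)" using ik by blast
  \<comment> \<open>One of \<open>k\<close> and \<open>i\<close> may be the additional index; this
    is the source of the coordinate hyperplanes.\<close>
  ultimately consider "k < l" "i < l" "H = {u. x k u - 1 * x i u = 0}" | "k < l" "H = {u. x k u = 0}" | "i < l" "H = {u. x i u = 0}"
    using k i by (cases "k < l"; cases "i < l") (auto simp: xx_def)
  then show "H \<in> std_arr l x 1"
  proof cases
    case 1 then show ?thesis unfolding std_arr_def using ik by (intro UnI2 CollectI exI[of _ k] exI[of _ i] exI[of _ 1]) auto
  qed (auto simp: std_arr_def)
qed

text \<open>Modulo \<open>C\<close> the space has dimension at most two, so distinct members of the
  arrangement meet in \<open>C\<close>; one hyperplane followed by all the others gives two
  levels.\<close>

lemma ss_dim_le_2: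
  assumes "dim U \<le> 2" shows "ss (arr G)"
proof (cases "arr G = {}")
  case True then show ?thesis using ss.empty by simp
next
  case False
  then obtain H0 where H0: "H0 \<in> arr G" by blast
  have ne: "\<not> UNIV \<subseteq> H" if "hyp H" for H using that by (auto simp: hyp_def)
  have "ss ({} \<union> {H0})" by (rule ss.step[OF ss.empty]) (use arr_hyp H0 ne in auto)
  then have 1: "ss {H0}" by simp
  show ?thesis
  proof (cases "arr G = {H0}")
    case True then show ?thesis using 1 by simp
  next
    case False
    have "ss ({H0} \<union> (arr G - {H0}))"
    proof (rule ss.step[OF 1])
      show "arr G - {H0} \<noteq> {}" using False H0 by blast
      fix H assume H: "H \<in> arr G - {H0}"
      then show hH: "hyp H" using arr_hyp by blast
      show "\<not> \<Inter>{H0} \<subseteq> H" using hyp_subset_eq[OF arr_hyp[OF H0] hH] H by auto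
    next
      fix H1 H2 assume H: "H1 \<in> arr G - {H0}" "H2 \<in> arr G - {H0}" "H1 \<noteq> H2"
      then have h: "hyp H1" "hyp H2" "C \<subseteq> H1" "C \<subseteq> H2" "C \<subseteq> H0" using arr_hyp arr_C H0 by auto
      have "H1 \<inter> H2 \<subseteq> H0"
      proof (rule ccontr)
        assume "\<not> ?thesis"
        then obtain w where w: "w \<in> H1" "w \<in> H2" "w \<notin> H0" by blast
        obtain u c where u: "u \<in> U" "c \<in> C" "w = u + c" using UC_sum by blast
        have uw: "u = w - c" using u by simp
        have uH: "u \<in> H1" "u \<in> H2" unfolding uw using w u h subspace_diff hyp_subspace by blast+
        have u0: "u \<noteq> 0" using u w h by auto
        \<comment> \<open>By dimension, a hyperplane through \<open>C\<close> and \<open>u\<close>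
          meets \<open>U\<close> in the line of \<open>u\<close> only.\<close>
        have line: "H \<inter> U \<subseteq> span {u}" if H: "hyp H" "C \<subseteq> H" "u \<in> H" for H
        proof -
          have "\<not> U \<subseteq> H"
          proof
            assume "U \<subseteq> H"
            then have "v \<in> H" for v using UC_sum[of v] H hyp_subspace subspace_add by blast
            then show False using ne[OF H(1)] by blast
          qed
          then have "dim (U \<inter> H) + 1 = dim U" using dim_Int_hyp[OF subU H(1)] by blast
          then have "dim (U \<inter> H) \<le> dim (span {u})" using assms u0 by simp
          moreover have "span {u} \<subseteq> U \<inter> H"
            using u(1) H(3) subU hyp_subspace[OF H(1)] by (intro span_minimal) (auto simp: subspace_inter)
          ultimately show ?thesis
            using subspace_dim_equal[of "span {u}" "U \<inter> H"] subU hyp_subspace[OF H(1)] by (auto simp: subspace_inter)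
        qed
        have "H1 \<subseteq> H2"
        proof
          fix a assume a: "a \<in> H1"
          obtain b c where b: "b \<in> U" "c \<in> C" "a = b + c" using UC_sum by blast
          have "b = a - c" using b by simp
          then have "b \<in> H1" using a b h subspace_diff hyp_subspace by blast
          then have "b \<in> span {u}" using line[OF h(1,3) uH(1)] b by blast
          then have "b \<in> H2" using span_minimal[of "{u}" H2] uH(2) hyp_subspace[OF h(2)] by blast
          then show "a \<in> H2" using b h(4) hyp_subspace[OF h(2)] subspace_add by blast
        qed
        then show False using hyp_subset_eq[OF h(1,2)] H by blast
      qed
      then show "\<exists>H3\<in>{H0}. H1 \<inter> H2 \<subseteq> H3" by blast
    qed
    then show ?thesis using H0 by (simp add: insert_absorb)
  qed
qed

end

section \<open>Decomposition into irreducible factors\<close>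

context cspace
begin

lemma GL_carrier_iff: "k \<in> carrier (GL scale U) \<longleftrightarrow> k \<in> extensional U \<and> bij_betw k U U \<and>
    (\<forall>x\<in>U. \<forall>y\<in>U. k (x + y) = k x + k y) \<and> (\<forall>c. \<forall>x\<in>U. k (c *s x) = c *s k x)"
  by (auto simp: GL_def Bij_def)

lemma GL_UNIV_iff: "g \<in> carrier (GL scale UNIV) \<longleftrightarrow> bij g \<and> lin g"
  by (auto simp: GL_carrier_iff lin_def)

lemma GL_mult: "g \<in> carrier (GL scale U) \<Longrightarrow> h \<in> carrier (GL scale U) \<Longrightarrow> g \<otimes>\<^bsub>GL scale U\<^esub> h = compose U g h"
  by (auto simp: GL_def BijGroup_def)

lemma GL_one: "\<one>\<^bsub>GL scale U\<^esub> = (\<lambda>x\<in>U. x)"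
  by (auto simp: GL_def BijGroup_def)

lemma group_GL: assumes U: "subspace U" shows "group (GL scale U)"
proof -
  have "subgroup (carrier (GL scale U)) (BijGroup U)"
  proof (rule group.subgroupI[OF group_BijGroup])
    show "carrier (GL scale U) \<subseteq> carrier (BijGroup U)" by (auto simp: GL_def BijGroup_def)
    have "(\<lambda>x\<in>U. x) \<in> carrier (GL scale U)"
      using U id_Bij by (auto simp: GL_def subspace_add subspace_scale)
    then show "carrier (GL scale U) \<noteq> {}" by blast
    fix g assume g: "g \<in> carrier (GL scale U)"
    then have gB: "g \<in> Bij U" and add: "\<And>x y. x \<in> U \<Longrightarrow> y \<in> U \<Longrightarrow> g (x + y) = g x + g y"
      and scl: "\<And>c x. x \<in> U \<Longrightarrow> g (c *s x) = c *s g x" by (auto simp: GL_def)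
    have bij: "bij_betw g U U" using gB by (simp add: Bij_def)
    let ?h = "inv_into U g"
    have hU: "?h x \<in> U" "g (?h x) = x" if "x \<in> U" for x
      using that bij_betw_imp_surj_on[OF bij] by (auto intro: inv_into_into f_inv_into_f)
    have hg: "?h (g x) = x" if "x \<in> U" for x using that bij_betw_imp_inj_on[OF bij] by simp
    have "?h (x + y) = ?h x + ?h y" if "x \<in> U" "y \<in> U" for x y
      using hg[of "?h x + ?h y"] add[OF hU(1)[OF that(1)] hU(1)[OF that(2)]] hU that U by (simp add: subspace_add)
    moreover have "?h (c *s x) = c *s ?h x" if "x \<in> U" for x c
      using hg[of "c *s ?h x"] scl[OF hU(1)[OF that]] hU that U by (simp add: subspace_scale)
    ultimately show "inv\<^bsub>BijGroup U\<^esub> g \<in> carrier (GL scale U)"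
      unfolding inv_BijGroup[OF gB] using restrict_inv_into_Bij[OF gB] U
      by (auto simp: GL_def subspace_add subspace_scale)
    fix h assume h: "h \<in> carrier (GL scale U)"
    have hf: "h x \<in> U" if "x \<in> U" for x using h that by (auto simp: GL_carrier_iff bij_betw_def)
    show "g \<otimes>\<^bsub>BijGroup U\<^esub> h \<in> carrier (GL scale U)"
      using g h hf compose_Bij[of g U h] U by (auto simp: GL_def BijGroup_def compose_def subspace_add subspace_scale)
  qed
  then have "group ((BijGroup U)\<lparr>carrier := carrier (GL scale U)\<rparr>)"
    by (rule subgroup.subgroup_is_group[OF _ group_BijGroup])
  then show ?thesis by (simp add: GL_def)
qed

lemma GL_UNIV_mult: "g \<in> carrier (GL scale UNIV) \<Longrightarrow> h \<in> carrier (GL scale UNIV) \<Longrightarrow> g \<otimes>\<^bsub>GL scale UNIV\<^esub> h = g \<circ> h"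
  by (auto simp: GL_mult compose_def)

lemma GL_UNIV_one: "\<one>\<^bsub>GL scale UNIV\<^esub> = id"
  by (auto simp: GL_one)

lemma GL_UNIV_inv: assumes g: "g \<in> carrier (GL scale UNIV)" shows "inv\<^bsub>GL scale UNIV\<^esub> g = inv_into UNIV g"
proof (rule group.inv_equality[OF group_GL[OF subspace_UNIV]])
  have gg: "bij g" "lin g" using g by (auto simp: GL_UNIV_iff)
  then show h: "inv_into UNIV g \<in> carrier (GL scale UNIV)" by (auto simp: GL_UNIV_iff bij_imp_bij_inv lin_inv)
  show "inv_into UNIV g \<otimes>\<^bsub>GL scale UNIV\<^esub> g = \<one>\<^bsub>GL scale UNIV\<^esub>"
    unfolding GL_UNIV_mult[OF h g] GL_UNIV_one using gg by (simp add: bij_is_inj)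
qed (rule g)

text \<open>By finiteness two powers with different exponents coincide, and cancellation leaves a
  positive exponent yielding the identity.\<close>

lemma finite_subgroup_order:
  assumes G: "group G" and W: "subgroup W G" "finite W" and g: "g \<in> W"
  shows "\<exists>n::nat. n > 0 \<and> g [^]\<^bsub>G\<^esub> n = \<one>\<^bsub>G\<^esub>"
proof -
  interpret group G by (rule G)
  have gc: "g \<in> carrier G" using W(1) g subgroup.mem_carrier by metis
  have "g [^]\<^bsub>G\<^esub> (n::nat) \<in> W" for n
    by (induction n) (use W(1) g in \<open>auto simp: subgroup.one_closed subgroup.m_closed\<close>)
  then have "range (\<lambda>n::nat. g [^]\<^bsub>G\<^esub> n) \<subseteq> W" by blast
  then have "\<not> inj (\<lambda>n::nat. g [^]\<^bsub>G\<^esub> n)"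
    using W(2) finite_subset range_inj_infinite by blast
  then obtain i j :: nat where ij: "i < j" "g [^]\<^bsub>G\<^esub> i = g [^]\<^bsub>G\<^esub> j"
    by (metis injI linorder_neqE_nat)
  have "g [^]\<^bsub>G\<^esub> j = g [^]\<^bsub>G\<^esub> i \<otimes>\<^bsub>G\<^esub> g [^]\<^bsub>G\<^esub> (j - i)" using ij(1) gc by (simp add: nat_pow_mult)
  then have "g [^]\<^bsub>G\<^esub> (j - i) = \<one>\<^bsub>G\<^esub>" using ij gc by (metis l_cancel_one' nat_pow_closed)
  then show ?thesis using ij(1) by (intro exI[of _ "j - i"]) auto
qed

text \<open>Elements of a finite group have finite order, so being a reflection amounts to fixing a
  hyperplane of \<open>U\<close>. The root is the displacement of a vector \<open>w\<close> off this
  hyperplane, divided by \<open>f w\<close>.\<close>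

lemma is_reflection_iff:
  assumes U: "subspace U" and W: "subgroup W (GL scale U)" "finite W" and k: "k \<in> W"
  shows "is_reflection scale U k \<longleftrightarrow>
    (\<exists>f v. lform f \<and> (\<exists>u\<in>U. f u \<noteq> 0) \<and> v \<in> U \<and> v \<noteq> 0 \<and> (\<forall>u\<in>U. k u = u + f u *s v))" (is "?L \<longleftrightarrow> ?R")
proof -
  have kc: "k \<in> carrier (GL scale U)" using W(1) k subgroup.mem_carrier by metis
  have add: "k (x + y) = k x + k y" if "x \<in> U" "y \<in> U" for x y using kc that by (simp add: GL_carrier_iff)
  have scl: "k (c *s x) = c *s k x" if "x \<in> U" for x c using kc that by (simp add: GL_carrier_iff)
  have kU: "k x \<in> U" if "x \<in> U" for x using kc that by (auto simp: GL_carrier_iff bij_betw_def)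
  have "?L \<longleftrightarrow> is_hyperplane scale U (fixed_by U k)"
    using kc finite_subgroup_order[OF group_GL[OF U] W k] by (simp add: is_reflection_def)
  also have "\<dots> \<longleftrightarrow> ?R"
  proof
    assume "is_hyperplane scale U (fixed_by U k)"
    then obtain f w where f: "lform f" "w \<in> U" "f w \<noteq> 0" and F: "fixed_by U k = {u \<in> U. f u = 0}"
      unfolding is_hyperplane_iff[OF U] by blast
    let ?v = "(1 / f w) *s (k w - w)"
    have "k u = u + f u *s ?v" if u: "u \<in> U" for u
    proof -
      let ?t = "f u / f w"
      have tw: "?t *s w \<in> U" "- (?t *s w) \<in> U" using U f(2) by (auto simp: subspace_scale subspace_neg)
      have "u - ?t *s w \<in> {u \<in> U. f u = 0}" using f u U tw by (auto simp: lform_simps subspace_diff)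
      then have fx: "k (u - ?t *s w) = u - ?t *s w" unfolding F[symmetric] fixed_by_def by simp
      have "k u = k ((u - ?t *s w) + ?t *s w)" by simp
      also have "\<dots> = k (u - ?t *s w) + ?t *s k w" using add[of "u - ?t *s w" "?t *s w"] scl[OF f(2)] u tw U by (simp add: subspace_diff)
      also have "\<dots> = u + f u *s ?v" unfolding fx by (simp add: scale_right_diff_distrib)
      finally show ?thesis .
    qed
    moreover have "?v \<noteq> 0"
    proof
      assume "?v = 0"
      then have "w \<in> fixed_by U k" using f by (simp add: fixed_by_def)
      then show False using F f by simp
    qed
    moreover have "?v \<in> U" using f kU U by (auto simp: subspace_diff subspace_scale)
    ultimately show ?R using f by blast
  next
    assume ?R
    then obtain f v where f: "lform f" "\<exists>u\<in>U. f u \<noteq> 0" "v \<noteq> 0" "\<And>u. u \<in> U \<Longrightarrow> k u = u + f u *s v" by blast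
    have "fixed_by U k = {u \<in> U. f u = 0}" unfolding fixed_by_def using f(3,4) by auto
    then show "is_hyperplane scale U (fixed_by U k)" unfolding is_hyperplane_iff[OF U] using f by blast
  qed
  finally show ?thesis .
qed

lemma is_reflection_UNIV:
  assumes "subgroup W (GL scale UNIV)" "finite W" "g \<in> W"
  shows "is_reflection scale UNIV g \<longleftrightarrow> reflection g"
  unfolding is_reflection_iff[OF subspace_UNIV assms] reflection_def by (auto simp: fun_eq_iff)

lemma reflection_arrangement_arr:
  assumes "subgroup W (GL scale UNIV)" "finite W"
  shows "reflection_arrangement scale W = arr W"
  unfolding reflection_arrangement_def arr_def fixed_by_def using is_reflection_UNIV[OF assms] by auto

end

section \<open>Direct sums and complements of summands\<close>

locale dsum = cspace scale Basis
  for scale :: "complex \<Rightarrow> 'v::ab_group_add \<Rightarrow> 'v" (infixr \<open>*s\<close> 75) and Basis :: "'v set" +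
  fixes F :: "'v set" and n :: nat and V :: "nat \<Rightarrow> 'v set"
  assumes dsd: "direct_sum_decomposition scale F n V"
begin

lemma subF: "subspace F" and subV: "i < n \<Longrightarrow> subspace (V i)"
  using dsd by (auto simp: direct_sum_decomposition_def)

lemma decompose: obtains f u where "f \<in> F" "\<And>i. i < n \<Longrightarrow> u i \<in> V i" "v = f + (\<Sum>i<n. u i)"
  using dsd unfolding direct_sum_decomposition_def by metis

lemma dsum_unique: "f \<in> F \<Longrightarrow> (\<And>i. i < n \<Longrightarrow> u i \<in> V i) \<Longrightarrow> f + (\<Sum>i<n. u i) = 0 \<Longrightarrow> f = 0 \<and> (\<forall>i<n. u i = 0)"
  using dsd unfolding direct_sum_decomposition_def by blast

lemma V_disjoint: assumes "i < n" "j < n" "i \<noteq> j" "v \<in> V i" "v \<in> V j" shows "v = 0"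
proof -
  define u where "u k = (if k = i then v else if k = j then - v else 0)" for k
  have "(\<Sum>k<n. u k) = (\<Sum>k<n. (if k = i then v else 0) + (if k = j then - v else 0))"
    using assms(3) by (intro sum.cong) (auto simp: u_def)
  also have "\<dots> = 0" using assms by (simp add: sum.distrib)
  finally have "0 + (\<Sum>k<n. u k) = 0" by simp
  moreover have "u k \<in> V k" if "k < n" for k using assms subV that by (auto simp: u_def subspace_neg subspace_0)
  ultimately have "\<forall>k<n. u k = 0" using dsum_unique[of 0 u] subspace_0[OF subF] by blast
  then show ?thesis using assms by (auto simp: u_def)
qed

lemma lin_eq_dsum:
  assumes "lin g" "lin h" "\<And>f. f \<in> F \<Longrightarrow> g f = h f" "\<And>i u. i < n \<Longrightarrow> u \<in> V i \<Longrightarrow> g u = h u"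
  shows "g = h"
proof
  fix v
  obtain f u where "f \<in> F" "\<And>i. i < n \<Longrightarrow> u i \<in> V i" "v = f + (\<Sum>i<n. u i)" using decompose by blast
  then show "g v = h v" using assms by (simp add: lin_simps)
qed

text \<open>The sum of \<open>F\<close> and all summands but the i-th; it serves as the complement
  \<open>C\<close> in \<open>refl_factor\<close>.\<close>

definition co :: "nat \<Rightarrow> 'v set" where
  "co i = {f + (\<Sum>j<n. u j) | f u. f \<in> F \<and> (\<forall>j<n. u j \<in> V j) \<and> u i = 0}"

lemma V_in_co: assumes "i < n" "j < n" "j \<noteq> i" shows "V j \<subseteq> co i"
proof
  fix v assume v: "v \<in> V j"
  define u where "u k = (if k = j then v else 0)" for k
  have "v = 0 + (\<Sum>k<n. u k)" using assms by (simp add: u_def)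
  moreover have "\<forall>k<n. u k \<in> V k" using v subV subspace_0 by (auto simp: u_def)
  moreover have "u i = 0" using assms by (simp add: u_def)
  ultimately show "v \<in> co i" unfolding co_def using subspace_0[OF subF] by blast
qed

lemma F_in_co: "F \<subseteq> co i"
proof
  fix f assume "f \<in> F"
  then show "f \<in> co i" unfolding co_def using subV subspace_0
    by (intro CollectI exI[of _ f] exI[of _ "\<lambda>_. 0"]) auto
qed

lemma co_subspace: "subspace (co i)"
  unfolding subspace_def
proof (intro conjI allI ballI)
  show "0 \<in> co i" using F_in_co subspace_0[OF subF] by blast
  fix a assume "a \<in> co i"
  then obtain f u where a: "f \<in> F" "\<forall>j<n. u j \<in> V j" "u i = 0" "a = f + (\<Sum>j<n. u j)" unfolding co_def by blast
  show "c *s a \<in> co i" for c unfolding co_def a(4) using a subF subV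
    by (intro CollectI exI[of _ "c *s f"] exI[of _ "\<lambda>j. c *s u j"]) (auto simp: scale_right_distrib scale_sum_right subspace_scale)
  fix b assume "b \<in> co i"
  then obtain f' u' where b: "f' \<in> F" "\<forall>j<n. u' j \<in> V j" "u' i = 0" "b = f' + (\<Sum>j<n. u' j)" unfolding co_def by blast
  show "a + b \<in> co i" unfolding co_def a(4) b(4) using a b subF subV
    by (intro CollectI exI[of _ "f + f'"] exI[of _ "\<lambda>j. u j + u' j"]) (auto simp: sum.distrib subspace_add algebra_simps)
qed

lemma V_co_sum: assumes "i < n" shows "\<exists>u\<in>V i. \<exists>c\<in>co i. v = u + c"
proof -
  obtain f u where u: "f \<in> F" "\<And>i. i < n \<Longrightarrow> u i \<in> V i" "v = f + (\<Sum>i<n. u i)" using decompose by blast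
  have "v = u i + (f + (\<Sum>j<n. (u(i := 0)) j))"
    using assms u(3) by (simp add: sum.remove[of "{..<n}" i])
  moreover have "f + (\<Sum>j<n. (u(i := 0)) j) \<in> co i" unfolding co_def
    using u subV[OF assms] subspace_0 by (intro CollectI exI[of _ f] exI[of _ "u(i := 0)"]) auto
  ultimately show ?thesis using u(2)[OF assms] by blast
qed

lemma V_co_Int: assumes "i < n" "v \<in> V i" "v \<in> co i" shows "v = 0"
proof -
  obtain f u where u: "f \<in> F" "\<forall>j<n. u j \<in> V j" "u i = 0" "v = f + (\<Sum>j<n. u j)" using assms(3) unfolding co_def by blast
  have "(\<Sum>j<n. (u(i := - v)) j) = - v + (\<Sum>j<n. u j)"
    using assms(1) u(3) by (simp add: sum.remove[of "{..<n}" i])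
  then have "f + (\<Sum>j<n. (u(i := - v)) j) = 0" using u(4) by (simp add: algebra_simps)
  moreover have "(u(i := - v)) j \<in> V j" if "j < n" for j
    using u(2) that subspace_neg[OF subV[OF assms(1)] assms(2)] by (cases "j = i") auto
  ultimately have "(u(i := - v)) i = 0" using dsum_unique[OF u(1), of "u(i := - v)"] assms(1) by blast
  then show ?thesis by simp
qed

lemma co_trivial:
  assumes "lin g" "\<And>f. f \<in> F \<Longrightarrow> g f = f" "\<And>j u. j < n \<Longrightarrow> j \<noteq> i \<Longrightarrow> u \<in> V j \<Longrightarrow> g u = u" "c \<in> co i"
  shows "g c = c"
proof -
  obtain f u where u: "f \<in> F" "\<forall>j<n. u j \<in> V j" "u i = 0" "c = f + (\<Sum>j<n. u j)" using assms(4) unfolding co_def by blast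
  have "g (u j) = u j" if "j < n" for j using assms(3)[of j "u j"] u that lin_0[OF assms(1)] by (cases "j = i") auto
  then show ?thesis using u assms(1,2) by (simp add: lin_simps)
qed

text \<open>If the form is nonzero somewhere on a summand, the root is a multiple of a displacement
  and lies in that summand. Different summands meet only in 0, so this happens for one summand only,
  and it does happen because the form is not zero.\<close>

lemma root_summand:
  assumes f: "lform f" "\<exists>u. f u \<noteq> 0" and v: "v \<noteq> 0" and fF: "\<And>w. w \<in> F \<Longrightarrow> f w = 0"
    and st: "\<And>i u. i < n \<Longrightarrow> u \<in> V i \<Longrightarrow> u + f u *s v \<in> V i"
  obtains i where "i < n" "v \<in> V i" "\<exists>u\<in>V i. f u \<noteq> 0" "\<And>j u. j < n \<Longrightarrow> j \<noteq> i \<Longrightarrow> u \<in> V j \<Longrightarrow> f u = 0"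
proof -
  have vV: "v \<in> V i" if "i < n" "u \<in> V i" "f u \<noteq> 0" for i u
  proof -
    have "(u + f u *s v) - u \<in> V i" using st[OF that(1,2)] that(2) subspace_diff[OF subV[OF that(1)]] by blast
    then have "f u *s v \<in> V i" by simp
    then have "(1 / f u) *s (f u *s v) \<in> V i" by (rule subspace_scale[OF subV[OF that(1)]])
    then show ?thesis using that(3) by simp
  qed
  obtain w where w: "f w \<noteq> 0" using f by blast
  obtain z u where z: "z \<in> F" "\<And>i. i < n \<Longrightarrow> u i \<in> V i" "w = z + (\<Sum>i<n. u i)" using decompose by blast
  have "\<exists>i<n. f (u i) \<noteq> 0"
  proof (rule ccontr)
    assume "\<not> ?thesis"
    then have "f w = 0" using z fF f(1) by (simp add: lform_simps)
    then show False using w by simp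
  qed
  then obtain i where i: "i < n" "f (u i) \<noteq> 0" by blast
  then have vi: "v \<in> V i" using vV z(2) by blast
  show thesis
  proof (rule that[OF i(1) vi])
    show "\<exists>u\<in>V i. f u \<noteq> 0" using i z(2) by blast
    fix j a assume j: "j < n" "j \<noteq> i" "a \<in> V j"
    show "f a = 0" using vV[OF j(1,3)] V_disjoint[OF j(1) i(1) j(2) _ vi] v by blast
  qed
qed

end

section \<open>Finite linear groups and products of their elements\<close>

locale finite_linear_group = cspace scale Basis
  for scale :: "complex \<Rightarrow> 'v::ab_group_add \<Rightarrow> 'v" (infixr \<open>*s\<close> 75) and Basis :: "'v set" +
  fixes W :: "('v \<Rightarrow> 'v) set"
  assumes sgW: "subgroup W (GL scale UNIV)" and finW: "finite W"
begin

lemma W_bij: "g \<in> W \<Longrightarrow> bij g" and W_lin: "g \<in> W \<Longrightarrow> lin g"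
  using subgroup.mem_carrier[OF sgW] GL_UNIV_iff by blast+

lemma W_comp: "g \<in> W \<Longrightarrow> h \<in> W \<Longrightarrow> g \<circ> h \<in> W"
  using subgroup.m_closed[OF sgW] GL_UNIV_mult[OF subgroup.mem_carrier[OF sgW] subgroup.mem_carrier[OF sgW]] by metis

lemma W_id: "id \<in> W"
  using subgroup.one_closed[OF sgW] unfolding GL_UNIV_one .

lemma W_inv: "g \<in> W \<Longrightarrow> inv_into UNIV g \<in> W"
  using subgroup.m_inv_closed[OF sgW] GL_UNIV_inv[OF subgroup.mem_carrier[OF sgW]] by metis

lemma inv_W: assumes "g \<in> W" shows "inv_into UNIV g (g u) = u" "g (inv_into UNIV g u) = u"
  using W_bij[OF assms] by (auto simp: bij_is_inj bij_is_surj surj_f_inv_f)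

text \<open>The product map of \<open>irreducible_decomposition\<close>, for an arbitrary list of
  indices so that induction is possible.\<close>

definition prodW :: "nat list \<Rightarrow> (nat \<Rightarrow> 'v \<Rightarrow> 'v) \<Rightarrow> 'v \<Rightarrow> 'v" where
  "prodW xs g = foldr (\<lambda>i h. g i \<otimes>\<^bsub>GL scale UNIV\<^esub> h) xs \<one>\<^bsub>GL scale UNIV\<^esub>"

text \<open>Each factor preserves its own summand and is trivial on the others, so on
  \<open>V j\<close> only the j-th factor of the product is felt.\<close>

lemma prodW_action:
  assumes g: "\<And>i. i < n \<Longrightarrow> g i \<in> W" and st: "\<And>i u. i < n \<Longrightarrow> u \<in> V i \<Longrightarrow> g i u \<in> V i"
    and triv: "\<And>i j u. i < n \<Longrightarrow> j < n \<Longrightarrow> j \<noteq> i \<Longrightarrow> u \<in> V j \<Longrightarrow> g i u = u"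
    and "distinct xs" "set xs \<subseteq> {..<n}"
  shows "prodW xs g \<in> W \<and> (\<forall>j<n. \<forall>u\<in>V j. prodW xs g u = (if j \<in> set xs then g j u else u))"
  using assms(4,5)
proof (induction xs)
  case Nil
  have "prodW [] g = id" by (simp add: prodW_def GL_UNIV_one)
  then show ?case using W_id by (metis empty_iff id_apply list.set(1))
next
  case (Cons i xs)
  have i: "i < n" "i \<notin> set xs" using Cons by auto
  have IH: "prodW xs g \<in> W" "\<And>j u. j < n \<Longrightarrow> u \<in> V j \<Longrightarrow> prodW xs g u = (if j \<in> set xs then g j u else u)"
    using Cons by auto
  have e: "prodW (i # xs) g = g i \<circ> prodW xs g"
    using GL_UNIV_mult[OF subgroup.mem_carrier[OF sgW g[OF i(1)]] subgroup.mem_carrier[OF sgW IH(1)]]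
    unfolding prodW_def by (simp only: foldr.simps o_apply)
  have "(g i \<circ> prodW xs g) u = (if j \<in> set (i # xs) then g j u else u)" if j: "j < n" "u \<in> V j" for j u
  proof (cases "j = i")
    case True then show ?thesis using IH(2)[OF j] i by simp
  next
    case False
    have "prodW xs g u \<in> V j" using IH(2)[OF j] st[OF j] j(2) by auto
    then have "g i (prodW xs g u) = prodW xs g u" using triv[OF i(1) j(1) False] by simp
    then show ?thesis using IH(2)[OF j] False by auto
  qed
  then show ?case unfolding e using W_comp[OF g[OF i(1)] IH(1)] by blast
qed

end

section \<open>The factors of a given decomposition\<close>

locale decomposed = finite_linear_group scale Basis W
  for scale :: "complex \<Rightarrow> 'v::ab_group_add \<Rightarrow> 'v" (infixr \<open>*s\<close> 75) and Basis :: "'v set"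
    and W :: "('v \<Rightarrow> 'v) set" +
  fixes n :: nat and V :: "nat \<Rightarrow> 'v set" and W' :: "nat \<Rightarrow> ('v \<Rightarrow> 'v) set"
  assumes dec: "irreducible_decomposition scale W n V W'"
begin

sublocale dsum scale Basis "fixed_space W" n V
  by unfold_locales (use dec in \<open>simp add: irreducible_decomposition_def\<close>)

lemma W'_sub: "i < n \<Longrightarrow> W' i \<subseteq> W" and W'_subgroup: "i < n \<Longrightarrow> subgroup (W' i) (GL scale UNIV)"
  using dec by (auto simp: irreducible_decomposition_def)

lemma W'_triv: "i < n \<Longrightarrow> j < n \<Longrightarrow> j \<noteq> i \<Longrightarrow> g \<in> W' i \<Longrightarrow> u \<in> V j \<Longrightarrow> g u = u"
  using dec unfolding irreducible_decomposition_def by blast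

lemma K_frg: "i < n \<Longrightarrow> finite_reflection_group scale (V i) ((\<lambda>g. restrict g (V i)) ` W' i)"
  and K_irr: "i < n \<Longrightarrow> irreducible_action scale (V i) ((\<lambda>g. restrict g (V i)) ` W' i)"
  using dec unfolding irreducible_decomposition_def by blast+

lemma K_subgroup: "i < n \<Longrightarrow> subgroup ((\<lambda>g. restrict g (V i)) ` W' i) (GL scale (V i))"
  using K_frg by (simp add: finite_reflection_group_def)

text \<open>The stability of \<open>V i\<close> is contained in the restriction being an element of
  \<open>GL scale (V i)\<close>.\<close>

lemma W'_V: assumes "i < n" "g \<in> W' i" "u \<in> V i" shows "g u \<in> V i"
proof -
  have "restrict g (V i) \<in> carrier (GL scale (V i))"
    using subgroup.mem_carrier[OF K_subgroup[OF assms(1)]] assms(2) by blast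
  then have "bij_betw (restrict g (V i)) (V i) (V i)" by (simp add: GL_carrier_iff)
  then show ?thesis using assms(3) by (metis bij_betw_apply restrict_apply')
qed

lemma W'_co: assumes "i < n" "g \<in> W' i" "c \<in> co i" shows "g c = c"
proof (rule co_trivial[OF _ _ _ assms(3)])
  show "lin g" using W_lin W'_sub assms by blast
  show "g f = f" if "f \<in> fixed_space W" for f using that W'_sub assms by (auto simp: fixed_space_def)
  show "g u = u" if "j < n" "j \<noteq> i" "u \<in> V j" for j u using W'_triv assms that by blast
qed

lemma W'_comp: assumes "i < n" "g \<in> W' i" "h \<in> W' i" shows "g \<circ> h \<in> W' i"
proof -
  note S = W'_subgroup[OF assms(1)]
  have "g \<otimes>\<^bsub>GL scale UNIV\<^esub> h = g \<circ> h" using GL_UNIV_mult subgroup.mem_carrier[OF S] assms by blast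
  then show ?thesis using subgroup.m_closed[OF S assms(2,3)] by simp
qed

lemma W'_id: "i < n \<Longrightarrow> id \<in> W' i"
  using subgroup.one_closed[OF W'_subgroup] GL_UNIV_one by metis

lemma W'_inv: assumes "i < n" "g \<in> W' i" shows "inv_into UNIV g \<in> W' i"
  using subgroup.m_inv_closed[OF W'_subgroup[OF assms(1)] assms(2)]
    GL_UNIV_inv[OF subgroup.mem_carrier[OF W'_subgroup[OF assms(1)] assms(2)]] by simp

lemma W'_ext: assumes i: "i < n" and g: "g \<in> W' i" "h \<in> W' i" and eq: "\<And>u. u \<in> V i \<Longrightarrow> g u = h u" shows "g = h"
proof
  fix v
  obtain u c where u: "u \<in> V i" "c \<in> co i" "v = u + c" using V_co_sum[OF i] by blast
  have "lin g" "lin h" using W_lin W'_sub[OF i] g by auto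
  moreover have "g c = c" "h c = c" using W'_co[OF i _ u(2)] g by blast+
  ultimately show "g v = h v" using u eq by (simp add: lin_simps)
qed

text \<open>As \<open>g\<close> is trivial on \<open>co i\<close>, its fixed space has the same
  codimension in the whole space as the fixed space of the restriction has in
  \<open>V i\<close>.\<close>

lemma restrict_reflection:
  assumes i: "i < n" and g: "g \<in> W' i" and r: "is_reflection scale (V i) (restrict g (V i))"
  shows "reflection g"
proof -
  have finK: "finite ((\<lambda>g. restrict g (V i)) ` W' i)" using K_frg[OF i] by (simp add: finite_reflection_group_def)
  obtain f v where f: "lform f" "\<exists>u\<in>V i. f u \<noteq> 0" "v \<in> V i" "v \<noteq> 0" "\<And>u. u \<in> V i \<Longrightarrow> restrict g (V i) u = u + f u *s v"
    using r g is_reflection_iff[OF subV[OF i] K_subgroup[OF i] finK] by blast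
  obtain w where w: "w \<in> V i" "f w \<noteq> 0" using f by blast
  have gl: "lin g" using W_lin W'_sub i g by blast
  have "w \<notin> {u. g u = u}" using f(5)[OF w(1)] w f(4) by simp
  then have "hyp {u. g u = u}"
  proof -
    assume nw: "w \<notin> {u. g u = u}"
    \<comment> \<open>The form \<open>f\<close> describes \<open>g\<close> on \<open>V i\<close>
      only and may be nonzero on \<open>co i\<close>; hence a new form is built from the fixed space
      of \<open>g\<close>.\<close>
    obtain h where h: "lform h" "h w = 1" "\<And>u. u \<in> {u. g u = u} \<Longrightarrow> h u = 0"
      using separating_form[OF subspace_fixed[OF gl] nw] by blast
    have "g u = u" if hu: "h u = 0" for u
    proof -
      obtain a c where a: "a \<in> V i" "c \<in> co i" "u = a + c" using V_co_sum[OF i] by blast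
      have gc: "g c = c" using W'_co[OF i g a(2)] .
      then have ha: "h a = 0" using hu h(1) h(3)[of c] a by (simp add: lform_simps)
      have ga: "g a = a + f a *s v" using f(5)[OF a(1)] a(1) by simp
      have gw: "g w = w + f w *s v" using f(5)[OF w(1)] w(1) by simp
      have "g (a - (f a / f w) *s w) = a - (f a / f w) *s w"
        using gl w(2) by (simp add: lin_simps ga gw scale_right_distrib)
      then have "h (a - (f a / f w) *s w) = 0" using h(3) by simp
      then have "f a / f w = 0" using ha h by (simp add: lform_simps)
      then have "f a = 0" using w(2) by simp
      then show ?thesis using a gc ga gl by (simp add: lin_simps)
    qed
    then have "{u. g u = u} = {u. h u = 0}" using h(3) by auto
    then show ?thesis unfolding hyp_def using h(1,2) by (intro exI[of _ h]) (auto intro!: exI[of _ w])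
  qed
  then have "is_hyperplane scale UNIV (fixed_by UNIV g)" by (simp add: is_hyperplane_UNIV fixed_by_def)
  moreover have gW: "g \<in> W" using W'_sub i g by blast
  ultimately have "is_reflection scale UNIV g"
    using finite_subgroup_order[OF group_GL[OF subspace_UNIV] sgW finW gW] subgroup.mem_carrier[OF sgW gW]
    by (simp add: is_reflection_def)
  then show ?thesis using is_reflection_UNIV[OF sgW finW gW] by blast
qed

text \<open>The inverse has the same form, with the root divided by -(1 + f(v)); this scalar is
  nonzero because \<open>g\<close> is injective.\<close>

lemma reflection_inv:
  assumes "reflection g" "bij g" shows "reflection (inv_into UNIV g)"
proof -
  obtain f v where f: "lform f" "\<exists>u. f u \<noteq> 0" "v \<noteq> 0" "g = (\<lambda>u. u + f u *s v)" using assms(1) reflection_def by auto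
  let ?c = "1 + f v"
  have c: "?c \<noteq> 0"
  proof
    assume "?c = 0"
    then have "g v = g 0" unfolding f(4) using lform_0[OF f(1)] by (metis add.left_neutral scale_left_distrib scale_one scale_zero_left)
    then show False using assms(2) f(3) by (metis bij_is_inj injD)
  qed
  let ?h = "\<lambda>u. u + f u *s ((- 1 / ?c) *s v)"
  have "g (?h u) = u" for u
  proof -
    have fh: "f (?h u) = f u / ?c" using c f(1) by (simp add: lform_simps field_simps)
    have "g (?h u) = ?h u + f (?h u) *s v" by (simp add: f(4))
    also have "\<dots> = u" unfolding fh by (simp flip: scale_left_distrib add: add.assoc)
    finally show ?thesis .
  qed
  then have "inv_into UNIV g = ?h" using assms(2) by (metis (no_types, lifting) bij_inv_eq_iff ext)
  moreover have "(- 1 / ?c) *s v \<noteq> 0" using c f(3) by simp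
  ultimately show ?thesis unfolding reflection_def using f(1,2) by blast
qed

text \<open>Restriction to \<open>V i\<close> is faithful on \<open>W' i\<close>, and reflections of
  the restricted group lift to reflections, so generation lifts as well. Inverses of the generators
  are again reflections, which turns \<open>generate\<close> into \<open>mcl\<close>.\<close>

lemma refl_factor: assumes i: "i < n" shows "refl_factor scale Basis (V i) (co i) (W' i)"
proof
  let ?U = "V i" and ?G = "W' i"
  let ?K = "(\<lambda>g. restrict g ?U) ` ?G"
  show "subspace ?U" by (rule subV[OF i])
  show "subspace (co i)" by (rule co_subspace)
  show "u = 0" if "u \<in> ?U" "u \<in> co i" for u using V_co_Int[OF i that] .
  show "\<exists>u\<in>?U. \<exists>c\<in>co i. v = u + c" for v by (rule V_co_sum[OF i])
  show "lin g" "bij g" if "g \<in> ?G" for g using that W_lin W_bij W'_sub[OF i] by blast+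
  show "g c = c" if "g \<in> ?G" "c \<in> co i" for g c using W'_co[OF i that] .
  show "g u \<in> ?U" if "g \<in> ?G" "u \<in> ?U" for g u using W'_V[OF i that] .
  show "inv_into UNIV g \<in> ?G" if "g \<in> ?G" for g using W'_inv[OF i that] .
  show "finite ?G" using finite_subset[OF W'_sub[OF i] finW] .
  have irr: "irreducible_action scale ?U ?K" by (rule K_irr[OF i])
  then show "?U \<noteq> {0}" by (simp add: irreducible_action_def)
  show "S = {0} \<or> S = ?U" if "subspace S" "S \<subseteq> ?U" "\<And>g u. g \<in> ?G \<Longrightarrow> u \<in> S \<Longrightarrow> g u \<in> S" for S
  proof -
    have "\<forall>k\<in>?K. k ` S \<subseteq> S" using that(2,3) by auto
    then show ?thesis using irr that(1,2) unfolding irreducible_action_def by blast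
  qed
  let ?R = "{g \<in> ?G. reflection g}"
  let ?RK = "{k \<in> ?K. is_reflection scale ?U k}"
  interpret GL: group "GL scale ?U" by (rule group_GL[OF subV[OF i]])
  have Kc: "?K \<subseteq> carrier (GL scale ?U)" using subgroup.subset[OF K_subgroup[OF i]] .
  have Kgen: "?K = generate (GL scale ?U) ?RK" using K_frg[OF i] by (simp add: finite_reflection_group_def)
  have one: "g = id" if "g \<in> ?G" "restrict g ?U = (\<lambda>x\<in>?U. x)" for g
  proof (rule W'_ext[OF i that(1) W'_id[OF i]])
    fix u assume "u \<in> ?U" then show "g u = id u" using fun_cong[OF that(2), of u] by simp
  qed
  have key: "g \<in> mcl ?R" if "k \<in> generate (GL scale ?U) ?RK" "g \<in> ?G" "restrict g ?U = k" for g k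
    using that
  proof (induction arbitrary: g rule: generate.induct)
    case one then show ?case using \<open>\<And>g. _ \<Longrightarrow> _ \<Longrightarrow> g = id\<close>[of g] mcl.id by (metis GL_one)
  next
    case (incl h)
    then have "is_reflection scale ?U (restrict g ?U)" by (metis (no_types, lifting) mem_Collect_eq)
    then have "reflection g" by (rule restrict_reflection[OF i incl(2)])
    then show ?case using incl by (intro mcl_incl) blast
  next
    case (inv h)
    have hc: "h \<in> carrier (GL scale ?U)" using inv(1) Kc by blast
    obtain g' where g': "g' \<in> ?G" "h = restrict g' ?U" using inv(1) by blast
    then have rg: "reflection g'" using restrict_reflection[OF i] inv(1) by blast
    have "g \<circ> g' = id"
    proof (rule one[OF W'_comp[OF i inv(2) g'(1)]])
      have "inv\<^bsub>GL scale ?U\<^esub> h \<otimes>\<^bsub>GL scale ?U\<^esub> h = (\<lambda>x\<in>?U. x)" using GL.l_inv[OF hc] GL_one by metis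
      then have "compose ?U (restrict g ?U) (restrict g' ?U) = (\<lambda>x\<in>?U. x)"
        unfolding inv(3) g'(2)[symmetric] GL_mult[OF GL.inv_closed[OF hc] hc, symmetric] .
      moreover have "compose ?U (restrict g ?U) (restrict g' ?U) = restrict (g \<circ> g') ?U"
        using W'_V[OF i g'(1)] by (auto simp: compose_def restrict_def)
      ultimately show "restrict (g \<circ> g') ?U = (\<lambda>x\<in>?U. x)" by simp
    qed
    moreover have bg: "bij g'" using g'(1) W'_sub[OF i] W_bij by blast
    ultimately have "g = inv_into UNIV g'" by (metis bij_is_surj comp_apply id_apply surj_f_inv_f ext)
    then have "reflection g" using reflection_inv[OF rg bg] by simp
    then show ?case using inv(2) by (intro mcl_incl) auto
  next
    case (eng h1 h2)
    have "h1 \<in> ?K" "h2 \<in> ?K" using eng(1,2) Kgen by blast+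
    then obtain g1 g2 where g12: "g1 \<in> ?G" "h1 = restrict g1 ?U" "g2 \<in> ?G" "h2 = restrict g2 ?U" by blast
    have "g = g1 \<circ> g2"
    proof (rule W'_ext[OF i eng(5) W'_comp[OF i g12(1,3)]])
      fix u assume u: "u \<in> ?U"
      have h12: "h1 \<in> carrier (GL scale ?U)" "h2 \<in> carrier (GL scale ?U)"
        using Kc \<open>h1 \<in> ?K\<close> \<open>h2 \<in> ?K\<close> by blast+
      have "restrict g ?U = compose ?U h1 h2" unfolding eng(6) by (rule GL_mult[OF h12])
      then have "restrict g ?U u = compose ?U h1 h2 u" by simp
      then show "g u = (g1 \<circ> g2) u" using u g12 W'_V[OF i g12(3) u] by (simp add: compose_def)
    qed
    moreover have "g1 \<in> mcl ?R" by (rule eng(3)[OF g12(1) g12(2)[symmetric]])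
    moreover have "g2 \<in> mcl ?R" by (rule eng(4)[OF g12(3) g12(4)[symmetric]])
    ultimately show ?case using mcl_mult by metis
  qed
  have "?G \<subseteq> mcl ?R"
  proof
    fix g assume g: "g \<in> ?G"
    then have "restrict g ?U \<in> generate (GL scale ?U) ?RK" using Kgen by blast
    then show "g \<in> mcl ?R" using key g by blast
  qed
  moreover have "mcl ?R \<subseteq> ?G"
  proof
    fix g assume "g \<in> mcl ?R"
    then show "g \<in> ?G"
    proof (induction rule: mcl.induct)
      case (step s g) then show ?case using W'_comp[OF i] by blast
    qed (rule W'_id[OF i])
  qed
  ultimately show "?G = mcl ?R" by blast
qed

lemma W_components:
  assumes g: "g \<in> W"
  obtains h where "\<And>i. i < n \<Longrightarrow> h i \<in> W' i" "\<And>i u. i < n \<Longrightarrow> u \<in> V i \<Longrightarrow> g u = h i u"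
proof -
  have "(\<lambda>g. foldr (\<lambda>i h. g i \<otimes>\<^bsub>GL scale UNIV\<^esub> h) [0..<n] \<one>\<^bsub>GL scale UNIV\<^esub>)
       \<in> iso (product_group {..<n} (\<lambda>i. (GL scale UNIV)\<lparr>carrier := W' i\<rparr>)) ((GL scale UNIV)\<lparr>carrier := W\<rparr>)"
    using dec by (simp add: irreducible_decomposition_def)
  then have "W = (\<lambda>g. foldr (\<lambda>i h. g i \<otimes>\<^bsub>GL scale UNIV\<^esub> h) [0..<n] \<one>\<^bsub>GL scale UNIV\<^esub>) ` (\<Pi>\<^sub>E i\<in>{..<n}. W' i)"
    by (simp add: iso_def bij_betw_def)
  then obtain h where h: "h \<in> (\<Pi>\<^sub>E i\<in>{..<n}. W' i)" "g = foldr (\<lambda>i k. h i \<otimes>\<^bsub>GL scale UNIV\<^esub> k) [0..<n] \<one>\<^bsub>GL scale UNIV\<^esub>"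
    using g by blast
  have hW: "h i \<in> W' i" if "i < n" for i using h(1) that by auto
  have "distinct [0..<n]" "set [0..<n] \<subseteq> {..<n}" by auto
  then have act: "\<forall>j<n. \<forall>u\<in>V j. prodW [0..<n] h u = (if j \<in> set [0..<n] then h j u else u)"
    using prodW_action[of n h V "[0..<n]"] hW W'_sub W'_V W'_triv by blast
  show thesis
  proof (rule that[of h, OF hW])
    fix i u assume "i < n" "u \<in> V i"
    then show "g u = h i u" using act unfolding h(2) prodW_def by simp
  qed
qed

text \<open>Every element of \<open>W\<close> stabilizes each summand, by
  \<open>W_components\<close>. A reflection is therefore concentrated on a single summand, and
  equals its component there.\<close>

lemma arr_W: "arr W = (\<Union>i<n. arr (W' i))"
proof (intro subset_antisym subsetI)
  fix H assume "H \<in> (\<Union>i<n. arr (W' i))"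
  then show "H \<in> arr W" using W'_sub by (auto simp: arr_def)
next
  fix H assume "H \<in> arr W"
  then obtain f v where f: "lform f" "\<exists>u. f u \<noteq> 0" "v \<noteq> 0" "(\<lambda>u. u + f u *s v) \<in> W" "H = {u. f u = 0}" by (rule arrE)
  let ?g = "\<lambda>u. u + f u *s v"
  obtain h where h: "\<And>i. i < n \<Longrightarrow> h i \<in> W' i" "\<And>i u. i < n \<Longrightarrow> u \<in> V i \<Longrightarrow> ?g u = h i u"
    using W_components[OF f(4)] by blast
  have fF: "f w = 0" if "w \<in> fixed_space W" for w
  proof -
    have "\<forall>g\<in>W. g w = w" using that by (simp add: fixed_space_def)
    from bspec[OF this f(4)] have "?g w = w" .
    then show ?thesis using f(3) by simp
  qed
  obtain i where i: "i < n" "\<And>j u. j < n \<Longrightarrow> j \<noteq> i \<Longrightarrow> u \<in> V j \<Longrightarrow> f u = 0"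
  proof (rule root_summand[OF f(1,2,3) fF])
    show "u + f u *s v \<in> V j" if "j < n" "u \<in> V j" for j u
      using h(2)[OF that] W'_V[OF that(1) h(1)[OF that(1)] that(2)] by simp
  qed (use that in blast)+
  have "?g = h i"
  proof (rule lin_eq_dsum)
    show "lin ?g" "lin (h i)" using W_lin f(4) W'_sub[OF i(1)] h(1)[OF i(1)] by blast+
    show "?g w = h i w" if "w \<in> fixed_space W" for w
    proof -
      have "h i \<in> W" using W'_sub[OF i(1)] h(1)[OF i(1)] by blast
      then have "h i w = w" using that unfolding fixed_space_def by blast
      then show ?thesis using fF[OF that] by simp
    qed
    show "?g u = h i u" if "j < n" "u \<in> V j" for j u
      using h(2)[OF that] i(2)[OF that(1) _ that(2)] W'_triv[OF i(1) that(1) _ h(1)[OF i(1)] that(2)] by (cases "j = i") auto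
  qed
  then have gi: "?g \<in> W' i" using h(1)[OF i(1)] by metis
  obtain w where "f w \<noteq> 0" using f(2) by blast
  then show "H \<in> (\<Union>i<n. arr (W' i))" using arrI[OF f(1) _ f(3) gi] f(5) i(1) by blast
qed

end

section \<open>Complete reducibility\<close>

context finite_linear_group
begin

definition stable :: "'v set \<Rightarrow> bool" where
  "stable S \<longleftrightarrow> subspace S \<and> (\<forall>g\<in>W. \<forall>u\<in>S. g u \<in> S)"

lemma subspace_projection:
  assumes S: "subspace S"
  obtains p where "lin p" "\<And>v. p v \<in> S" "\<And>s. s \<in> S \<Longrightarrow> p s = s"
proof -
  obtain B where B: "B \<subseteq> S" "independent B" "S \<subseteq> span B" using basis_exists by metis
  define E where "E = extend_basis B"
  have E: "independent E" "span E = UNIV" "B \<subseteq> E"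
    using independent_extend_basis[OF B(2)] span_extend_basis[OF B(2)] extend_basis_superset[OF B(2)] by (auto simp: E_def)
  have finB: "finite B" using B(2) by (rule finiteI_independent)
  define p where "p v = (\<Sum>b\<in>B. representation E v b *s b)" for v
  have lp: "lin p" unfolding lin_def p_def
    using E by (simp add: representation_add representation_scale scale_left_distrib sum.distrib scale_sum_right)
  have pb: "p b = b" if b: "b \<in> B" for b
  proof -
    have "p b = (\<Sum>c\<in>B. if c = b then b else 0)" unfolding p_def
      using E b by (intro sum.cong) (auto simp: representation_basis)
    then show ?thesis using finB b by simp
  qed
  have "B \<subseteq> {v. p v = v}" using pb by auto
  then have "span B \<subseteq> {v. p v = v}" using span_minimal subspace_fixed[OF lp] by blast
  then have "p s = s" if "s \<in> S" for s using that B(3) by blast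
  moreover have "p v \<in> S" for v unfolding p_def using B(1) S by (auto intro!: subspace_sum subspace_scale)
  ultimately show thesis using that lp by blast
qed

text \<open>A projection onto \<open>S\<close> is averaged over the group. The average maps into
  \<open>S\<close>, is the identity on \<open>S\<close> and commutes with \<open>W\<close>, so its
  kernel is a stable complement.\<close>

lemma maschke:
  assumes S: "stable S"
  obtains T where "stable T" "S \<inter> T = {0}" "\<And>v. \<exists>s\<in>S. \<exists>t\<in>T. v = s + t"
proof -
  have sS: "subspace S" and gS: "\<And>g u. g \<in> W \<Longrightarrow> u \<in> S \<Longrightarrow> g u \<in> S" using S by (auto simp: stable_def)
  obtain p where p: "lin p" "\<And>v. p v \<in> S" "\<And>s. s \<in> S \<Longrightarrow> p s = s" using subspace_projection[OF sS] by blast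
  let ?i = "inv_into UNIV"
  define m where "m = (of_nat (card W) :: complex)"
  have m: "m \<noteq> 0" using finW W_id by (auto simp: m_def)
  define q where "q v = (1 / m) *s (\<Sum>g\<in>W. g (p (?i g v)))" for v
  have term_lin: "lin (\<lambda>v. g (p (?i g v)))" if "g \<in> W" for g
    using lin_comp[OF W_lin[OF that] lin_comp[OF p(1) lin_inv[OF W_lin[OF that] W_bij[OF that]]]] by (simp add: comp_def)
  have lq: "lin q"
  proof -
    have "q (u + v) = q u + q v" for u v
      unfolding q_def scale_right_distrib[symmetric] sum.distrib[symmetric]
      by (intro arg_cong[of _ _ "scale (1 / m)"] sum.cong refl lin_add[OF term_lin])
    moreover have "q (c *s u) = c *s q u" for c u
    proof -
      have "(\<Sum>g\<in>W. g (p (?i g (c *s u)))) = (\<Sum>g\<in>W. c *s g (p (?i g u)))"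
        by (intro sum.cong refl lin_scale[OF term_lin])
      then show ?thesis unfolding q_def by (simp add: scale_sum_right mult.commute)
    qed
    ultimately show ?thesis by (simp add: lin_def)
  qed
  have qS: "q v \<in> S" for v unfolding q_def using sS gS p(2) by (auto intro!: subspace_scale subspace_sum)
  have qs: "q s = s" if s: "s \<in> S" for s
  proof -
    have "g (p (?i g s)) = s" if "g \<in> W" for g using p(3) gS[OF W_inv[OF that] s] inv_W[OF that] by simp
    then have "q s = (1 / m) *s (\<Sum>g\<in>W. s)"
      unfolding q_def by (intro arg_cong[of _ _ "scale (1 / m)"] sum.cong refl)
    also have "(\<Sum>g\<in>W. s) = m *s s"
      unfolding m_def using finW by (induction W rule: finite_induct) (auto simp: scale_left_distrib)
    finally show ?thesis using m by simp
  qed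
  have comm: "q (h v) = h (q v)" if h: "h \<in> W" for h v
  proof -
    have "(\<Sum>g\<in>W. g (p (?i g (h v)))) = (\<Sum>g\<in>W. h (g (p (?i g v))))"
    \<comment> \<open>The sum is reindexed by left multiplication with \<open>h\<close>.\<close>
    proof (rule sum.reindex_bij_witness[of _ "\<lambda>g. h \<circ> g" "\<lambda>g. ?i h \<circ> g"])
      fix g assume g: "g \<in> W"
      show "h \<circ> (?i h \<circ> g) = g" "?i h \<circ> (h \<circ> g) = g" using inv_W[OF h] by (auto simp: fun_eq_iff)
      show "?i h \<circ> g \<in> W" "h \<circ> g \<in> W" using W_comp W_inv h g by auto
      have "?i (?i h \<circ> g) v = ?i g (h v)"
      proof -
        have "bij (?i h \<circ> g)" using W_bij[OF W_comp[OF W_inv[OF h] g]] .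
        moreover have "(?i h \<circ> g) (?i g (h v)) = v" using inv_W[OF g] inv_W[OF h] by simp
        ultimately show ?thesis by (metis bij_inv_eq_iff)
      qed
      then show "h ((?i h \<circ> g) (p (?i (?i h \<circ> g) v))) = g (p (?i g (h v)))" using inv_W[OF h] by simp
    qed
    then show ?thesis unfolding q_def using W_lin[OF h] by (simp add: lin_simps)
  qed
  define T where "T = {v. q v = 0}"
  have "subspace T" using lq by (auto simp: T_def subspace_def lin_simps)
  moreover have "g u \<in> T" if "g \<in> W" "u \<in> T" for g u using that comm lin_0[OF W_lin] by (simp add: T_def)
  ultimately have "stable T" by (simp add: stable_def)
  moreover have "S \<inter> T = {0}" using qs sS lin_0[OF lq] by (auto simp: T_def subspace_0)
  moreover have "\<exists>s\<in>S. \<exists>t\<in>T. v = s + t" for v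
  proof -
    have "v - q v \<in> T" using lq qs[OF qS] by (simp add: T_def lin_simps)
    then show ?thesis using qS[of v] by (metis add.commute diff_add_cancel)
  qed
  ultimately show thesis using that by blast
qed

text \<open>Irreducibility with all of \<open>W\<close> acting, available before any factors have
  been constructed.\<close>

definition irred :: "'v set \<Rightarrow> bool" where
  "irred S \<longleftrightarrow> stable S \<and> S \<noteq> {0} \<and> (\<forall>T. stable T \<and> T \<subseteq> S \<longrightarrow> T = {0} \<or> T = S)"

lemma stable_Int: "stable S \<Longrightarrow> stable T \<Longrightarrow> stable (S \<inter> T)"
  by (auto simp: stable_def subspace_inter)

text \<open>A nonzero stable subspace of least dimension is irreducible. It is split off by
  \<open>maschke\<close>, the complement being intersected with \<open>S\<close>, and the dimension
  drops.\<close>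

lemma semisimple:
  "stable S \<Longrightarrow> \<exists>k V. (\<forall>i<k. irred (V i) \<and> V i \<subseteq> S) \<and>
     (\<forall>v\<in>S. \<exists>u. (\<forall>i<k. u i \<in> V i) \<and> v = (\<Sum>i<k. u i)) \<and>
     (\<forall>u. (\<forall>i<k. u i \<in> V i) \<and> (\<Sum>i<k. u i) = 0 \<longrightarrow> (\<forall>i<(k::nat). u i = 0))"
proof (induction "dim S" arbitrary: S rule: less_induct)
  case less
  show ?case
  proof (cases "S = {0}")
    case True
    show ?thesis by (rule exI[of _ 0]) (use True in auto)
  next
    case False
    have sS: "subspace S" using less(2) by (simp add: stable_def)
    let ?P = "\<lambda>T. stable T \<and> T \<noteq> {0} \<and> T \<subseteq> S"
    have "?P S" using less(2) False by blast
    then obtain S1 where S1: "?P S1" and min: "\<And>T. ?P T \<Longrightarrow> dim S1 \<le> dim T"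
      using ex_has_least_nat[of ?P S dim] by blast
    have irr1: "irred S1" unfolding irred_def
    proof (intro conjI allI impI)
      fix T assume T: "stable T \<and> T \<subseteq> S1"
      show "T = {0} \<or> T = S1"
      proof (rule disjCI)
        assume "T \<noteq> S1"
        show "T = {0}"
        proof (rule ccontr)
          assume "T \<noteq> {0}"
          then have "dim S1 \<le> dim T" using min T S1 by blast
          then have "T = S1" using subspace_dim_equal[of T S1] T S1 by (auto simp: stable_def)
          then show False using \<open>T \<noteq> S1\<close> by blast
        qed
      qed
    qed (use S1 in auto)
    obtain Q where Q: "stable Q" "S1 \<inter> Q = {0}" "\<And>v. \<exists>s\<in>S1. \<exists>t\<in>Q. v = s + t" using maschke S1 by blast
    define S2 where "S2 = S \<inter> Q"
    have st2: "stable S2" using stable_Int less(2) Q(1) by (simp add: S2_def)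
    have "S2 \<noteq> S"
    proof
      assume "S2 = S"
      then have "S1 \<subseteq> Q" using S1 by (auto simp: S2_def)
      then have "S1 = {0}" using Q(2) by blast
      then show False using S1 by blast
    qed
    then have "S2 \<subset> S" by (auto simp: S2_def)
    moreover have "subspace S2" using st2 by (simp add: stable_def)
    ultimately have "dim S2 < dim S" using sS by (intro dim_psubset) (simp add: span_eq_iff[THEN iffD2])
    from less(1)[OF this st2] obtain k V where V: "\<forall>i<k. irred (V i) \<and> V i \<subseteq> S2"
      "\<forall>v\<in>S2. \<exists>u. (\<forall>i<k. u i \<in> V i) \<and> v = (\<Sum>i<k. u i)"
      "\<forall>u. (\<forall>i<k. u i \<in> V i) \<and> (\<Sum>i<k. u i) = 0 \<longrightarrow> (\<forall>i<(k::nat). u i = 0)" by blast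
    define V' where "V' = V(k := S1)"
    have V'k: "V' k = S1" "\<And>i. i < k \<Longrightarrow> V' i = V i" by (auto simp: V'_def)
    show ?thesis
    proof (intro exI[of _ "Suc k"] exI[of _ V'] conjI allI impI ballI)
      show "irred (V' i)" "V' i \<subseteq> S" if "i < Suc k" for i
      proof -
        have "irred (V' i) \<and> V' i \<subseteq> S"
        proof (cases "i = k")
          case True then show ?thesis using irr1 S1 V'k(1) by simp
        next
          case False
          then have "i < k" using that by simp
          then show ?thesis using V(1) V'k(2) by (auto simp: S2_def)
        qed
        then show "irred (V' i)" "V' i \<subseteq> S" by auto
      qed
      show "\<exists>u. (\<forall>i<Suc k. u i \<in> V' i) \<and> v = (\<Sum>i<Suc k. u i)" if v: "v \<in> S" for v
      proof -
        obtain s t where st: "s \<in> S1" "t \<in> Q" "v = s + t" using Q(3) by blast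
        have "t = v - s" using st by simp
        moreover have "s \<in> S" using st S1 by blast
        ultimately have "t \<in> S" using v sS subspace_diff by metis
        then have "t \<in> S2" using st by (simp add: S2_def)
        then obtain u where u: "\<forall>i<k. u i \<in> V i" "t = (\<Sum>i<k. u i)" using V(2) by blast
        have "(\<Sum>i<Suc k. (u(k := s)) i) = v" using st u by (simp add: add.commute)
        moreover have "\<forall>i<Suc k. (u(k := s)) i \<in> V' i" using u st V'k by (auto simp: less_Suc_eq)
        ultimately show ?thesis by blast
      qed
      fix u i assume u: "(\<forall>i<Suc k. u i \<in> V' i) \<and> (\<Sum>i<Suc k. u i) = 0" and i: "i < Suc k"
      have uV: "u i \<in> V i" if "i < k" for i using u V'k(2)[OF that] that less_SucI by metis
      then have s2: "(\<Sum>i<k. u i) \<in> S2"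
        using V(1) \<open>subspace S2\<close> by (intro subspace_sum) auto
      have uk: "u k = - (\<Sum>i<k. u i)" using u by (simp add: eq_neg_iff_add_eq_0 add.commute)
      then have "u k \<in> S2" using s2 \<open>subspace S2\<close> subspace_neg by metis
      moreover have "u k \<in> S1" using u V'k by auto
      ultimately have "u k = 0" using Q(2) by (auto simp: S2_def)
      moreover from this have "(\<Sum>i<k. u i) = 0" using uk by simp
      then have "\<forall>i<k. u i = 0" using V(3) uV by blast
      ultimately show "u i = 0" using i by (auto simp: less_Suc_eq)
    qed
  qed
qed

lemma fixed_space_stable: "stable (fixed_space W)"
proof -
  have "subspace (fixed_space W)"
    unfolding subspace_def fixed_space_def by (auto simp: lin_simps[OF W_lin])
  moreover have "g u \<in> fixed_space W" if "g \<in> W" "u \<in> fixed_space W" for g u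
  proof -
    have "g u = u" using that by (simp add: fixed_space_def)
    then show ?thesis using that by simp
  qed
  ultimately show ?thesis by (simp add: stable_def)
qed

lemma ex_invariant_decomposition:
  obtains k V where "direct_sum_decomposition scale (fixed_space W) k V" "\<And>i. i < k \<Longrightarrow> irred (V i)"
proof -
  let ?F = "fixed_space W"
  obtain S where S: "stable S" "?F \<inter> S = {0}" "\<And>v. \<exists>f\<in>?F. \<exists>s\<in>S. v = f + s"
    using maschke[OF fixed_space_stable] by blast
  obtain k V where V: "\<forall>i<k. irred (V i) \<and> V i \<subseteq> S"
      "\<forall>v\<in>S. \<exists>u. (\<forall>i<k. u i \<in> V i) \<and> v = (\<Sum>i<k. u i)"
      "\<forall>u. (\<forall>i<k. u i \<in> V i) \<and> (\<Sum>i<k. u i) = 0 \<longrightarrow> (\<forall>i<(k::nat). u i = 0)" using semisimple[OF S(1)] by blast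
  have sS: "subspace S" using S(1) by (simp add: stable_def)
  have "direct_sum_decomposition scale ?F k V" unfolding direct_sum_decomposition_def
  proof (intro conjI allI impI ballI)
    show "subspace ?F" using fixed_space_stable by (simp add: stable_def)
    show "subspace (V i)" if "i < k" for i using V(1) that by (simp add: irred_def stable_def)
    show "\<exists>f\<in>?F. \<exists>u. (\<forall>i<k. u i \<in> V i) \<and> v = f + (\<Sum>i<k. u i)" for v
    proof -
      obtain f s where f: "f \<in> ?F" "s \<in> S" "v = f + s" using S(3) by blast
      obtain u where "\<forall>i<k. u i \<in> V i" "s = (\<Sum>i<k. u i)" using V(2) f(2) by blast
      then show ?thesis using f by blast
    qed
    fix f u assume f: "f \<in> ?F" and u: "(\<forall>i<k. u i \<in> V i) \<and> f + (\<Sum>i<k. u i) = 0"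
    have s: "(\<Sum>i<k. u i) \<in> S" using u V(1) sS by (intro subspace_sum) auto
    have "f = - (\<Sum>i<k. u i)" using u by (simp add: eq_neg_iff_add_eq_0)
    then have "f \<in> S" using s sS subspace_neg by metis
    then show f0: "f = 0" using f S(2) by blast
    have "(\<Sum>i<k. u i) = 0" using u f0 by simp
    then show "u i = 0" if "i < k" for i using V(3) u that by blast
  qed
  then show thesis using that V(1) by blast
qed

end

section \<open>Existence of the decomposition of a reflection group\<close>

locale finite_refl_group = finite_linear_group scale Basis W
  for scale :: "complex \<Rightarrow> 'v::ab_group_add \<Rightarrow> 'v" (infixr \<open>*s\<close> 75) and Basis :: "'v set"
    and W :: "('v \<Rightarrow> 'v) set" +
  assumes genW: "W = generate (GL scale UNIV) {g \<in> W. is_reflection scale UNIV g}"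
begin

lemma W_induct [consumes 1, case_names id reflection inv comp]:
  assumes g: "g \<in> W" and "P id" and "\<And>s. s \<in> W \<Longrightarrow> reflection s \<Longrightarrow> P s"
    and "\<And>s. s \<in> W \<Longrightarrow> P s \<Longrightarrow> P (inv_into UNIV s)"
    and "\<And>s t. s \<in> W \<Longrightarrow> t \<in> W \<Longrightarrow> P s \<Longrightarrow> P t \<Longrightarrow> P (s \<circ> t)"
  shows "P g"
proof -
  have "g \<in> generate (GL scale UNIV) {g \<in> W. is_reflection scale UNIV g}" using g genW by blast
  then show ?thesis
  proof (induction rule: generate.induct)
    case one then show ?case unfolding GL_UNIV_one by (rule assms(2))
  next
    case (incl h) then show ?case using assms(3)[of h] is_reflection_UNIV[OF sgW finW, of h] by blast
  next
    case (inv h)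
    then have h: "h \<in> W" "reflection h" using is_reflection_UNIV[OF sgW finW, of h] by blast+
    show ?case unfolding GL_UNIV_inv[OF subgroup.mem_carrier[OF sgW h(1)]]
      by (rule assms(4)[OF h(1) assms(3)[OF h]])
  next
    case (eng h1 h2)
    then have h: "h1 \<in> W" "h2 \<in> W" using genW by blast+
    show ?case unfolding GL_UNIV_mult[OF subgroup.mem_carrier[OF sgW h(1)] subgroup.mem_carrier[OF sgW h(2)]]
      by (rule assms(5)[OF h eng.IH])
  qed
qed

context
  fixes n V
  assumes dsd: "direct_sum_decomposition scale (fixed_space W) n V" and irr: "\<And>i. i < n \<Longrightarrow> irred (V i)"
begin

interpretation dsum scale Basis "fixed_space W" n V by unfold_locales (rule dsd)

lemma V_stable: "i < n \<Longrightarrow> g \<in> W \<Longrightarrow> u \<in> V i \<Longrightarrow> g u \<in> V i"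
  using irr by (auto simp: irred_def stable_def)

text \<open>The i-th factor is recovered from the summands alone, as the subgroup of
  \<open>W\<close> trivial on all the others.\<close>

definition Wc :: "nat \<Rightarrow> ('v \<Rightarrow> 'v) set" where
  "Wc i = {g \<in> W. \<forall>j<n. j \<noteq> i \<longrightarrow> (\<forall>u\<in>V j. g u = u)}"

lemma Wc_id: "id \<in> Wc i" using W_id by (simp add: Wc_def)

lemma Wc_comp: assumes "g \<in> Wc i" "h \<in> Wc i" shows "g \<circ> h \<in> Wc i"
  using W_comp[of g h] assms unfolding Wc_def by auto

lemma Wc_inv: assumes "g \<in> Wc i" shows "inv_into UNIV g \<in> Wc i"
proof -
  have g: "g \<in> W" "\<And>j u. j < n \<Longrightarrow> j \<noteq> i \<Longrightarrow> u \<in> V j \<Longrightarrow> g u = u" using assms unfolding Wc_def by blast+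
  have "inv_into UNIV g u = u" if "j < n" "j \<noteq> i" "u \<in> V j" for j u
    using g(2)[OF that] inv_W(1)[OF g(1), of u] by simp
  then show ?thesis using W_inv[OF g(1)] unfolding Wc_def by blast
qed

lemma Wc_subgroup: "subgroup (Wc i) (GL scale UNIV)"
proof (rule group.subgroupI[OF group_GL[OF subspace_UNIV]])
  have sub: "Wc i \<subseteq> carrier (GL scale UNIV)" using subgroup.subset[OF sgW] by (auto simp: Wc_def)
  then show "Wc i \<subseteq> carrier (GL scale UNIV)" .
  show "Wc i \<noteq> {}" using Wc_id by blast
  show "inv\<^bsub>GL scale UNIV\<^esub> g \<in> Wc i" if "g \<in> Wc i" for g
    using GL_UNIV_inv[of g] Wc_inv[OF that] sub that by auto
  show "g \<otimes>\<^bsub>GL scale UNIV\<^esub> h \<in> Wc i" if "g \<in> Wc i" "h \<in> Wc i" for g h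
    using GL_UNIV_mult[of g h] Wc_comp[OF that] sub that by (metis subsetD)
qed

lemma reflection_component:
  assumes s: "s \<in> W" "reflection s"
  obtains i f v where "i < n" "s \<in> Wc i" "lform f" "\<exists>u\<in>V i. f u \<noteq> 0" "v \<in> V i" "v \<noteq> 0" "s = (\<lambda>u. u + f u *s v)"
proof -
  obtain f v where f: "lform f" "\<exists>u. f u \<noteq> 0" "v \<noteq> 0" "s = (\<lambda>u. u + f u *s v)" using s(2) reflection_def by auto
  have fF: "f w = 0" if "w \<in> fixed_space W" for w
  proof -
    have "s w = w" using that s(1) by (simp add: fixed_space_def)
    then show ?thesis using f(3,4) by simp
  qed
  have st: "u + f u *s v \<in> V i" if "i < n" "u \<in> V i" for i u using V_stable[OF that(1) s(1) that(2)] f(4) by simp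
  obtain i where i: "i < n" "v \<in> V i" "\<exists>u\<in>V i. f u \<noteq> 0" "\<And>j u. j < n \<Longrightarrow> j \<noteq> i \<Longrightarrow> u \<in> V j \<Longrightarrow> f u = 0"
    using root_summand[OF f(1,2,3) fF st] by blast
  have "s \<in> Wc i" unfolding Wc_def using s(1) i(4) f(4) by auto
  then show thesis using that i f by blast
qed

text \<open>Generation by reflections is the point: a reflection lies in a single
  \<open>Wc i\<close> by \<open>reflection_component\<close>, and having components passes to
  inverses and products.\<close>

lemma components:
  assumes "g \<in> W"
  shows "\<exists>h. (\<forall>i<n. h i \<in> Wc i) \<and> (\<forall>i<n. \<forall>u\<in>V i. g u = h i u)"
  using assms
proof (induction rule: W_induct)
  case id
  show ?case by (rule exI[of _ "\<lambda>_. id"]) (simp add: Wc_id[unfolded id_def] id_def)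
next
  case (reflection s)
  obtain i f v where i: "i < n" "s \<in> Wc i" by (rule reflection_component[OF reflection])
  have "(if j = i then s else id) \<in> Wc j" for j using i Wc_id[of j] by (cases "j = i") auto
  moreover have "s u = (if j = i then s else id) u" if "j < n" "u \<in> V j" for j u using i that by (auto simp: Wc_def)
  ultimately show ?case by (intro exI[of _ "\<lambda>j. if j = i then s else id"]) blast
next
  case (inv s)
  then obtain h where h: "\<forall>i<n. h i \<in> Wc i" "\<forall>i<n. \<forall>u\<in>V i. s u = h i u" by blast
  have "inv_into UNIV s u = inv_into UNIV (h i) u" if "i < n" "u \<in> V i" for i u
  proof -
    have hW: "h i \<in> W" using h(1) that by (simp add: Wc_def)
    have "inv_into UNIV s u \<in> V i" using V_stable[OF that(1) W_inv[OF inv(1)] that(2)] .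
    then have "h i (inv_into UNIV s u) = u" using h(2) that(1) inv_W(2)[OF inv(1)] by metis
    then show ?thesis using inv_W(1)[OF hW] by metis
  qed
  then show ?case using h(1) Wc_inv by (intro exI[of _ "\<lambda>i. inv_into UNIV (h i)"]) blast
next
  case (comp s t)
  obtain h where h: "\<forall>i<n. h i \<in> Wc i" "\<forall>i<n. \<forall>u\<in>V i. s u = h i u" using comp by blast
  obtain k where k: "\<forall>i<n. k i \<in> Wc i" "\<forall>i<n. \<forall>u\<in>V i. t u = k i u" using comp by blast
  have "(s \<circ> t) u = (h i \<circ> k i) u" if "i < n" "u \<in> V i" for i u
    using h(2) k(2) that V_stable[OF that(1) comp(2) that(2)] by simp
  then show ?case using h(1) k(1) Wc_comp by (intro exI[of _ "\<lambda>i. h i \<circ> k i"]) blast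
qed

lemma W_ext: assumes "g \<in> W" "h \<in> W" "\<And>i u. i < n \<Longrightarrow> u \<in> V i \<Longrightarrow> g u = h u" shows "g = h"
proof (rule lin_eq_dsum[OF W_lin[OF assms(1)] W_lin[OF assms(2)] _ assms(3)])
  fix f assume "f \<in> fixed_space W"
  then have "g f = f" "h f = f" using assms(1,2) unfolding fixed_space_def by blast+
  then show "g f = h f" by simp
qed

lemma Wc_W: "Wc i \<subseteq> W" by (auto simp: Wc_def)

text \<open>Elements of \<open>W\<close> are determined by their action on the summands, where the
  product acts through one factor at a time; multiplicativity and bijectivity are checked
  there.\<close>

lemma prodW_iso:
  "prodW [0..<n] \<in> iso (product_group {..<n} (\<lambda>i. (GL scale UNIV)\<lparr>carrier := Wc i\<rparr>)) ((GL scale UNIV)\<lparr>carrier := W\<rparr>)"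
proof -
  have d: "distinct [0..<n]" "set [0..<n] \<subseteq> {..<n}" by auto
  have act: "prodW [0..<n] g \<in> W" "j < n \<Longrightarrow> u \<in> V j \<Longrightarrow> prodW [0..<n] g u = g j u"
    if "g \<in> (\<Pi>\<^sub>E i\<in>{..<n}. Wc i)" for g j u
  proof -
    have "\<And>i. i < n \<Longrightarrow> g i \<in> Wc i" using that by auto
    then have "prodW [0..<n] g \<in> W \<and>
        (\<forall>j<n. \<forall>u\<in>V j. prodW [0..<n] g u = (if j \<in> set [0..<n] then g j u else u))"
      using V_stable d by (intro prodW_action) (auto simp: Wc_def)
    then show "prodW [0..<n] g \<in> W"
      "j < n \<Longrightarrow> u \<in> V j \<Longrightarrow> prodW [0..<n] g u = g j u" by auto
  qed
  have Wcar: "g \<in> carrier (GL scale UNIV)" if "g \<in> W" for g using subgroup.mem_carrier[OF sgW that] .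
  have hom: "prodW [0..<n] (\<lambda>i\<in>{..<n}. g i \<otimes>\<^bsub>GL scale UNIV\<^esub> h i) = prodW [0..<n] g \<otimes>\<^bsub>GL scale UNIV\<^esub> prodW [0..<n] h"
    if g: "g \<in> (\<Pi>\<^sub>E i\<in>{..<n}. Wc i)" and h: "h \<in> (\<Pi>\<^sub>E i\<in>{..<n}. Wc i)" for g h
  proof -
    have m: "g i \<otimes>\<^bsub>GL scale UNIV\<^esub> h i = g i \<circ> h i" if "i < n" for i
    proof -
      have "g i \<in> W" "h i \<in> W" using g h that Wc_W by auto
      then show ?thesis using GL_UNIV_mult Wcar by blast
    qed
    have gh: "(\<lambda>i\<in>{..<n}. g i \<otimes>\<^bsub>GL scale UNIV\<^esub> h i) \<in> (\<Pi>\<^sub>E i\<in>{..<n}. Wc i)"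
    proof (rule restrict_PiE_iff[THEN iffD2], rule ballI)
      fix i assume i: "i \<in> {..<n}"
      then have "g i \<in> Wc i" "h i \<in> Wc i" using g h by auto
      then show "g i \<otimes>\<^bsub>GL scale UNIV\<^esub> h i \<in> Wc i" using m[of i] i Wc_comp by (metis lessThan_iff)
    qed
    have pm: "prodW [0..<n] g \<otimes>\<^bsub>GL scale UNIV\<^esub> prodW [0..<n] h = prodW [0..<n] g \<circ> prodW [0..<n] h"
      using GL_UNIV_mult Wcar act(1) g h by blast
    show ?thesis unfolding pm
    proof (rule W_ext)
      show "prodW [0..<n] (\<lambda>i\<in>{..<n}. g i \<otimes>\<^bsub>GL scale UNIV\<^esub> h i) \<in> W" by (rule act(1)[OF gh])
      show "prodW [0..<n] g \<circ> prodW [0..<n] h \<in> W" by (rule W_comp[OF act(1)[OF g] act(1)[OF h]])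
      fix i u assume i: "i < n" "u \<in> V i"
      have "prodW [0..<n] h u \<in> V i" using V_stable[OF i(1) act(1)[OF h] i(2)] .
      then show "prodW [0..<n] (\<lambda>i\<in>{..<n}. g i \<otimes>\<^bsub>GL scale UNIV\<^esub> h i) u = (prodW [0..<n] g \<circ> prodW [0..<n] h) u"
        using act(2)[OF gh i] act(2)[OF h i] act(2)[OF g i(1)] m[OF i(1)] i(1) by simp
    qed
  qed
  have inj: "inj_on (prodW [0..<n]) (\<Pi>\<^sub>E i\<in>{..<n}. Wc i)"
  proof (rule inj_onI)
    fix g h assume g: "g \<in> (\<Pi>\<^sub>E i\<in>{..<n}. Wc i)" and h: "h \<in> (\<Pi>\<^sub>E i\<in>{..<n}. Wc i)" and eq: "prodW [0..<n] g = prodW [0..<n] h"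
    show "g = h"
    proof (rule PiE_ext[OF g h])
      fix i assume "i \<in> {..<n}"
      then have i: "i < n" by simp
      have gi: "g i \<in> Wc i" "h i \<in> Wc i" using g h i by auto
      show "g i = h i"
      proof (rule W_ext)
        show "g i \<in> W" "h i \<in> W" using gi Wc_W by auto
        fix j u assume j: "j < n" "u \<in> V j"
        show "g i u = h i u"
        proof (cases "j = i")
          case True then show ?thesis using act(2)[OF g j] act(2)[OF h j] eq by simp
        next
          case False then show ?thesis using gi j by (simp add: Wc_def)
        qed
      qed
    qed
  qed
  have surj: "prodW [0..<n] ` (\<Pi>\<^sub>E i\<in>{..<n}. Wc i) = W"
  proof (intro subset_antisym subsetI)
    fix g assume "g \<in> prodW [0..<n] ` (\<Pi>\<^sub>E i\<in>{..<n}. Wc i)" then show "g \<in> W" using act(1) by blast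
  next
    fix g assume g: "g \<in> W"
    obtain h where h: "\<forall>i<n. h i \<in> Wc i" "\<forall>i<n. \<forall>u\<in>V i. g u = h i u" using components[OF g] by blast
    have h': "restrict h {..<n} \<in> (\<Pi>\<^sub>E i\<in>{..<n}. Wc i)" using h(1) by auto
    have "prodW [0..<n] (restrict h {..<n}) = g"
      by (rule W_ext[OF act(1)[OF h'] g]) (use act(2)[OF h'] h(2) in auto)
    then show "g \<in> prodW [0..<n] ` (\<Pi>\<^sub>E i\<in>{..<n}. Wc i)" using h' by blast
  qed
  show ?thesis unfolding iso_def bij_betw_def hom_def
    using inj surj act(1) hom by (auto simp: Pi_def)
qed

text \<open>A reflection of \<open>W\<close> restricts to \<open>V i\<close> as a reflection or as
  the identity, which gives generation. Irreducibility is inherited because \<open>W\<close> acts on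
  \<open>V i\<close> through its i-th components.\<close>

lemma Wc_reflection_group:
  assumes i: "i < n"
  shows "finite_reflection_group scale (V i) ((\<lambda>g. restrict g (V i)) ` Wc i)"
    "irreducible_action scale (V i) ((\<lambda>g. restrict g (V i)) ` Wc i)"
proof -
  let ?U = "V i" and ?K = "(\<lambda>g. restrict g (V i)) ` Wc i"
  interpret GL: group "GL scale ?U" by (rule group_GL[OF subV[OF i]])
  have resGL: "restrict g ?U \<in> carrier (GL scale ?U)" if g: "g \<in> W" for g
  proof -
    have "bij_betw (restrict g ?U) ?U ?U"
      by (rule bij_betw_byWitness[of _ "inv_into UNIV g"])
        (use V_stable[OF i g] V_stable[OF i W_inv[OF g]] inv_W[OF g] in auto)
    then show ?thesis using W_lin[OF g] subV[OF i] by (auto simp: GL_carrier_iff lin_simps subspace_add subspace_scale)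
  qed
  have resmult: "restrict g ?U \<otimes>\<^bsub>GL scale ?U\<^esub> restrict h ?U = restrict (g \<circ> h) ?U" if "g \<in> W" "h \<in> W" for g h
    unfolding GL_mult[OF resGL[OF that(1)] resGL[OF that(2)]]
    using V_stable[OF i that(2)] by (auto simp: compose_def restrict_def)
  have resid: "restrict id ?U = \<one>\<^bsub>GL scale ?U\<^esub>" unfolding GL_one by (auto simp: restrict_def)
  have resinv: "inv\<^bsub>GL scale ?U\<^esub> (restrict g ?U) = restrict (inv_into UNIV g) ?U" if g: "g \<in> W" for g
  proof (rule GL.inv_equality[OF _ resGL[OF g] resGL[OF W_inv[OF g]]])
    have "inv_into UNIV g \<circ> g = id" using inv_W[OF g] by (auto simp: fun_eq_iff)
    then show "restrict (inv_into UNIV g) ?U \<otimes>\<^bsub>GL scale ?U\<^esub> restrict g ?U = \<one>\<^bsub>GL scale ?U\<^esub>"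
      using resmult[OF W_inv[OF g] g] resid by metis
  qed
  have sgK: "subgroup ?K (GL scale ?U)"
  proof (rule GL.subgroupI)
    show "?K \<subseteq> carrier (GL scale ?U)" using resGL Wc_W by blast
    show "?K \<noteq> {}" using Wc_id by blast
    fix a assume "a \<in> ?K"
    then obtain g where g: "g \<in> Wc i" "a = restrict g ?U" by blast
    have gW: "g \<in> W" using g Wc_W by blast
    show "inv\<^bsub>GL scale ?U\<^esub> a \<in> ?K" unfolding g(2) resinv[OF gW] using Wc_inv[OF g(1)] by blast
    fix b assume "b \<in> ?K"
    then obtain h where h: "h \<in> Wc i" "b = restrict h ?U" by blast
    have hW: "h \<in> W" using h Wc_W by blast
    show "a \<otimes>\<^bsub>GL scale ?U\<^esub> b \<in> ?K" unfolding g(2) h(2) resmult[OF gW hW] using Wc_comp[OF g(1) h(1)] by blast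
  qed
  have finK: "finite ?K" using finite_subset[OF Wc_W finW] by blast
  let ?R = "{k \<in> ?K. is_reflection scale ?U k}"
  have Rc: "?R \<subseteq> carrier (GL scale ?U)" using subgroup.subset[OF sgK] by blast
  have "restrict g ?U \<in> generate (GL scale ?U) ?R" if "g \<in> W" for g
    using that
  proof (induction rule: W_induct)
    case id show ?case unfolding resid by (rule generate.one)
  next
    case (reflection s)
    obtain j f v where j: "j < n" "s \<in> Wc j" "lform f" "\<exists>u\<in>V j. f u \<noteq> 0" "v \<in> V j" "v \<noteq> 0" "s = (\<lambda>u. u + f u *s v)"
      by (rule reflection_component[OF reflection])
    show ?case
    proof (cases "j = i")
      case True
      have sK: "restrict s ?U \<in> ?K" using j(2) True by blast
      have "\<forall>u\<in>?U. restrict s ?U u = u + f u *s v" using j(7) by simp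
      then have "is_reflection scale ?U (restrict s ?U)"
        unfolding is_reflection_iff[OF subV[OF i] sgK finK sK] using j(3,4,5,6) True by blast
      then show ?thesis using sK by (intro generate.incl) blast
    next
      case False
      then have "restrict s ?U = \<one>\<^bsub>GL scale ?U\<^esub>"
        unfolding GL_one using j(2) i by (auto simp: Wc_def restrict_def fun_eq_iff)
      then show ?thesis using generate.one by metis
    qed
  next
    case (inv s)
    show ?case unfolding resinv[OF inv(1), symmetric] by (rule GL.generate_m_inv_closed[OF Rc inv(2)])
  next
    case (comp s t)
    show ?case unfolding resmult[OF comp(1,2), symmetric] by (rule generate.eng[OF comp(3,4)])
  qed
  then have "?K \<subseteq> generate (GL scale ?U) ?R" using Wc_W by blast
  moreover have "generate (GL scale ?U) ?R \<subseteq> ?K" by (rule GL.generate_subgroup_incl[OF _ sgK]) blast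
  ultimately have "?K = generate (GL scale ?U) ?R" by blast
  then show "finite_reflection_group scale ?U ?K" unfolding finite_reflection_group_def using sgK finK by blast
  show "irreducible_action scale ?U ?K" unfolding irreducible_action_def
  proof (intro conjI allI impI)
    show "?U \<noteq> {0}" using irr[OF i] by (simp add: irred_def)
    fix S assume S: "subspace S \<and> S \<subseteq> ?U \<and> (\<forall>g\<in>?K. g ` S \<subseteq> S)"
    have "g u \<in> S" if g: "g \<in> W" and u: "u \<in> S" for g u
    proof -
      obtain h where h: "\<forall>i<n. h i \<in> Wc i" "\<forall>i<n. \<forall>u\<in>V i. g u = h i u" using components[OF g] by blast
      have uU: "u \<in> ?U" using S u by blast
      have "restrict (h i) ?U \<in> ?K" using h(1) i by blast
      then have "restrict (h i) ?U u \<in> S" using S u by blast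
      then show ?thesis using h(2) i uU by simp
    qed
    then have "stable S" using S by (simp add: stable_def)
    then show "S = {0} \<or> S = ?U" using irr[OF i] S by (simp add: irred_def)
  qed
qed

lemma irreducible_decomposition_Wc: "irreducible_decomposition scale W n V Wc"
  unfolding irreducible_decomposition_def
proof (intro conjI allI impI ballI)
  show "direct_sum_decomposition scale (fixed_space W) n V" by (rule dsd)
  show "subgroup (Wc i) (GL scale UNIV)" "Wc i \<subseteq> W" for i using Wc_subgroup Wc_W by blast+
  show "(\<lambda>g. foldr (\<lambda>i h. g i \<otimes>\<^bsub>GL scale UNIV\<^esub> h) [0..<n] \<one>\<^bsub>GL scale UNIV\<^esub>)
       \<in> iso (product_group {..<n} (\<lambda>i. (GL scale UNIV)\<lparr>carrier := Wc i\<rparr>)) ((GL scale UNIV)\<lparr>carrier := W\<rparr>)"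
    using prodW_iso by (simp only: prodW_def[abs_def])
  show "finite_reflection_group scale (V i) ((\<lambda>g. restrict g (V i)) ` Wc i)"
    "irreducible_action scale (V i) ((\<lambda>g. restrict g (V i)) ` Wc i)" if "i < n" for i
    using Wc_reflection_group[OF that] by blast+
  show "g v = v" if "i < n" "j < n" "j \<noteq> i" "g \<in> Wc i" "v \<in> V j" for i j g v using that by (simp add: Wc_def)
qed

end

lemma ex_irreducible_decomposition: "\<exists>n V W'. irreducible_decomposition scale W n V W'"
proof -
  obtain n V where "direct_sum_decomposition scale (fixed_space W) n V" "\<And>i. i < n \<Longrightarrow> irred (V i)"
    using ex_invariant_decomposition by blast
  then show ?thesis using irreducible_decomposition_Wc by blast
qed

end

section \<open>Supersolvable reflection arrangements\<close>

context refl_factor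
begin

text \<open>Vectors on all hyperplanes are fixed by \<open>G\<close>, and the fixed vectors in
  \<open>U\<close> form a stable subspace. If this were all of \<open>U\<close>, every line of
  \<open>U\<close> would be stable and irreducibility would force rank one. The result makes
  \<open>C\<close> itself a flat.\<close>

lemma Inter_arr: assumes d: "2 \<le> dim U" shows "\<Inter>(arr G) = C"
proof (intro subset_antisym subsetI)
  fix c assume "c \<in> C" then show "c \<in> \<Inter>(arr G)" using arr_C by blast
next
  fix v assume v: "v \<in> \<Inter>(arr G)"
  obtain u c where u: "u \<in> U" "c \<in> C" "v = u + c" using UC_sum by blast
  define S where "S = {u \<in> U. \<forall>g\<in>G. g u = u}"
  have fix_u: "g u = u" if "g \<in> mcl {g \<in> G. reflection g}" for g
    using that
  proof (induction rule: mcl.induct)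
    case (step s g)
    then have H: "{u. s u = u} \<in> arr G" unfolding arr_def by blast
    then have "v \<in> {u. s u = u}" "c \<in> {u. s u = u}" using v arr_C u(2) by blast+
    moreover have "lin s" using G_lin step by blast
    ultimately have "s u = u" using u(3) by (simp add: lin_simps)
    then show ?case using step by simp
  qed simp
  then have uS: "u \<in> S" unfolding S_def using u(1) G_gen by blast
  have sS: "subspace S" using subU by (auto simp: S_def subspace_def lin_simps[OF G_lin])
  have "S = {0} \<or> S = U"
  proof (rule irr[OF sS])
    show "S \<subseteq> U" by (auto simp: S_def)
    fix g u assume "g \<in> G" "u \<in> S"
    moreover from this have "g u = u" by (simp add: S_def)
    ultimately show "g u \<in> S" by simp
  qed
  moreover have "S \<noteq> U"
  proof
    assume SU: "S = U"
    obtain w where w: "w \<in> U" "w \<noteq> 0" using U_ne subspace_0[OF subU] by blast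
    have "span {w} = {0} \<or> span {w} = U"
    proof (rule irr)
      show sub: "span {w} \<subseteq> U" using w subU by (intro span_minimal) auto
      fix g u assume gu: "g \<in> G" "u \<in> span {w}"
      then have "u \<in> S" using sub SU by blast
      then have "g u = u" using gu(1) by (simp add: S_def)
      then show "g u \<in> span {w}" using gu(2) by simp
    qed simp
    then have "span {w} = U" using w span_base[of w "{w}"] by blast
    then have "dim U = dim {w}" using dim_span by metis
    then show False using d w by simp
  qed
  ultimately have "u = 0" using uS by blast
  then show "v \<in> C" using u by simp
qed

text \<open>The classification delivers \<open>r\<close> and \<open>m\<close>, and \<open>p\<close>
  is \<open>r div m\<close>. As \<open>m\<close> is at least 2 and divides \<open>r\<close>, the
  case \<open>r = 2\<close> leaves \<open>m = 2\<close>, which is type B; otherwise \<open>r\<close>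
  is at least 3, and \<open>m \<ge> 2\<close> becomes \<open>p \<noteq> r\<close>.\<close>

theorem supersolvable_factor_type:
  assumes q: "modular_line q" "q \<notin> C" and d: "3 \<le> dim U"
  shows "(\<exists>l\<ge>3. isomorphic_reflection_group scale U K l (coxeter_group coxeter_matrix_A l) \<or>
              isomorphic_reflection_group scale U K l (coxeter_group (coxeter_matrix_B l) l)) \<or>
       (\<exists>r p l. r \<ge> 3 \<and> l \<ge> 3 \<and> p \<ge> 1 \<and> p dvd r \<and> p \<noteq> r \<and>
              isomorphic_reflection_group scale U K l (monomial_group r p l))"
proof -
  have CL: "C \<in> LL" using Inter_arr d by (auto simp: intersection_lattice_def intro!: exI[of _ "arr G"])
  let ?l = "dim U"
  from q CL refl d show ?thesis
  proof (cases rule: modular_line_classification)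
    case (A e x)
    then have "isomorphic_reflection_group scale U K ?l (coxeter_group coxeter_matrix_A ?l)"
      using isomorphic_A_iff[of ?l] d by auto
    then show ?thesis using d by blast
  next
    case (M e x r m)
    show ?thesis
    proof (cases "r = 2")
      case True
      then have "m = 2" using M(2,3) dvd_imp_le[of m 2] by simp
      then have "isomorphic_reflection_group scale U K ?l (coxeter_group (coxeter_matrix_B ?l) ?l)"
        using isomorphic_B_iff[of ?l] M d True by auto
      then show ?thesis using d by blast
    next
      case False
      let ?p = "r div m"
      have "m \<le> r" using M(3,4) dvd_imp_le by blast
      then have r3: "3 \<le> r" using False M(2) by simp
      have mp: "m * ?p = r" using M(3) by simp
      then have p: "?p dvd r" "1 \<le> ?p" using M(4) by (metis dvd_triv_right, metis Suc_leI One_nat_def gr0I mult_0_right less_irrefl)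
      have pm: "r div ?p = m" using mp p(2) by (metis nonzero_mult_div_cancel_right not_one_le_zero)
      have "?p \<noteq> r"
      proof
        assume "?p = r"
        then have "m * r = r" using mp by simp
        then show False using M(2,4) by simp
      qed
      moreover have "isomorphic_reflection_group scale U K ?l (monomial_group r ?p ?l)"
        using isomorphic_monomial_iff[of ?l ?p r] p(1) M(4,1,5) d pm by auto
      ultimately show ?thesis using r3 p d by blast
    qed
  qed
qed

theorem ss_factor:
  assumes "dim U \<le> 2 \<or>
       (\<exists>l\<ge>3. isomorphic_reflection_group scale U K l (coxeter_group coxeter_matrix_A l) \<or>
              isomorphic_reflection_group scale U K l (coxeter_group (coxeter_matrix_B l) l)) \<or>
       (\<exists>r p l. r \<ge> 3 \<and> l \<ge> 3 \<and> p \<ge> 1 \<and> p dvd r \<and> p \<noteq> r \<and>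
              isomorphic_reflection_group scale U K l (monomial_group r p l))"
  shows "ss (arr G)"
proof -
  have mono: "ss (arr G)" if x: "coords U C l e x" and G: "G = mcl (swaps l e x r \<union> diags l e x m)"
    and m: "m dvd r" "2 \<le> m" "0 < r" and l: "3 \<le> l" for l e x r m
    using arr_monomial[OF x G m] ss_std_arr[OF x m(3), of l] l by simp
  from assms consider "dim U \<le> 2"
    | l where "3 \<le> l" "isomorphic_reflection_group scale U K l (coxeter_group coxeter_matrix_A l)"
    | l where "3 \<le> l" "isomorphic_reflection_group scale U K l (coxeter_group (coxeter_matrix_B l) l)"
    | r p l where "r \<ge> 3" "l \<ge> 3" "p \<ge> 1" "p dvd r" "p \<noteq> r" "isomorphic_reflection_group scale U K l (monomial_group r p l)"
    by blast
  then show ?thesis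
  proof cases
    case 1 then show ?thesis by (rule ss_dim_le_2)
  next
    case 2
    then obtain e x where x: "coords U C l e x" "G = mcl (swaps l e x 1 \<union> sg l e x ` {..<l})"
      using isomorphic_A_iff[of l] by auto
    show ?thesis using arr_type_A[OF x 2(1)] ss_std_arr[OF x(1), of 1 l] by simp
  next
    case 3
    then obtain e x where x: "coords U C l e x" "G = mcl (swaps l e x 2 \<union> diags l e x 2)"
      using isomorphic_B_iff[of l] by auto
    show ?thesis by (rule mono[OF x]) (use 3 in auto)
  next
    case 4
    then obtain e x where x: "coords U C l e x" "G = mcl (swaps l e x r \<union> diags l e x (r div p))"
      using isomorphic_monomial_iff[of l p r] by auto
    obtain t where t: "r = p * t" using 4(4) by blast
    \<comment> \<open>\<open>t = 1\<close> would mean \<open>p = r\<close>; with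
      \<open>t \<ge> 2\<close> there are nontrivial diagonal reflections, and the coordinate
      hyperplanes are present.\<close>
    have "t \<noteq> 0" "t \<noteq> 1" using t 4(1,5) by (auto intro: ccontr)
    moreover have "r div p = t" using t 4(3) by simp
    ultimately have "2 \<le> r div p" "r div p dvd r" using t by auto
    then show ?thesis using mono[OF x] 4(1,2) by simp
  qed
qed

end

section \<open>Passage between the group and its factors\<close>

context decomposed
begin

text \<open>A hyperplane belonging to another factor contains \<open>V i\<close>; if it contained
  \<open>co i\<close> too, it would be the whole space.\<close>

lemma arr_W_co: assumes i: "i < n" and H: "H \<in> arr W" "co i \<subseteq> H" shows "H \<in> arr (W' i)"
proof -
  obtain j where j: "j < n" "H \<in> arr (W' j)" using H(1) arr_W by blast
  have "j = i"
  proof (rule ccontr)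
    assume ne: "j \<noteq> i"
    interpret F: refl_factor scale Basis "V j" "co j" "W' j" by (rule refl_factor[OF j(1)])
    have "V i \<subseteq> H" using V_in_co[OF j(1) i] ne F.arr_C[OF j(2)] by blast
    then have "v \<in> H" for v
      using V_co_sum[OF i, of v] H(2) hyp_subspace[OF arr_hyp[OF H(1)]] subspace_add by blast
    moreover have "H \<noteq> UNIV" using arr_hyp[OF H(1)] by (auto simp: hyp_def)
    ultimately show False by blast
  qed
  then show ?thesis using j by simp
qed

lemma lattice_co:
  assumes i: "i < n" and Y: "Y \<in> intersection_lattice (arr W)" "co i \<subseteq> Y"
  shows "Y \<in> intersection_lattice (arr (W' i))"
proof -
  obtain B where B: "B \<subseteq> arr W" "Y = \<Inter>B" using Y(1) by (auto simp: intersection_lattice_def)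
  have "B \<subseteq> arr (W' i)" using arr_W_co[OF i] B Y(2) by blast
  then show ?thesis using B(2) by (auto simp: intersection_lattice_def)
qed

text \<open>The first chain member inside \<open>co i\<close> and its predecessor \<open>X j\<close>
  differ by one vector \<open>q\<close> outside \<open>co i\<close>. A flat of the factor contains
  \<open>co i\<close>, so adding \<open>X j\<close> to it amounts to adding the line of
  \<open>q\<close>, and modularity of \<open>X j\<close> makes the result a flat.\<close>

lemma supersolvable_modular_line:
  assumes ss: "supersolvable scale (arr W)" and i: "i < n" and d: "3 \<le> dim (V i)"
  shows "\<exists>q. refl_factor.modular_line scale (W' i) q \<and> q \<notin> co i"
proof -
  interpret F: refl_factor scale Basis "V i" "co i" "W' i" by (rule refl_factor[OF i])
  let ?A = "arr W"
  let ?N = "codim scale (\<Inter>?A)"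
  obtain X where X: "X 0 = UNIV \<and> X ?N = \<Inter>?A \<and> (\<forall>i \<le> ?N. modular_element ?A (X i)) \<and>
        (\<forall>i < ?N. X (Suc i) \<subset> X i \<and> \<not> (\<exists>Y\<in>intersection_lattice ?A. X (Suc i) \<subset> Y \<and> Y \<subset> X i))"
    using ss unfolding supersolvable_def by (elim exE)
  have AA: "arr (W' i) \<subseteq> ?A" using arr_W i by blast
  \<comment> \<open>By the rank bound the hyperplanes of the factor intersect in
    \<open>co i\<close>, so the chain does end inside it.\<close>
  have "\<Inter>?A \<subseteq> co i" using F.Inter_arr d AA by auto
  then have PN: "X ?N \<subseteq> co i" using X by simp
  have P0: "\<not> X 0 \<subseteq> co i"
  proof
    assume "X 0 \<subseteq> co i"
    then have "V i \<subseteq> co i" using X by auto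
    then have "V i = {0}" using V_co_Int[OF i] subspace_0[OF subV[OF i]] by blast
    then show False using F.U_ne by blast
  qed
  define k where "k = (LEAST k. X k \<subseteq> co i)"
  have k: "X k \<subseteq> co i" unfolding k_def by (rule LeastI[of _ ?N]) (rule PN)
  have "k \<noteq> 0" using k P0 by metis
  then obtain j where j: "k = Suc j" using not0_implies_Suc by blast
  have "k \<le> ?N" unfolding k_def by (rule Least_le) (rule PN)
  then have jN: "j < ?N" using j by simp
  have nj: "\<not> X j \<subseteq> co i" using not_less_Least[of j "\<lambda>k. X k \<subseteq> co i"] j unfolding k_def by auto
  have hA: "hyp H" if "H \<in> ?A" for H using arr_hyp that by blast
  have Lsub: "subspace Y" if "Y \<in> intersection_lattice ?A" for Y
    using that hA by (auto simp: intersection_lattice_def intro!: subspace_INT_hyp)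
  have mod: "modular_element ?A (X j)" "modular_element ?A (X (Suc j))" using X jN by auto
  then have XL: "X j \<in> intersection_lattice ?A" "X (Suc j) \<in> intersection_lattice ?A" by (auto simp: modular_element_def)
  obtain B where B: "B \<subseteq> ?A" "X (Suc j) = \<Inter>B" using XL(2) by (auto simp: intersection_lattice_def)
  have st: "X (Suc j) \<subset> X j" using X jN by simp
  then obtain H where H: "H \<in> B" "\<not> X j \<subseteq> H" using B by blast
  have "X j \<inter> H \<in> intersection_lattice ?A"
  proof -
    obtain B' where "B' \<subseteq> ?A" "X j = \<Inter>B'" using XL(1) by (auto simp: intersection_lattice_def)
    then show ?thesis using H B(1) unfolding intersection_lattice_def by (intro CollectI exI[of _ "insert H B'"]) auto
  qed
  moreover have "X (Suc j) \<subseteq> X j \<inter> H" "X j \<inter> H \<subset> X j" using st B H by auto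
  moreover have "\<not> (\<exists>Y\<in>intersection_lattice ?A. X (Suc j) \<subset> Y \<and> Y \<subset> X j)" using X jN by simp
  \<comment> \<open>The chain has no gaps, so a single hyperplane of the arrangement cuts
    \<open>X j\<close> down to the next member.\<close>
  ultimately have XH: "X (Suc j) = X j \<inter> H" by blast
  obtain q where q: "q \<in> X j" "q \<notin> co i" using nj by blast
  have qH: "q \<notin> H" using q XH k j by blast
  have "{y + t *s q | y t. y \<in> Y} \<in> F.LL" if Y: "Y \<in> F.LL" for Y
  proof -
    have YL: "Y \<in> intersection_lattice ?A" using intersection_lattice_mono[OF AA] Y by blast
    have Yco: "co i \<subseteq> Y" using F.LL_C[OF Y] .
    have eq: "{y + t *s q | y t. y \<in> Y} = X j \<boxplus> Y"
    proof (intro subset_antisym subsetI)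
      fix v assume "v \<in> {y + t *s q | y t. y \<in> Y}"
      then obtain y t where "v = t *s q + y" "y \<in> Y" by (auto simp: add.commute)
      moreover have "t *s q \<in> X j" using q Lsub[OF XL(1)] subspace_scale by blast
      ultimately show "v \<in> X j \<boxplus> Y" by blast
    next
      fix v assume "v \<in> X j \<boxplus> Y"
      then obtain a y where v: "v = a + y" "a \<in> X j" "y \<in> Y" by blast
      obtain t where t: "a - t *s q \<in> H" using hyp_shift[OF hA qH] H B by blast
      have "a - t *s q \<in> X j" using v q Lsub[OF XL(1)] subspace_diff subspace_scale by blast
      then have "a - t *s q \<in> X k" using t XH j by blast
      then have "a - t *s q \<in> Y" using k Yco by blast
      then have "(a - t *s q) + y \<in> Y" using v Lsub[OF YL] subspace_add by blast
      moreover have "v = ((a - t *s q) + y) + t *s q" using v by simp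
      ultimately show "v \<in> {y + t *s q | y t. y \<in> Y}" by blast
    qed
    have "X j \<boxplus> Y \<in> intersection_lattice ?A" using mod(1) YL unfolding modular_element_def by blast
    moreover have "co i \<subseteq> X j \<boxplus> Y"
    proof
      fix c assume "c \<in> co i"
      then have "c = 0 + c" "0 \<in> X j" "c \<in> Y" using Yco subspace_0[OF Lsub[OF XL(1)]] by auto
      then show "c \<in> X j \<boxplus> Y" by blast
    qed
    ultimately show ?thesis unfolding eq using lattice_co[OF i] by blast
  qed
  then have "F.modular_line q" unfolding F.modular_line_def by blast
  then show ?thesis using q(2) by blast
qed

text \<open>The factors satisfy the condition of \<open>ss_union\<close>: \<open>V k\<close> lies in
  every hyperplane of the other factors, and \<open>co k\<close> in every hyperplane of the k-th
  one.\<close>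

lemma ss_arr_W: assumes "\<And>i. i < n \<Longrightarrow> ss (arr (W' i))" shows "ss (arr W)"
proof -
  have "ss (\<Union>i<k. arr (W' i))" if "k \<le> n" for k
    using that
  proof (induction k)
    case 0 then show ?case using ss.empty by simp
  next
    case (Suc k)
    have k: "k < n" using Suc by simp
    have "ss ((\<Union>i<k. arr (W' i)) \<union> arr (W' k))"
    proof (rule ss_union[OF assms[OF k]])
      show "ss (\<Union>i<k. arr (W' i))" using Suc by simp
      fix v
      obtain u c where u: "u \<in> V k" "c \<in> co k" "v = u + c" using V_co_sum[OF k] by blast
      have "c \<in> H" if "H \<in> arr (W' k)" for H using refl_factor.arr_C[OF refl_factor[OF k] that] u by blast
      moreover have "u \<in> H" if "j < k" "H \<in> arr (W' j)" for j H
      proof -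
        have j: "j < n" using that k by simp
        show ?thesis using refl_factor.arr_C[OF refl_factor[OF j] that(2)] V_in_co[OF j k] that(1) u(1) by blast
      qed
      ultimately show "\<exists>a\<in>\<Inter>(\<Union>i<k. arr (W' i)). \<exists>b\<in>\<Inter>(arr (W' k)). v = a + b" using u(3) by blast
    qed
    then show ?case by (simp add: lessThan_Suc Un_commute)
  qed
  then show ?thesis using arr_W by simp
qed

end

theorem theorem1p2:
  fixes scale :: "complex \<Rightarrow> 'v::ab_group_add \<Rightarrow> 'v" and Basis :: "'v set"
    and W :: "('v \<Rightarrow> 'v) set"
  assumes "finite_dimensional_vector_space scale Basis"
    and "finite_reflection_group scale UNIV W"
  shows "supersolvable scale (reflection_arrangement scale W) \<longleftrightarrow>
    (\<forall>U K. irreducible_factor scale W U K \<longrightarrow>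
       vector_space.dim scale U \<le> 2 \<or>
       (\<exists>l\<ge>3. isomorphic_reflection_group scale U K l (coxeter_group coxeter_matrix_A l) \<or>
              isomorphic_reflection_group scale U K l (coxeter_group (coxeter_matrix_B l) l)) \<or>
       (\<exists>r p l. r \<ge> 3 \<and> l \<ge> 3 \<and> p \<ge> 1 \<and> p dvd r \<and> p \<noteq> r \<and>
              isomorphic_reflection_group scale U K l (monomial_group r p l)))"
    (is "?L \<longleftrightarrow> ?R")
proof -
  interpret finite_dimensional_vector_space scale Basis by (rule assms(1))
  have W: "subgroup W (GL scale UNIV)" "finite W"
    "W = generate (GL scale UNIV) {g \<in> W. is_reflection scale UNIV g}"
    using assms(2) unfolding finite_reflection_group_def by blast+
  interpret finite_refl_group scale Basis W
    by (intro finite_refl_group.intro finite_linear_group.intro cspace.intro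
        finite_linear_group_axioms.intro finite_refl_group_axioms.intro assms(1) W)
  have arrW: "reflection_arrangement scale W = arr W" by (rule reflection_arrangement_arr[OF sgW finW])
  show ?thesis
  proof
    assume L: ?L
    show ?R
    proof (intro allI impI)
      fix U K assume "irreducible_factor scale W U K"
      then obtain n V W' i where dec: "irreducible_decomposition scale W n V W'" and i: "i < n"
        and UK: "U = V i" "K = (\<lambda>g. restrict g (V i)) ` W' i" unfolding irreducible_factor_def by blast
      interpret decomposed scale Basis W n V W'
        by (intro decomposed.intro finite_linear_group_axioms decomposed_axioms.intro dec)
      interpret F: refl_factor scale Basis "V i" "co i" "W' i" by (rule refl_factor[OF i])
      show "dim U \<le> 2 \<or>
       (\<exists>l\<ge>3. isomorphic_reflection_group scale U K l (coxeter_group coxeter_matrix_A l) \<or>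
              isomorphic_reflection_group scale U K l (coxeter_group (coxeter_matrix_B l) l)) \<or>
       (\<exists>r p l. r \<ge> 3 \<and> l \<ge> 3 \<and> p \<ge> 1 \<and> p dvd r \<and> p \<noteq> r \<and>
              isomorphic_reflection_group scale U K l (monomial_group r p l))"
      proof (cases "dim U \<le> 2")
        case False
        then have d: "3 \<le> dim (V i)" using UK by simp
        obtain q where q: "F.modular_line q" "q \<notin> co i"
          using supersolvable_modular_line[OF L[unfolded arrW] i d] by blast
        show ?thesis unfolding UK using F.supersolvable_factor_type[OF q d] by (rule disjI2)
      qed simp
    qed
  next
    assume R: ?R
    \<comment> \<open>The condition speaks of the factors of all decompositions and would be empty
      without one, so the existence of a decomposition enters here.\<close>
    obtain n V W' where dec: "irreducible_decomposition scale W n V W'" using ex_irreducible_decomposition by blast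
    interpret decomposed scale Basis W n V W'
        by (intro decomposed.intro finite_linear_group_axioms decomposed_axioms.intro dec)
    have "ss (arr W)"
    proof (rule ss_arr_W)
      fix i assume i: "i < n"
      interpret F: refl_factor scale Basis "V i" "co i" "W' i" by (rule refl_factor[OF i])
      have "irreducible_factor scale W (V i) ((\<lambda>g. restrict g (V i)) ` W' i)"
        unfolding irreducible_factor_def using dec i by blast
      then show "ss (arr (W' i))" using R F.ss_factor by blast
    qed
    then show ?L unfolding arrW by (rule ss_supersolvable)
  qed
qed

end
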